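(* Let $f\in L^2(0,2\pi)$. For $M,k\in\mathbb{N}$ let $V_{M,k}$ denote any minimiser of $V\mapsto \|P_M(Ex(\cdot,Z(V))-f)\|_2^2$ over all lists $V$ of $k$ vectors in $\mathbb{R}^2$. Then for any sequences $M_i\to\infty$, $k_i\to\infty$ there exist a subsequence $(M_{i_j},k_{i_j})_j$ and a zonoid $\mathcal{M}$ such that, as $j\to\infty$, \begin{itemize} \item $Ex(\cdot,Z(V_{M_{i_j},k_{i_j}}))\overset{*}{\rightharpoonup}Ex(\cdot,\mathcal{M})$ weakly-* in $W^{1,\infty}(\mathbb{S}^1)$; \item $Ex(\cdot,Z(V_{M_{i_j},k_{i_j}}))\to Ex(\cdot,\mathcal{M})$ strongly in $W^{1,p}(\mathbb{S}^1)$ for every $p<\infty$; \item $\frac{d^2}{d\theta^2}Ex(\cdot,Z(V_{M_{i_j},k_{i_j}}))\overset{*}{\rightharpoonup}\frac{d^2}{d\theta^2}Ex(\cdot,\mathcal{M})$ weakly-* in $C(\mathbb{S}^1)^*$; \item $Z(V_{M_{i_j},k_{i_j}})\to\mathcal{M}$ in the Hausdorff metric; \end{itemize} and $$\|Ex(\cdot,\mathcal{M})-f\|_2^2=\inf_{\tilde{\mathcal{M}}\text{ zonoid}}\|Ex(\cdot,\tilde{\mathcal{M}})-f\|_2^2 .$$ In particular, if $f$ is the excluded area function of some zonoid, then $f=Ex(\cdot,\mathcal{M})$.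
   Context: For a list $V=(v_i)_{i=1}^k$ of vectors in $\mathbb{R}^2$ (zero vectors allowed), the zonotope is $Z(V)=\{\sum_{i=1}^k a_iv_i:a_i\in[-\frac12,\frac12]\}$. A zonoid is a Hausdorff-metric limit of zonotopes; in $\mathbb{R}^2$ these are exactly the non-empty compact convex sets $\mathcal{M}$ with $-\mathcal{M}=\mathcal{M}$. The excluded area function of a compact convex set is $Ex(\theta,\mathcal{M})=|\mathcal{M}-R_\theta\mathcal{M}|$, where $R_\theta$ is the counterclockwise rotation by $\theta$, $A-B=\{a-b:a\in A,b\in B\}$ and $|\cdot|$ is area. For a zonoid $Ex(\cdot,\mathcal{M})$ is even and $\pi$-periodic, so its Fourier series contains only the modes $\cos(2m\theta)$, $m\ge0$. $\|\cdot\|_2$ is the norm of $L^2(0,2\pi)$ and $P_M$ is the orthogonal projection of $L^2(0,2\pi)$ onto $\mathrm{span}\{\cos(2m\theta):0\le m\le M\}$ (the first $M$ even Fourier modes). $\mathbb{S}^1$ is identified with $\mathbb{R}/2\pi\mathbb{Z}$; second derivatives of excluded area functions are finite Radon measures, regarded as elements of $C(\mathbb{S}^1)^*$. *)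

theory Defs
  imports "HOL-Analysis.Analysis"
begin

subsection \<open>Zonotopes, zonoids and the excluded area\<close>

definition zonotope :: "(real^2) list \<Rightarrow> (real^2) set" where
  "zonotope V =
     {(\<Sum>i<length V. a i *\<^sub>R V ! i) | a :: nat \<Rightarrow> real. \<forall>i<length V. a i \<in> {-1/2..1/2}}"

text \<open>This is the Hausdorff metric on non-empty compact sets. On other arguments the suprema may
  be meaningless.\<close>

definition hausdorff_dist :: "'a::metric_space set \<Rightarrow> 'a set \<Rightarrow> real" where
  "hausdorff_dist A B = max (SUP a\<in>A. infdist a B) (SUP b\<in>B. infdist b A)"

definition zonoid :: "(real^2) set \<Rightarrow> bool" where
  "zonoid K \<longleftrightarrow> K \<noteq> {} \<and> compact K \<and>
     (\<exists>W :: nat \<Rightarrow> (real^2) list. (\<lambda>n. hausdorff_dist (zonotope (W n)) K) \<longlonglongrightarrow> 0)"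

definition rot :: "real \<Rightarrow> real^2 \<Rightarrow> real^2" where
  "rot \<theta> x = vector [cos \<theta> * x $ 1 - sin \<theta> * x $ 2, sin \<theta> * x $ 1 + cos \<theta> * x $ 2]"

definition excluded_area :: "real \<Rightarrow> (real^2) set \<Rightarrow> real" where
  "excluded_area \<theta> K = measure lebesgue {a - b | a b. a \<in> K \<and> b \<in> rot \<theta> ` K}"


subsection \<open>Lebesgue spaces and projection onto even Fourier modes\<close>

text \<open>Functions on the circle are functions on the reals, used up to null sets on
  the interval from 0 to \<open>2 * pi\<close>. Periodicity is required of the test functions below.\<close>

abbreviation circ :: "real measure" where
  "circ \<equiv> lebesgue_on {0<..<2*pi}"

definition in_Lp :: "real \<Rightarrow> (real \<Rightarrow> real) \<Rightarrow> bool" where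
  "in_Lp p g \<longleftrightarrow> g \<in> borel_measurable circ \<and> integrable circ (\<lambda>\<theta>. \<bar>g \<theta>\<bar> powr p)"

definition Lp_norm :: "real \<Rightarrow> (real \<Rightarrow> real) \<Rightarrow> real" where
  "Lp_norm p g = (\<integral>\<theta>. \<bar>g \<theta>\<bar> powr p \<partial>circ) powr (1 / p)"

definition in_Linf :: "(real \<Rightarrow> real) \<Rightarrow> bool" where
  "in_Linf g \<longleftrightarrow> g \<in> borel_measurable circ \<and> (\<exists>B. AE \<theta> in circ. \<bar>g \<theta>\<bar> \<le> B)"

definition even_modes :: "nat \<Rightarrow> (real \<Rightarrow> real) set" where
  "even_modes M = {(\<lambda>\<theta>. \<Sum>m\<le>M. c m * cos (2 * real m * \<theta>)) | c. True}"

text \<open>Two elements of \<^term>\<open>even_modes M\<close> that agree almost everywhere are equal, so the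
  description is unique whenever \<open>g\<close> is square integrable.\<close>

definition even_proj :: "nat \<Rightarrow> (real \<Rightarrow> real) \<Rightarrow> real \<Rightarrow> real" where
  "even_proj M g =
     (THE p. p \<in> even_modes M \<and> (\<forall>q\<in>even_modes M. (\<integral>\<theta>. (g \<theta> - p \<theta>) * q \<theta> \<partial>circ) = 0))"


subsection \<open>Weak derivatives and Sobolev convergence on the circle\<close>

definition periodic_2pi :: "(real \<Rightarrow> real) \<Rightarrow> bool" where
  "periodic_2pi \<phi> \<longleftrightarrow> (\<forall>\<theta>. \<phi> (\<theta> + 2 * pi) = \<phi> \<theta>)"

definition C_circle :: "(real \<Rightarrow> real) set" where
  "C_circle = {\<phi>. continuous_on UNIV \<phi> \<and> periodic_2pi \<phi>}"

definition smooth_circle :: "(real \<Rightarrow> real) set" where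
  "smooth_circle = {\<phi>. (\<forall>n \<theta>. ((deriv ^^ n) \<phi>) differentiable (at \<theta>)) \<and> periodic_2pi \<phi>}"

definition has_weak_deriv :: "(real \<Rightarrow> real) \<Rightarrow> (real \<Rightarrow> real) \<Rightarrow> bool" where
  "has_weak_deriv u h \<longleftrightarrow> integrable circ u \<and> integrable circ h \<and>
     (\<forall>\<phi>\<in>smooth_circle. (\<integral>\<theta>. u \<theta> * deriv \<phi> \<theta> \<partial>circ) = - (\<integral>\<theta>. h \<theta> * \<phi> \<theta> \<partial>circ))"

text \<open>Weak derivatives are unique almost everywhere, so the choice of \<open>dw\<close> and \<open>du\<close> below is
  immaterial.\<close>

definition tendsto_W1p :: "real \<Rightarrow> (nat \<Rightarrow> real \<Rightarrow> real) \<Rightarrow> (real \<Rightarrow> real) \<Rightarrow> bool" where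
  "tendsto_W1p p w u \<longleftrightarrow> (\<exists>dw du.
     (\<forall>j. in_Lp p (w j) \<and> in_Lp p (dw j) \<and> has_weak_deriv (w j) (dw j)) \<and>
     in_Lp p u \<and> in_Lp p du \<and> has_weak_deriv u du \<and>
     (\<lambda>j. Lp_norm p (\<lambda>\<theta>. w j \<theta> - u \<theta>)) \<longlonglongrightarrow> 0 \<and>
     (\<lambda>j. Lp_norm p (\<lambda>\<theta>. dw j \<theta> - du \<theta>)) \<longlonglongrightarrow> 0)"

text \<open>Weak-* convergence in $W^{1,\infty}$: the functions and their weak derivatives converge
  weakly-* in $L^\infty = (L^1)^*$.\<close>

definition weakstar_W1inf :: "(nat \<Rightarrow> real \<Rightarrow> real) \<Rightarrow> (real \<Rightarrow> real) \<Rightarrow> bool" where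
  "weakstar_W1inf w u \<longleftrightarrow> (\<exists>dw du.
     (\<forall>j. in_Linf (w j) \<and> in_Linf (dw j) \<and> has_weak_deriv (w j) (dw j)) \<and>
     in_Linf u \<and> in_Linf du \<and> has_weak_deriv u du \<and>
     (\<forall>\<psi>. integrable circ \<psi> \<longrightarrow>
        (\<lambda>j. \<integral>\<theta>. w j \<theta> * \<psi> \<theta> \<partial>circ) \<longlonglongrightarrow> (\<integral>\<theta>. u \<theta> * \<psi> \<theta> \<partial>circ) \<and>
        (\<lambda>j. \<integral>\<theta>. dw j \<theta> * \<psi> \<theta> \<partial>circ) \<longlonglongrightarrow> (\<integral>\<theta>. du \<theta> * \<psi> \<theta> \<partial>circ)))"


subsection \<open>Second derivatives as elements of the dual of the continuous functions\<close>

definition C_dual :: "((real \<Rightarrow> real) \<Rightarrow> real) \<Rightarrow> bool" where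
  "C_dual T \<longleftrightarrow>
     (\<forall>\<phi>\<in>C_circle. \<forall>\<psi>\<in>C_circle. T (\<lambda>\<theta>. \<phi> \<theta> + \<psi> \<theta>) = T \<phi> + T \<psi>) \<and>
     (\<forall>c. \<forall>\<phi>\<in>C_circle. T (\<lambda>\<theta>. c * \<phi> \<theta>) = c * T \<phi>) \<and>
     (\<exists>B. \<forall>\<phi>\<in>C_circle. \<bar>T \<phi>\<bar> \<le> B * (SUP \<theta>. \<bar>\<phi> \<theta>\<bar>))"

text \<open>\<open>T\<close> is the distributional second derivative of \<open>u\<close>, a finite signed Radon measure regarded
  as a bounded functional. By density of smooth functions it is unique on \<^term>\<open>C_circle\<close>.\<close>

definition has_second_deriv_C_dual :: "(real \<Rightarrow> real) \<Rightarrow> ((real \<Rightarrow> real) \<Rightarrow> real) \<Rightarrow> bool" where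
  "has_second_deriv_C_dual u T \<longleftrightarrow> integrable circ u \<and> C_dual T \<and>
     (\<forall>\<phi>\<in>smooth_circle. T \<phi> = (\<integral>\<theta>. u \<theta> * (deriv ^^ 2) \<phi> \<theta> \<partial>circ))"

definition weakstar_second_deriv :: "(nat \<Rightarrow> real \<Rightarrow> real) \<Rightarrow> (real \<Rightarrow> real) \<Rightarrow> bool" where
  "weakstar_second_deriv w u \<longleftrightarrow> (\<exists>S T.
     (\<forall>j. has_second_deriv_C_dual (w j) (S j)) \<and> has_second_deriv_C_dual u T \<and>
     (\<forall>\<phi>\<in>C_circle. (\<lambda>j. S j \<phi>) \<longlonglongrightarrow> T \<phi>))"

end

theory Submission
  imports Defs "HOL-Complex_Analysis.Great_Picard"
begin

text \<open>For a list \<open>V\<close> of vectors, the area formula for zonotopes shows that the excluded area of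
  \<open>Z(V)\<close> is \<open>c + \<Sum>\<^sub>v\<^sub>,\<^sub>w \<bar>det(v, R\<^sub>\<theta> w)\<bar>\<close>, a sum of absolute values of sinusoids whose amplitudes
  add up to \<open>S\<^sup>2\<close>, where \<open>S = \<Sum> \<bar>v\<bar>\<close>. Its mean is at least a multiple of \<open>S\<^sup>2\<close>, so comparing a minimiser with
  the zero list in the zeroth mode bounds \<open>S\<close>, and Blaschke selection gives a Hausdorff limit \<open>K\<close>,
  along which areas converge.

  All these functions are semiconvex with the same constant: adding \<open>S\<^sup>2 \<theta>\<^sup>2 / 2\<close> makes them convex.
  Pointwise convergence of convex functions forces convergence of the derivatives wherever the limit is
  differentiable, hence almost everywhere, and the second derivatives are bounded below with mean zero,
  hence bounded in total variation. This yields the three analytic modes of convergence.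

  For optimality, a fixed competitor \<open>Z(W)\<close> is admissible for all large \<open>k\<close> after padding with zero vectors.
  The difference of two excluded area functions is even and \<open>\<pi>\<close>-periodic, so it is a uniform limit of
  even modes, and the part of the error outside the range of the projection disappears in the limit.
  Zonoids are then reached by continuity.\<close>

subsection \<open>Zonotopes and their area\<close>

text \<open>The projection changes along the sequence, so there is no single functional whose lower
  semicontinuity would give optimality, and the part of \<open>f\<close> outside the even modes need
  not become small. The comparison survives because that part is common to the minimiser and the
  competitor and cancels in their difference. Only the difference of two excluded areas has to be
  near the range of the projection, and its limit can be approximated once, by a mode whose degree
  is independent of \<open>j\<close>.

  Semiconvexity comes from the kinks: the absolute value of a sinusoid is the larger of the sinusoid
  and its negative, so taking it only bends the graph upwards. The amplitude for the pair
  \<open>v\<close>, \<open>w\<close> is the product of the norms, by the Lagrange identity.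

  Area convergence is split in two: outer regularity bounds the areas along the sequence from above,
  and the area formula for slightly enlarged zonotopes bounds them from below.

  Derivatives are everywhere defined selections of slopes. Integration by parts is proved by moving
  difference quotients onto the test function, and second derivatives are functionals extended by
  density from smooth functions, without a representing measure.\<close>

definition det2 :: "real^2 \<Rightarrow> real^2 \<Rightarrow> real" where
  "det2 x y = x $ 1 * y $ 2 - x $ 2 * y $ 1"

lemma zonotope_Nil: "zonotope [] = {0}"
  by (auto simp: zonotope_def)

text \<open>Peeling off the first coefficient exhibits the set as the Minkowski sum of one segment
  with the zonotope of the tail. This is the form that supports list induction.\<close>

lemma zonotope_Cons:
  "zonotope (v # V) = {t *\<^sub>R v + x | t x. t \<in> {-1/2..1/2} \<and> x \<in> zonotope V}"
proof (intro equalityI subsetI)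
  fix y assume "y \<in> zonotope (v # V)"
  then obtain a where a: "y = (\<Sum>i<Suc (length V). a i *\<^sub>R (v # V) ! i)"
    "\<forall>i<Suc (length V). a i \<in> {-1/2..1/2}"
    unfolding zonotope_def by auto
  have "y = a 0 *\<^sub>R v + (\<Sum>i<length V. a (Suc i) *\<^sub>R V ! i)"
    unfolding a(1) sum.lessThan_Suc_shift by simp
  moreover have "(\<Sum>i<length V. a (Suc i) *\<^sub>R V ! i) \<in> zonotope V"
    unfolding zonotope_def using a(2) by (intro CollectI exI[of _ "\<lambda>i. a (Suc i)"]) auto
  ultimately show "y \<in> {t *\<^sub>R v + x | t x. t \<in> {-1/2..1/2} \<and> x \<in> zonotope V}"
    using a(2) by blast
next
  fix y assume "y \<in> {t *\<^sub>R v + x | t x. t \<in> {-1/2..1/2} \<and> x \<in> zonotope V}"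
  then obtain t a where t: "t \<in> {-1/2..1/2}"
    and a: "y = t *\<^sub>R v + (\<Sum>i<length V. a i *\<^sub>R V ! i)" "\<forall>i<length V. a i \<in> {-1/2..1/2}"
    unfolding zonotope_def by blast
  have "y = (\<Sum>i<Suc (length V). (case i of 0 \<Rightarrow> t | Suc j \<Rightarrow> a j) *\<^sub>R (v # V) ! i)"
    unfolding sum.lessThan_Suc_shift a(1) by simp
  then show "y \<in> zonotope (v # V)"
    unfolding zonotope_def using t a(2)
    by (intro CollectI exI[of _ "\<lambda>i. case i of 0 \<Rightarrow> t | Suc j \<Rightarrow> a j"]) (auto split: nat.splits)
qed

lemma zonotope_nonempty: "zonotope V \<noteq> {}"
proof (induction V)
  case (Cons v V)
  then obtain x where "x \<in> zonotope V" by blast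
  then have "0 *\<^sub>R v + x \<in> zonotope (v # V)" unfolding zonotope_Cons by fastforce
  then show ?case by blast
qed (simp add: zonotope_Nil)

lemma compact_zonotope: "compact (zonotope V)"
proof (induction V)
  case (Cons v V)
  have "zonotope (v # V) = (\<lambda>p. fst p *\<^sub>R v + snd p) ` ({-1/2..1/2} \<times> zonotope V)"
    unfolding zonotope_Cons by force
  moreover have "compact ((\<lambda>p. fst p *\<^sub>R v + snd p) ` ({-1/2..1/2} \<times> zonotope V))"
    by (intro compact_continuous_image continuous_intros compact_Times Cons) auto
  ultimately show ?case by simp
qed (simp add: zonotope_Nil)

lemma convex_zonotope: "convex (zonotope V)"
proof (induction V)
  case (Cons v V)
  have "zonotope (v # V) = (\<lambda>p. fst p *\<^sub>R v + snd p) ` ({-1/2..1/2} \<times> zonotope V)"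
    unfolding zonotope_Cons by force
  moreover have "linear (\<lambda>p :: real \<times> (real^2). fst p *\<^sub>R v + snd p)"
    by (rule linearI) (auto simp: algebra_simps)
  then have "convex ((\<lambda>p. fst p *\<^sub>R v + snd p) ` ({-1/2..1/2} \<times> zonotope V))"
    by (intro convex_linear_image convex_Times Cons) auto
  ultimately show ?case by simp
qed (simp add: zonotope_Nil)

lemma zonotope_append:
  "zonotope (U @ V) = {x + y | x y. x \<in> zonotope U \<and> y \<in> zonotope V}"
proof (induction U)
  case (Cons u U)
  show ?case
  proof (intro equalityI subsetI)
    fix z assume "z \<in> zonotope ((u # U) @ V)"
    then obtain t x y where "t \<in> {-1/2..1/2}" "x \<in> zonotope U" "y \<in> zonotope V" "z = t *\<^sub>R u + (x + y)"
      unfolding append_Cons zonotope_Cons Cons by blast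
    then have "t *\<^sub>R u + x \<in> zonotope (u # U)" "z = (t *\<^sub>R u + x) + y"
      unfolding zonotope_Cons by auto
    then show "z \<in> {x + y | x y. x \<in> zonotope (u # U) \<and> y \<in> zonotope V}"
      using \<open>y \<in> zonotope V\<close> by blast
  next
    fix z assume "z \<in> {x + y | x y. x \<in> zonotope (u # U) \<and> y \<in> zonotope V}"
    then obtain t x y where *: "t \<in> {-1/2..1/2}" "x \<in> zonotope U" "y \<in> zonotope V" "z = t *\<^sub>R u + (x + y)"
      unfolding zonotope_Cons by (auto simp: add.assoc)
    then have "x + y \<in> zonotope (U @ V)" unfolding Cons by blast
    then show "z \<in> zonotope ((u # U) @ V)"
      unfolding append_Cons zonotope_Cons using * by blast
  qed
qed (auto simp: zonotope_Nil)

lemma zonotope_map_linear: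
  assumes "linear f"
  shows "zonotope (map f V) = f ` zonotope V"
proof (induction V)
  case (Cons v V)
  interpret linear f by fact
  show ?case
    unfolding list.map zonotope_Cons Cons by (force simp: add scale)
qed (simp add: zonotope_Nil linear_0[OF assms])

lemma zonotope_uminus: "x \<in> zonotope V \<Longrightarrow> - x \<in> zonotope V"
proof (induction V arbitrary: x)
  case (Cons v V)
  then obtain t y where "t \<in> {-1/2..1/2}" "y \<in> zonotope V" "x = t *\<^sub>R v + y"
    unfolding zonotope_Cons by blast
  then have "- t \<in> {-1/2..1/2}" "- y \<in> zonotope V" "- x = (- t) *\<^sub>R v + (- y)"
    using Cons.IH by auto
  then show ?case unfolding zonotope_Cons by blast
qed (auto simp: zonotope_Nil)

lemma zonotope_append_replicate_0: "zonotope (V @ replicate n 0) = zonotope V"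
proof -
  have "zonotope (replicate n 0) = {0}"
    by (induction n) (auto simp: zonotope_Nil zonotope_Cons intro: exI[of _ 0])
  then show ?thesis by (auto simp: zonotope_append)
qed

text \<open>This is the support function of a zonotope in disguise: each generator contributes half
  of \<bar>l w\<bar> on either side of the origin. It serves both to measure the shadow in the area
  formula and to bound the generators by the size of the set.\<close>

lemma linear_image_zonotope:
  fixes l :: "real^2 \<Rightarrow> real"
  assumes "linear l"
  shows "l ` zonotope V = {- (\<Sum>w\<leftarrow>V. \<bar>l w\<bar>) / 2 .. (\<Sum>w\<leftarrow>V. \<bar>l w\<bar>) / 2}"
proof (induction V)
  case Nil
  then show ?case by (simp add: zonotope_Nil linear_0[OF assms])
next
  case (Cons v V)
  define s where "s = (\<Sum>w\<leftarrow>V. \<bar>l w\<bar>)"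
  have s0: "s \<ge> 0" unfolding s_def by (rule sum_list_nonneg) auto
  interpret linear l by fact
  have "l ` zonotope (v # V) = {t * l v + y | t y. t \<in> {-1/2..1/2} \<and> y \<in> l ` zonotope V}"
    unfolding zonotope_Cons by (force simp: add scale)
  also have "\<dots> = {t * l v + y | t y. t \<in> {-1/2..1/2} \<and> y \<in> {- s / 2 .. s / 2}}"
    unfolding Cons s_def ..
  also have "\<dots> = {- (\<bar>l v\<bar> + s) / 2 .. (\<bar>l v\<bar> + s) / 2}" (is "?A = ?B")
  proof (intro equalityI subsetI)
    fix x assume "x \<in> ?A"
    then obtain t y where ty: "x = t * l v + y" "\<bar>t\<bar> \<le> 1/2" "\<bar>y\<bar> \<le> s / 2" by auto
    have "\<bar>t * l v\<bar> \<le> 1/2 * \<bar>l v\<bar>" unfolding abs_mult using ty(2) by (intro mult_right_mono) auto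
    moreover have "\<bar>x\<bar> \<le> \<bar>t * l v\<bar> + \<bar>y\<bar>" unfolding ty(1) by (rule abs_triangle_ineq)
    ultimately have "\<bar>x\<bar> \<le> (\<bar>l v\<bar> + s) / 2" using ty(3) by simp
    then show "x \<in> ?B" by auto
  next
    fix x assume "x \<in> ?B"
    then have x: "\<bar>x\<bar> \<le> (\<bar>l v\<bar> + s) / 2" by auto
    show "x \<in> ?A"
    proof (cases "\<bar>l v\<bar> + s = 0")
      case True
      then show ?thesis using x s0 by (auto intro!: exI[of _ 0])
    next
      case False
      then have pos: "\<bar>l v\<bar> + s > 0" using s0 by linarith
      \<comment> \<open>The point is split in proportion to the two half-widths: the same ratio
        \<open>q\<close>, at most 1/2 in modulus, scales the new segment and the old
        interval.\<close>
      define q where "q = x / (\<bar>l v\<bar> + s)"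
      have q: "\<bar>q\<bar> \<le> 1/2" unfolding q_def using x pos by (simp add: abs_divide divide_simps)
      have "x = (q * sgn (l v)) * l v + q * s"
      proof -
        have "(q * sgn (l v)) * l v + q * s = q * (l v * sgn (l v) + s)" by (simp add: algebra_simps)
        also have "l v * sgn (l v) = \<bar>l v\<bar>" by (rule abs_sgn[symmetric])
        also have "q * (\<bar>l v\<bar> + s) = x" using pos unfolding q_def by simp
        finally show ?thesis ..
      qed
      moreover have "\<bar>q * sgn (l v)\<bar> \<le> 1/2" using q by (auto simp: abs_mult sgn_if)
      moreover have "\<bar>q * s\<bar> \<le> 1/2 * s" unfolding abs_mult using q s0 by (intro mult_mono) auto
      ultimately show ?thesis by (fastforce simp: abs_le_iff)
    qed
  qed
  finally show ?case by (simp add: s_def)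
qed

section \<open>The area formula\<close>

fun zarea :: "(real^2) list \<Rightarrow> real" where
  "zarea [] = 0"
| "zarea (v # V) = zarea V + (\<Sum>w\<leftarrow>V. \<bar>det2 w v\<bar>)"

definition vec_of_pair :: "real \<times> real \<Rightarrow> real^2" where
  "vec_of_pair p = vector [fst p, snd p]"

lemma vec_of_pair_nth [simp]: "vec_of_pair p $ 1 = fst p" "vec_of_pair p $ 2 = snd p"
  by (simp_all add: vec_of_pair_def)

lemma linear_vec_of_pair: "linear vec_of_pair"
  by (rule linearI) (auto simp: vec_eq_iff forall_2)

lemma measurable_vec_of_pair [measurable]: "vec_of_pair \<in> borel_measurable borel"
  by (intro borel_measurable_continuous_onI linear_continuous_on linear_linear[THEN iffD2] linear_vec_of_pair)

lemma Basis_real2: "(Basis :: (real^2) set) = {axis 1 1, axis 2 1}"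
  by (auto simp: Basis_vec_def UNIV_2)

text \<open>Agreement on boxes determines Lebesgue measure. The identification carries Fubini's
  theorem for products over to \<open>real^2\<close>.\<close>

lemma distr_vec_of_pair: "distr lborel lborel vec_of_pair = lborel"
proof (rule lborel_eqI[symmetric])
  fix l u :: "real^2"
  assume le: "\<And>b. b \<in> Basis \<Longrightarrow> l \<bullet> b \<le> u \<bullet> b"
  have ne: "axis 1 1 \<noteq> (axis 2 1 :: real^2)" by (simp add: axis_eq_axis)
  have le': "l $ 1 \<le> u $ 1" "l $ 2 \<le> u $ 2"
    using le[of "axis 1 1"] le[of "axis 2 1"] by (auto simp: inner_axis Basis_real2)
  have "vec_of_pair -` box l u = box (l $ 1, l $ 2) (u $ 1, u $ 2)"
    by (auto simp: mem_box Basis_real2 inner_axis Basis_prod_def)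
  then have "emeasure (distr lborel lborel vec_of_pair) (box l u) = emeasure lborel (box (l $ 1, l $ 2)
      (u $ 1, u $ 2))"
    by (simp add: emeasure_distr)
  also have "\<dots> = ennreal ((u $ 1 - l $ 1) * (u $ 2 - l $ 2))"
    using le' by (simp add: emeasure_lborel_box_eq Basis_prod_def prod.union_disjoint inner_diff_left)
  also have "\<dots> = ennreal (\<Prod>b\<in>Basis. (u - l) \<bullet> b)"
    by (simp add: Basis_real2 ne inner_axis)
  finally show "emeasure (distr lborel lborel vec_of_pair) (box l u) = ennreal (\<Prod>b\<in>Basis. (u - l) \<bullet> b)" .
qed simp

lemma emeasure_compact_slices:
  fixes K :: "(real^2) set"
  assumes "compact K"
  shows "emeasure lborel K = (\<integral>\<^sup>+x. emeasure lborel {y. vector [x, y] \<in> K} \<partial>lborel)"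
proof -
  have K: "K \<in> sets borel" using assms by (simp add: borel_compact)
  have "emeasure lborel K = emeasure lborel (vec_of_pair -` K)"
    using K by (subst distr_vec_of_pair[symmetric]) (simp add: emeasure_distr)
  also have "\<dots> = emeasure (lborel \<Otimes>\<^sub>M lborel) (vec_of_pair -` K)"
    by (simp add: lborel_prod)
  also have "\<dots> = (\<integral>\<^sup>+x. emeasure lborel (Pair x -` (vec_of_pair -` K)) \<partial>lborel)"
    using measurable_sets[OF measurable_vec_of_pair K]
    by (intro lborel.emeasure_pair_measure_alt) (simp only: lborel_prod, simp)
  also have "\<dots> = (\<integral>\<^sup>+x. emeasure lborel {y. vector [x, y] \<in> K} \<partial>lborel)"
    by (simp add: vimage_def vec_of_pair_def)
  finally show ?thesis .
qed

text \<open>Cavalieri's principle: by convexity and compactness every non-empty vertical slice is a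
  closed interval, and adding a unit vertical segment lengthens it by exactly 1. The area therefore
  grows by the length of the shadow on the first axis.\<close>

lemma emeasure_zonotope_vertical:
  fixes V :: "(real^2) list"
  defines "e \<equiv> vector [0, 1] :: real^2"
  shows "emeasure lborel (zonotope (e # V)) = emeasure lborel (zonotope V) + ennreal (\<Sum>w\<leftarrow>V. \<bar>w $ 1\<bar>)"
proof -
  define s where "s = (\<Sum>w\<leftarrow>V. \<bar>w $ 1\<bar>)"
  have s0: "s \<ge> 0" unfolding s_def by (rule sum_list_nonneg) auto
  define P where "P = {- s / 2 .. s / 2}"
  have lin: "linear (\<lambda>x :: real^2. x $ 1)" by (rule linearI) auto
  have P: "(\<lambda>x. x $ 1) ` zonotope V = P"
    unfolding P_def s_def by (rule linear_image_zonotope[OF lin])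
  have e: "e $ 1 = 0" "e $ 2 = 1" by (simp_all add: e_def)
  have slice: "emeasure lborel {y. vector [x, y] \<in> zonotope (e # V)} =
      emeasure lborel {y. vector [x, y] \<in> zonotope V} + indicator P x" for x
  proof (cases "x \<in> P")
    case True
    define T where "T = {y. vector [x, y] \<in> zonotope V}"
    have T_eq: "T = (\<lambda>p. p $ 2) ` (zonotope V \<inter> {p. p $ 1 = x})"
    proof (intro equalityI subsetI)
      fix y assume "y \<in> T"
      then show "y \<in> (\<lambda>p. p $ 2) ` (zonotope V \<inter> {p. p $ 1 = x})"
        unfolding T_def by (intro image_eqI[of _ _ "vector [x, y]"]) auto
    next
      fix y assume "y \<in> (\<lambda>p. p $ 2) ` (zonotope V \<inter> {p. p $ 1 = x})"
      then obtain p where p: "p \<in> zonotope V" "p $ 1 = x" "p $ 2 = y" by auto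
      then have "p = vector [x, y]" by (simp add: vec_eq_iff forall_2)
      then show "y \<in> T" using p unfolding T_def by simp
    qed
    have lin2: "linear (\<lambda>x :: real^2. x $ 2)" by (rule linearI) auto
    have cl: "closed {p :: real^2. p $ 1 = x}"
      by (intro closed_Collect_eq continuous_intros)
    have "convex {p :: real^2. p $ 1 = x}"
      by (auto simp: convex_def algebra_simps distrib_right[symmetric])
    then have "convex T" unfolding T_eq
      by (intro convex_linear_image[OF lin2] convex_Int convex_zonotope)
    moreover have "compact T" unfolding T_eq
      by (intro compact_continuous_image continuous_intros compact_Int_closed compact_zonotope cl)
    ultimately obtain a b where ab: "T = {a..b}"
      using connected_compact_interval_1[of T] convex_connected[of T] by auto
    have "T \<noteq> {}" using True P T_eq by auto
    then have le: "a \<le> b" using ab by auto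
    have "{y. vector [x, y] \<in> zonotope (e # V)} = {a - 1/2 .. b + 1/2}"
    proof (intro equalityI subsetI)
      fix y assume "y \<in> {y. vector [x, y] \<in> zonotope (e # V)}"
      then obtain t p where tp: "t \<in> {-1/2..1/2}" "p \<in> zonotope V" "vector [x, y] = t *\<^sub>R e + p"
        unfolding zonotope_Cons by blast
      have "p $ 1 = x" "p $ 2 = y - t"
        using arg_cong[OF tp(3), of "\<lambda>v. v $ 1"] arg_cong[OF tp(3), of "\<lambda>v. v $ 2"] by (auto simp: e)
      then have "y - t \<in> T" unfolding T_eq using tp(2) by force
      then show "y \<in> {a - 1/2 .. b + 1/2}" using ab tp(1) by auto
    next
      fix y assume y: "y \<in> {a - 1/2 .. b + 1/2}"
      \<comment> \<open>The point of the old slice nearest to \<open>y\<close>, so that the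
        remainder fits into the new segment.\<close>
      define z where "z = max a (min b y)"
      have "z \<in> T" using ab le unfolding z_def by auto
      moreover have "y - z \<in> {-1/2..1/2}" using y le unfolding z_def by auto
      moreover have "vector [x, y] = (y - z) *\<^sub>R e + vector [x, z]"
        by (simp add: vec_eq_iff forall_2 e)
      ultimately show "y \<in> {y. vector [x, y] \<in> zonotope (e # V)}"
        unfolding zonotope_Cons T_def by blast
    qed
    then show ?thesis using True le ab[unfolded T_def]
      by (simp flip: ennreal_plus ennreal_1)
  next
    case False
    have "{y. vector [x, y] \<in> zonotope V} = {}"
      using False P by (metis (mono_tags, lifting) image_eqI vector_2(1) empty_Collect_eq)
    moreover have "{y. vector [x, y] \<in> zonotope (e # V)} = {}"
    proof (rule ccontr)
      assume "{y. vector [x, y] \<in> zonotope (e # V)} \<noteq> {}"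
      then obtain y t p where tp: "p \<in> zonotope V" "vector [x, y] = t *\<^sub>R e + p"
        unfolding zonotope_Cons by blast
      have "p $ 1 = x" using arg_cong[OF tp(2), of "\<lambda>v. v $ 1"] by (simp add: e)
      then show False using False P tp(1) by blast
    qed
    ultimately show ?thesis using False by simp
  qed
  have K: "zonotope V \<in> sets borel" by (simp add: borel_compact compact_zonotope)
  have [measurable]: "(\<lambda>x. emeasure lborel {y. vector [x, y] \<in> zonotope V}) \<in> borel_measurable lborel"
  proof -
    have "(\<lambda>x. emeasure lborel (Pair x -` (vec_of_pair -` zonotope V))) \<in> borel_measurable lborel"
      using measurable_sets[OF measurable_vec_of_pair K]
      by (intro lborel.measurable_emeasure_Pair) (simp only: lborel_prod, simp)
    then show ?thesis by (simp add: vimage_def vec_of_pair_def)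
  qed
  have "emeasure lborel (zonotope (e # V)) =
      (\<integral>\<^sup>+x. emeasure lborel {y. vector [x, y] \<in> zonotope V} + indicator P x \<partial>lborel)"
    by (simp add: emeasure_compact_slices[OF compact_zonotope] slice)
  also have "\<dots> = (\<integral>\<^sup>+x. emeasure lborel {y. vector [x, y] \<in> zonotope V} \<partial>lborel) + (\<integral>\<^sup>+x. indicator P x
      \<partial>lborel)"
    by (rule nn_integral_add) (auto simp: P_def)
  also have "\<dots> = emeasure lborel (zonotope V) + ennreal s"
    using s0 by (simp add: emeasure_compact_slices[OF compact_zonotope, symmetric] P_def)
  finally show ?thesis by (simp add: s_def)
qed

lemma measure_zonotope_linear:
  fixes f :: "real^2 \<Rightarrow> real^2"
  assumes "linear f"
  shows "measure lebesgue (zonotope (map f V)) = \<bar>det (matrix f)\<bar> * measure lebesgue (zonotope V)"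
  unfolding zonotope_map_linear[OF assms]
  by (rule measure_linear_image[OF assms]) (simp add: lmeasurable_compact compact_zonotope)

text \<open>Unfolding \<open>zarea\<close> gives the classical sum of \<bar>det\<bar> over unordered
  pairs of generators. In the induction a unimodular change of coordinates turns the new generator
  into the unit vertical vector, and the shadow of the rest then has length equal to the sum of the
  determinants with that generator.\<close>

theorem measure_zonotope: "measure lebesgue (zonotope V) = zarea V"
proof (induction V)
  case (Cons v V)
  show ?case
  proof (cases "v = 0")
    case True
    have "zonotope (0 # V) = zonotope V"
      unfolding zonotope_Cons by (auto intro!: exI[of _ 0])
    then show ?thesis using Cons True by (simp add: det2_def)
  next
    case False
    define N where "N = (v $ 1)\<^sup>2 + (v $ 2)\<^sup>2"
    have N: "N \<noteq> 0" using False unfolding N_def by (auto simp: vec_eq_iff forall_2 sum_power2_eq_zero_iff)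
    \<comment> \<open>Taking \<open>det2 x v\<close> as first coordinate sends \<open>v\<close> to
      the vertical axis and turns shadows into determinants. Dividing the second coordinate by the
      squared norm \<open>N\<close> makes the determinant of \<open>f\<close> equal to 1 and the
      image of \<open>v\<close> a unit vector.\<close>
    define f :: "real^2 \<Rightarrow> real^2" where
      "f x = vector [det2 x v, (x $ 1 * v $ 1 + x $ 2 * v $ 2) / N]" for x
    have lin: "linear f"
      by (rule linearI) (auto simp: f_def vec_eq_iff forall_2 det2_def algebra_simps add_divide_distrib)
    have "det (matrix f) = 1"
      using N by (simp add: det_2 matrix_def f_def det2_def axis_def)
         (simp add: N_def power2_eq_square add_divide_distrib[symmetric] add.commute)
    then have meas: "measure lebesgue (zonotope (map f U)) = measure lebesgue (zonotope U)" for U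
      by (simp add: measure_zonotope_linear[OF lin])
    have fv: "f v = vector [0, 1]"
      using N by (simp add: f_def det2_def vec_eq_iff forall_2) (simp add: N_def power2_eq_square)
    have f1: "f w $ 1 = det2 w v" for w by (simp add: f_def)
    have fin: "emeasure lborel (zonotope U) = ennreal (measure lebesgue (zonotope U))" for U
    proof -
      have "zonotope U \<in> sets lborel" by (simp add: borel_compact compact_zonotope)
      then have "measure lebesgue (zonotope U) = measure lborel (zonotope U)"
        by (rule measure_completion)
      moreover have "emeasure lborel (zonotope U) < \<infinity>"
        by (intro emeasure_bounded_finite compact_imp_bounded compact_zonotope)
      ultimately show ?thesis by (simp add: emeasure_eq_ennreal_measure)
    qed
    have "ennreal (measure lebesgue (zonotope (map f (v # V)))) =
        ennreal (measure lebesgue (zonotope (map f V)) + (\<Sum>w\<leftarrow>map f V. \<bar>w $ 1\<bar>))"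
      using emeasure_zonotope_vertical[of "map f V"] unfolding fin list.map fv
      by (subst ennreal_plus) (auto intro!: sum_list_nonneg)
    then have "measure lebesgue (zonotope (map f (v # V))) =
        measure lebesgue (zonotope (map f V)) + (\<Sum>w\<leftarrow>map f V. \<bar>w $ 1\<bar>)"
      by (subst (asm) ennreal_inj) (auto intro!: add_nonneg_nonneg sum_list_nonneg)
    then show ?thesis unfolding meas by (simp add: Cons f1 o_def)
  qed
qed (simp add: zonotope_Nil)

lemma zarea_nonneg: "zarea V \<ge> 0"
  by (induction V) (auto intro!: add_nonneg_nonneg sum_list_nonneg)

lemma zarea_append:
  "zarea (U @ V) = zarea U + zarea V + (\<Sum>u\<leftarrow>U. \<Sum>v\<leftarrow>V. \<bar>det2 v u\<bar>)"
  by (induction U) auto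

lemma det2_bound: "\<bar>det2 x y\<bar> \<le> norm x * norm y"
proof -
  have "(det2 x y)\<^sup>2 \<le> (norm x * norm y)\<^sup>2"
  proof -
    have n: "(norm z)\<^sup>2 = (z $ 1)\<^sup>2 + (z $ 2)\<^sup>2" for z :: "real^2"
      unfolding power2_norm_eq_inner by (simp add: inner_vec_def sum_2 power2_eq_square)
    have "(norm x * norm y)\<^sup>2 - (det2 x y)\<^sup>2 = (x $ 1 * y $ 1 + x $ 2 * y $ 2)\<^sup>2"
      unfolding power_mult_distrib n det2_def by (simp add: power2_eq_square algebra_simps)
    then show ?thesis by (smt (verit) zero_le_power2)
  qed
  then have "\<bar>det2 x y\<bar> \<le> \<bar>norm x * norm y\<bar>" by (simp only: abs_le_square_iff)
  then show ?thesis by simp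
qed

lemma zarea_bound: "zarea V \<le> (\<Sum>v\<leftarrow>V. norm v)\<^sup>2"
proof (induction V)
  case (Cons v V)
  have "(\<Sum>w\<leftarrow>V. \<bar>det2 w v\<bar>) \<le> (\<Sum>w\<leftarrow>V. norm w * norm v)"
    by (intro sum_list_mono det2_bound)
  also have "\<dots> = (\<Sum>w\<leftarrow>V. norm w) * norm v" by (rule sum_list_mult_const)
  finally have "zarea (v # V) \<le> (\<Sum>w\<leftarrow>V. norm w)\<^sup>2 + (\<Sum>w\<leftarrow>V. norm w) * norm v"
    using Cons by simp
  also have "\<dots> \<le> (norm v + (\<Sum>w\<leftarrow>V. norm w))\<^sup>2"
  proof -
    have "(\<Sum>w\<leftarrow>V. norm w) \<ge> 0" by (rule sum_list_nonneg) auto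
    then have "(\<Sum>w\<leftarrow>V. norm w) * norm v \<ge> 0" by (rule mult_nonneg_nonneg) simp
    moreover have "(norm v)\<^sup>2 \<ge> 0" by simp
    moreover have "(norm v + (\<Sum>w\<leftarrow>V. norm w))\<^sup>2 =
       (norm v)\<^sup>2 + 2 * ((\<Sum>w\<leftarrow>V. norm w) * norm v) + (\<Sum>w\<leftarrow>V. norm w)\<^sup>2"
      by (simp add: power2_eq_square algebra_simps)
    ultimately show ?thesis by linarith
  qed
  finally show ?case by simp
qed simp

section \<open>Rotations and the excluded area of a zonotope\<close>

lemma linear_rot: "linear (rot \<theta>)"
  by (rule linearI) (auto simp: rot_def vec_eq_iff forall_2 algebra_simps)

lemma det2_rot: "det2 (rot \<theta> x) (rot \<theta> y) = det2 x y"
proof -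
  have "(c * x1 - s * x2) * (s * y1 + c * y2) - (s * x1 + c * x2) * (c * y1 - s * y2) =
      (c\<^sup>2 + s\<^sup>2) * (x1 * y2 - x2 * y1)" for c s x1 x2 y1 y2 :: real
    by (simp add: power2_eq_square algebra_simps)
  from this[of "cos \<theta>" "x $ 1" "sin \<theta>" "x $ 2" "y $ 1" "y $ 2"] show ?thesis
    by (simp add: det2_def rot_def)
qed

lemma zarea_map_rot: "zarea (map (rot \<theta>) V) = zarea V"
  by (induction V) (auto simp: o_def det2_rot)

text \<open>Shows the dependence on the angle to be a sinusoid. By \<open>det2_inner_sq\<close> its
  amplitude is the product of the norms.\<close>

lemma det2_rot_right: "det2 v (rot \<theta> w) = det2 v w * cos \<theta> + (v \<bullet> w) * sin \<theta>"
  by (simp add: det2_def rot_def inner_vec_def sum_2 algebra_simps)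

lemma norm_rot: "norm (rot \<theta> x) = norm x"
proof -
  have "(c * x1 - s * x2) * (c * x1 - s * x2) + (s * x1 + c * x2) * (s * x1 + c * x2) =
      (c\<^sup>2 + s\<^sup>2) * (x1 * x1 + x2 * x2)" for c s x1 x2 :: real
    by (simp add: power2_eq_square algebra_simps)
  from this[of "cos \<theta>" "x $ 1" "sin \<theta>" "x $ 2"] have "rot \<theta> x \<bullet> rot \<theta> x = x \<bullet> x"
    by (simp add: rot_def inner_vec_def sum_2)
  then show ?thesis by (simp add: norm_eq_sqrt_inner)
qed

text \<open>Zonotopes are centrally symmetric, so the difference set is a Minkowski sum, and
  concatenating the lists keeps it within the scope of the area formula.\<close>

lemma excluded_set_zonotope:
  "{a - b | a b. a \<in> zonotope V \<and> b \<in> rot \<theta> ` zonotope V} = zonotope (V @ map (rot \<theta>) V)"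
proof -
  have "rot \<theta> ` zonotope V = zonotope (map (rot \<theta>) V)"
    by (rule zonotope_map_linear[OF linear_rot, symmetric])
  moreover have "{a - b | a b. a \<in> zonotope V \<and> b \<in> zonotope W} = zonotope (V @ W)" for W
  proof (intro equalityI subsetI)
    fix z assume "z \<in> {a - b | a b. a \<in> zonotope V \<and> b \<in> zonotope W}"
    then obtain a b where "a \<in> zonotope V" "- b \<in> zonotope W" "z = a + - b"
      using zonotope_uminus[of _ W] by auto
    then show "z \<in> zonotope (V @ W)" unfolding zonotope_append by blast
  next
    fix z assume "z \<in> zonotope (V @ W)"
    then obtain a b where "a \<in> zonotope V" "- b \<in> zonotope W" "z = a - - b"
      unfolding zonotope_append using zonotope_uminus[of _ W] by auto
    then show "z \<in> {a - b | a b. a \<in> zonotope V \<and> b \<in> zonotope W}" by blast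
  qed
  ultimately show ?thesis by simp
qed

lemma excluded_area_zonotope:
  "excluded_area \<theta> (zonotope V) =
     2 * zarea V + (\<Sum>v\<leftarrow>V. \<Sum>w\<leftarrow>V. \<bar>det2 v w * cos \<theta> + (v \<bullet> w) * sin \<theta>\<bar>)"
proof -
  have "\<bar>det2 (rot \<theta> w) v\<bar> = \<bar>det2 v w * cos \<theta> + (v \<bullet> w) * sin \<theta>\<bar>" for v w
  proof -
    have "det2 (rot \<theta> w) v = - det2 v (rot \<theta> w)" by (simp add: det2_def)
    then show ?thesis by (simp add: det2_rot_right)
  qed
  then show ?thesis
    unfolding excluded_area_def excluded_set_zonotope measure_zonotope
    by (simp add: zarea_append zarea_map_rot o_def)
qed

text \<open>The half-width of the set along each axis is half the sum of the coordinates in modulus,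
  hence at most \<open>R\<close>. Two axes contribute \<open>2 * R\<close> each. This controls the
  generators, however many there are, by the set alone.\<close>

lemma zonotope_bound_sum_norm:
  assumes "zonotope V \<subseteq> cball 0 R"
  shows "(\<Sum>v\<leftarrow>V. norm v) \<le> 4 * R"
proof -
  have *: "(\<Sum>v\<leftarrow>V. \<bar>v $ i\<bar>) \<le> 2 * R" for i
  proof -
    have "linear (\<lambda>x :: real^2. x $ i)" by (rule linearI) auto
    note img = linear_image_zonotope[OF this, of V]
    have "(\<Sum>v\<leftarrow>V. \<bar>v $ i\<bar>) \<ge> 0" by (rule sum_list_nonneg) auto
    then have "(\<Sum>v\<leftarrow>V. \<bar>v $ i\<bar>) / 2 \<in> (\<lambda>x. x $ i) ` zonotope V"
      unfolding img by simp
    then obtain x where x: "x \<in> zonotope V" "(\<Sum>v\<leftarrow>V. \<bar>v $ i\<bar>) / 2 = x $ i" by (rule imageE)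
    have "norm x \<le> R" using x(1) assms by auto
    then show ?thesis using x(2) component_le_norm_cart[of x i] by linarith
  qed
  have "(\<Sum>v\<leftarrow>V. norm v) \<le> (\<Sum>v\<leftarrow>V. \<bar>v $ 1\<bar> + \<bar>v $ 2\<bar>)"
    by (intro sum_list_mono order_trans[OF norm_le_l1_cart]) (simp add: sum_2)
  also have "\<dots> = (\<Sum>v\<leftarrow>V. \<bar>v $ 1\<bar>) + (\<Sum>v\<leftarrow>V. \<bar>v $ 2\<bar>)"
    by (rule sum_list_addf)
  finally show ?thesis using *[of 1] *[of 2] by linarith
qed

lemma zonotope_subset_cball: "zonotope V \<subseteq> cball 0 (\<Sum>v\<leftarrow>V. norm v)"
proof (induction V)
  case (Cons v V)
  show ?case
  proof
    fix x assume "x \<in> zonotope (v # V)"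
    then obtain t y where "t \<in> {-1/2..1/2}" "y \<in> zonotope V" "x = t *\<^sub>R v + y"
      unfolding zonotope_Cons by blast
    moreover from this have "norm y \<le> (\<Sum>v\<leftarrow>V. norm v)" "\<bar>t\<bar> * norm v \<le> 1 * norm v"
      using Cons by (auto intro!: mult_left_le_one_le)
    ultimately show "x \<in> cball 0 (\<Sum>v\<leftarrow>v # V. norm v)"
      using norm_triangle_ineq[of "t *\<^sub>R v" y] by simp
  qed
qed (simp add: zonotope_Nil)

subsection \<open>Hausdorff limits of zonotopes\<close>

lemma bdd_above_infdist:
  fixes A B :: "'a::metric_space set"
  assumes "bounded A" "B \<noteq> {}"
  shows "bdd_above ((\<lambda>a. infdist a B) ` A)"
proof -
  obtain b where b: "b \<in> B" using assms by blast
  obtain e where e: "\<And>a. a \<in> A \<Longrightarrow> dist b a \<le> e" using assms(1) bounded_any_center[of A b] by auto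
  show ?thesis
    by (rule bdd_aboveI2[of _ _ e]) (metis b e infdist_le dist_commute order_trans)
qed

lemma infdist_le_hausdorff_dist:
  fixes A B :: "'a::metric_space set"
  assumes "bounded A" "bounded B" "A \<noteq> {}" "B \<noteq> {}"
  shows "a \<in> A \<Longrightarrow> infdist a B \<le> hausdorff_dist A B" "b \<in> B \<Longrightarrow> infdist b A \<le> hausdorff_dist A B"
  using cSUP_upper[OF _ bdd_above_infdist[OF assms(1,4)], of a] cSUP_upper[OF _ bdd_above_infdist[OF
      assms(2,3)], of b]
  unfolding hausdorff_dist_def by linarith+

lemma hausdorff_dist_attained:
  fixes A B :: "'a::heine_borel set"
  assumes "compact A" "compact B" "A \<noteq> {}" "B \<noteq> {}"
  shows "a \<in> A \<Longrightarrow> \<exists>b\<in>B. dist a b \<le> hausdorff_dist A B" "b \<in> B \<Longrightarrow> \<exists>a\<in>A. dist b a \<le> hausdorff_dist A B"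
  using infdist_le_hausdorff_dist[OF assms(1,2)[THEN compact_imp_bounded] assms(3,4)]
    infdist_attains_inf[OF compact_imp_closed[OF assms(1)] assms(3)]
    infdist_attains_inf[OF compact_imp_closed[OF assms(2)] assms(4)]
  by metis+

lemma hausdorff_dist_le:
  assumes "A \<noteq> {}" "B \<noteq> {}" "\<And>a. a \<in> A \<Longrightarrow> infdist a B \<le> e" "\<And>b. b \<in> B \<Longrightarrow> infdist b A \<le> e"
  shows "hausdorff_dist A B \<le> e"
  unfolding hausdorff_dist_def using assms by (auto intro!: cSUP_least)

lemma hausdorff_dist_nonneg:
  assumes "bounded A" "bounded B" "A \<noteq> {}" "B \<noteq> {}"
  shows "hausdorff_dist A B \<ge> 0"
  using assms infdist_le_hausdorff_dist(1)[OF assms] infdist_nonneg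
  by (metis all_not_in_conv order_trans)

text \<open>The distance functions of the sets are 1-Lipschitz and uniformly bounded on
  \<open>C\<close>, so Arzela-Ascoli gives a uniformly convergent subsequence. The limit set is
  recovered as the zero set of the limit function.\<close>

theorem blaschke_selection:
  fixes S :: "nat \<Rightarrow> 'a::euclidean_space set"
  assumes C: "compact C" and S: "\<And>n. S n \<noteq> {}" "\<And>n. S n \<subseteq> C"
  obtains r K where "strict_mono r" "compact K" "K \<noteq> {}" "K \<subseteq> C" "(\<lambda>j. hausdorff_dist (S (r j)) K) \<longlonglongrightarrow> 0"
proof -
  define F where "F n x = infdist x (S n)" for n x
  obtain B where B: "\<And>x y. x \<in> C \<Longrightarrow> y \<in> C \<Longrightarrow> dist x y \<le> B"
    using compact_imp_bounded[OF C] bounded_two_points by metis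
  have "\<exists>g k. continuous_on C g \<and> strict_mono (k :: nat \<Rightarrow> nat) \<and>
      (\<forall>e>0. \<exists>N. \<forall>n x. n \<ge> N \<and> x \<in> C \<longrightarrow> norm (F (k n) x - g x) < e)"
  proof (rule Arzela_Ascoli[of C F B])
    show "compact C" by fact
    show "norm (F n x) \<le> B" if "x \<in> C" for n x
    proof -
      obtain y where "y \<in> S n" using S(1)[of n] by blast
      then show ?thesis unfolding F_def using infdist_le2[of y "S n" x B] B[of x y] S(2)[of n] that
        by (auto simp: infdist_nonneg)
    qed
    show "\<exists>d. 0 < d \<and> (\<forall>n y. y \<in> C \<and> norm (x - y) < d \<longrightarrow> norm (F n x - F n y) < e)"
      if "x \<in> C" "0 < e" for x e
    proof (intro exI[of _ e] conjI allI impI)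
      fix n y assume "y \<in> C \<and> norm (x - y) < e"
      moreover have "\<bar>infdist x (S n) - infdist y (S n)\<bar> \<le> dist x y"
        using infdist_triangle[of x "S n" y] infdist_triangle[of y "S n" x] by (simp add: dist_commute)
      ultimately show "norm (F n x - F n y) < e" by (simp add: F_def dist_norm)
    qed fact
  qed blast
  then obtain g r where g: "continuous_on C g" and r: "strict_mono (r :: nat \<Rightarrow> nat)" and
      lim: "\<And>e. e > 0 \<Longrightarrow> \<exists>N. \<forall>n x. n \<ge> N \<and> x \<in> C \<longrightarrow> norm (F (r n) x - g x) < e" by blast
  have g0: "g x \<ge> 0" if "x \<in> C" for x
  proof (rule ccontr)
    assume "\<not> g x \<ge> 0"
    then obtain N where "\<And>n y. n \<ge> N \<Longrightarrow> y \<in> C \<Longrightarrow> norm (F (r n) y - g y) < - g x"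
      using lim[of "- g x"] by auto
    from this[of N x] that have "F (r N) x < 0" by auto
    then show False using infdist_nonneg[of x "S (r N)"] by (simp add: F_def)
  qed
  have gS: "\<exists>N. \<forall>n\<ge>N. \<forall>x\<in>S (r n). g x < e" if e: "e > 0" for e
  proof -
    obtain N where N: "\<And>n x. n \<ge> N \<Longrightarrow> x \<in> C \<Longrightarrow> norm (F (r n) x - g x) < e"
      using lim[OF e] by auto
    have "g x < e" if "n \<ge> N" "x \<in> S (r n)" for n x
      using N[OF that(1) subsetD[OF S(2) that(2)]] that(2) by (simp add: F_def)
    then show ?thesis by blast
  qed
  define K where "K = {x \<in> C. g x = 0}"
  have cK: "compact K"
  proof -
    have "closed K" unfolding K_def
      using continuous_closed_preimage_constant[OF g compact_imp_closed[OF C], of 0] by simp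
    then have "compact (C \<inter> K)" by (rule compact_Int_closed[OF C])
    moreover have "C \<inter> K = K" by (auto simp: K_def)
    ultimately show ?thesis by simp
  qed
  have "C \<noteq> {}" using S by blast
  then obtain m where m: "m \<in> C" "\<And>x. x \<in> C \<Longrightarrow> g m \<le> g x"
    using continuous_attains_inf[OF C _ g] by blast
  \<comment> \<open>If the minimum were positive, \<open>g\<close> would stay away from 0 on the
    sets themselves, where it tends to 0 uniformly. Hence the zero set is not empty.\<close>
  have "g m \<le> 0"
  proof (rule ccontr)
    assume "\<not> g m \<le> 0"
    then obtain N where "\<forall>n\<ge>N. \<forall>x\<in>S (r n). g x < g m" using gS[of "g m"] by auto
    then show False using S(1)[of "r N"] S(2)[of "r N"] m(2) by (meson all_not_in_conv order_refl
        not_less subsetD)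
  qed
  then have K0: "m \<in> K" using m(1) g0 unfolding K_def by force
  \<comment> \<open>Turns smallness of \<open>g\<close> into closeness to \<open>K\<close>: on the
    compact part of \<open>C\<close> at distance at least \<open>e\<close> from \<open>K\<close>,
    the function \<open>g\<close> has a positive minimum. This is what makes points of the sets
    close to \<open>K\<close>; the converse closeness is uniform convergence at points where
    \<open>g\<close> vanishes.\<close>
  have near: "\<exists>d>0. \<forall>x\<in>C. g x < d \<longrightarrow> infdist x K \<le> e" if "e > 0" for e
  proof (cases "\<forall>x\<in>C. infdist x K < e")
    case True
    then show ?thesis by (intro exI[of _ 1]) auto
  next
    case False
    define T where "T = C \<inter> {x. e \<le> infdist x K}"
    have "closed {x. e \<le> infdist x K}"
      by (intro closed_Collect_le continuous_intros)
    then have cT: "compact T" unfolding T_def by (rule compact_Int_closed[OF C])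
    have "T \<noteq> {}" using False unfolding T_def by auto
    then obtain t where t: "t \<in> T" "\<And>x. x \<in> T \<Longrightarrow> g t \<le> g x"
      using continuous_attains_inf[OF cT] continuous_on_subset[OF g] unfolding T_def by blast
    have "t \<notin> K" using t(1) that unfolding T_def by auto
    then have "g t > 0" using t(1) g0[of t] unfolding K_def T_def by force
    then show ?thesis
      by (intro exI[of _ "g t"]) (use t(2) in \<open>force simp: T_def not_less[symmetric]\<close>)
  qed
  have "(\<lambda>j. hausdorff_dist (S (r j)) K) \<longlonglongrightarrow> 0"
  proof (rule LIMSEQ_I)
    fix e :: real assume e: "e > 0"
    then have e2: "e / 2 > 0" by simp
    from near[OF e2] obtain d where d: "d > 0" "\<And>x. x \<in> C \<Longrightarrow> g x < d \<Longrightarrow> infdist x K \<le> e / 2" by blast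
    obtain N1 where N1: "\<And>n x. n \<ge> N1 \<Longrightarrow> x \<in> S (r n) \<Longrightarrow> g x < d" using gS[OF d(1)] by blast
    obtain N2 where N2: "\<And>n x. n \<ge> N2 \<Longrightarrow> x \<in> C \<Longrightarrow> norm (F (r n) x - g x) < e / 2"
      using lim[OF e2] by auto
    have "norm (hausdorff_dist (S (r n)) K - 0) < e" if n: "n \<ge> max N1 N2" for n
    proof -
      have "hausdorff_dist (S (r n)) K \<le> e / 2"
      proof (rule hausdorff_dist_le)
        show "infdist a K \<le> e / 2" if "a \<in> S (r n)" for a
          using d(2) N1[of n a] that n S(2) by auto
        show "infdist b (S (r n)) \<le> e / 2" if "b \<in> K" for b
          using N2[of n b] that n unfolding K_def F_def by (auto simp: infdist_nonneg)
      qed (use S K0 in auto)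
      moreover have "hausdorff_dist (S (r n)) K \<ge> 0"
        using S K0 by (intro hausdorff_dist_nonneg bounded_subset[OF compact_imp_bounded[OF C]]
            compact_imp_bounded[OF cK]) auto
      ultimately show ?thesis using e by simp
    qed
    then show "\<exists>N. \<forall>n\<ge>N. norm (hausdorff_dist (S (r n)) K - 0) < e" by blast
  qed
  then show thesis using that[OF r cK] K0 unfolding K_def by blast
qed

text \<open>An \<open>e\<close>-neighbourhood of a zonotope lies in the zonotope with the square of
  side \<open>2 * e\<close> added, which is again a zonotope. The area formula then bounds the
  increase: \<open>2 * e\<close> times the sum of norms for each of the two new generators, and the
  square itself. This gives the lower bound for areas along a Hausdorff convergent sequence.\<close>

lemma measure_near_zonotope:
  assumes A: "A \<in> lmeasurable" and near: "\<And>a. a \<in> A \<Longrightarrow> \<exists>d\<in>zonotope U. norm (a - d) \<le> e" and e: "e \<ge> 0"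
  shows "measure lebesgue A \<le> zarea U + 4 * e * (\<Sum>u\<leftarrow>U. norm u) + 4 * e\<^sup>2"
proof (cases "e = 0")
  case True
  then have "A \<subseteq> zonotope U" using near by force
  then have "measure lebesgue A \<le> measure lebesgue (zonotope U)"
    using A by (intro measure_mono_fmeasurable) (auto simp: lmeasurable_compact compact_zonotope)
  then show ?thesis using True by (simp add: measure_zonotope)
next
  case False
  \<comment> \<open>Length \<open>2 * e\<close>, since coefficients run over [-1/2, 1/2] and
    displacements up to \<open>e\<close> in either direction must be reached. Dividing by it is why
    \<open>e = 0\<close> is treated apart.\<close>
  define e1 :: "real^2" where "e1 = vector [2 * e, 0]"
  define e2 :: "real^2" where "e2 = vector [0, 2 * e]"
  have "A \<subseteq> zonotope (e1 # e2 # U)"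
  proof
    fix a assume "a \<in> A"
    then obtain d where d: "d \<in> zonotope U" "norm (a - d) \<le> e" using near by blast
    define s t where "s = (a - d) $ 1 / (2 * e)" and "t = (a - d) $ 2 / (2 * e)"
    have ep: "e > 0" using e False by simp
    have "\<bar>(a - d) $ 1\<bar> \<le> e" "\<bar>(a - d) $ 2\<bar> \<le> e"
      using d(2) component_le_norm_cart order_trans by blast+
    then have "\<bar>s\<bar> \<le> 1/2" "\<bar>t\<bar> \<le> 1/2"
      unfolding s_def t_def using ep by (simp_all add: abs_divide divide_simps)
    then have st: "s \<in> {-1/2..1/2}" "t \<in> {-1/2..1/2}" unfolding atLeastAtMost_iff by linarith+
    have "t *\<^sub>R e2 + d \<in> zonotope (e2 # U)" unfolding zonotope_Cons using st(2) d(1) by blast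
    then have "s *\<^sub>R e1 + (t *\<^sub>R e2 + d) \<in> zonotope (e1 # e2 # U)"
      unfolding zonotope_Cons[of e1] using st(1) by blast
    moreover have "s *\<^sub>R e1 + (t *\<^sub>R e2 + d) = a"
      using False by (simp add: vec_eq_iff forall_2 e1_def e2_def s_def t_def)
    ultimately show "a \<in> zonotope (e1 # e2 # U)" by simp
  qed
  then have "measure lebesgue A \<le> measure lebesgue (zonotope (e1 # e2 # U))"
    using A by (intro measure_mono_fmeasurable) (auto simp: lmeasurable_compact compact_zonotope)
  also have "\<dots> = zarea U + (\<Sum>w\<leftarrow>U. \<bar>det2 w e2\<bar>) + \<bar>det2 e2 e1\<bar> + (\<Sum>w\<leftarrow>U. \<bar>det2 w e1\<bar>)"
    by (simp add: measure_zonotope)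
  also have "\<dots> \<le> zarea U + 2 * e * (\<Sum>u\<leftarrow>U. norm u) + 4 * e\<^sup>2 + 2 * e * (\<Sum>u\<leftarrow>U. norm u)"
  proof -
    have "\<bar>w $ i\<bar> * (2 * e) \<le> 2 * e * norm w" for w :: "real^2" and i
      using component_le_norm_cart[of w i] e by (simp add: mult_mono mult.commute)
    then have "(\<Sum>w\<leftarrow>U. \<bar>det2 w e2\<bar>) \<le> (\<Sum>w\<leftarrow>U. 2 * e * norm w)"
        "(\<Sum>w\<leftarrow>U. \<bar>det2 w e1\<bar>) \<le> (\<Sum>w\<leftarrow>U. 2 * e * norm w)"
      using e by (auto intro!: sum_list_mono simp: det2_def e1_def e2_def abs_mult)
    moreover have "(\<Sum>w\<leftarrow>U. 2 * e * norm w) = 2 * e * (\<Sum>u\<leftarrow>U. norm u)"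
      by (rule sum_list_const_mult)
    moreover have "\<bar>det2 e2 e1\<bar> = 4 * e\<^sup>2"
      by (simp add: det2_def e1_def e2_def power2_eq_square abs_mult)
    ultimately show ?thesis by linarith
  qed
  finally show ?thesis by (simp add: algebra_simps)
qed

text \<open>Outer regularity: an open set of nearly the same measure contains a uniform
  neighbourhood of the compact set. This is the upper half of the continuity of area.\<close>

lemma measure_near_compact:
  fixes A :: "'a::euclidean_space set"
  assumes A: "compact A" and e: "e > 0"
  shows "\<exists>d>0. \<forall>D\<in>lmeasurable. (\<forall>x\<in>D. \<exists>a\<in>A. dist a x \<le> d) \<longrightarrow>
    measure lebesgue D \<le> measure lebesgue A + e"
proof -
  have Am: "A \<in> lmeasurable" by (rule lmeasurable_compact[OF A])
  obtain T where T: "open T" "A \<subseteq> T" "T - A \<in> lmeasurable" "emeasure lebesgue (T - A) < ennreal e"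
    using sets_lebesgue_outer_open[of A e] Am e by blast
  obtain d where d: "d > 0" "(\<Union>x\<in>A. cball x d) \<subseteq> T"
    using compact_subset_open_imp_cball_epsilon_subset[OF A T(1,2)] by blast
  have "measure lebesgue D \<le> measure lebesgue A + e"
    if D: "D \<in> lmeasurable" "\<forall>x\<in>D. \<exists>a\<in>A. dist a x \<le> d" for D
  proof -
    have "D \<subseteq> T" using D(2) d(2) by force
    have eq: "T = A \<union> (T - A)" using T(2) by blast
    have "measure lebesgue D \<le> measure lebesgue (A \<union> (T - A))"
      using \<open>D \<subseteq> T\<close> eq D(1) by (intro measure_mono_fmeasurable fmeasurable.Un Am T(3)) auto
    also have "\<dots> \<le> measure lebesgue A + measure lebesgue (T - A)"
      using Am T(3) by (intro measure_Un_le) auto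
    also have "measure lebesgue (T - A) \<le> e"
      using T(3,4) e by (simp add: emeasure_eq_measure2 ennreal_less_iff)
    finally show ?thesis by simp
  qed
  then show ?thesis using d(1) by blast
qed

lemma compact_excluded_set:
  assumes "compact K"
  shows "compact {a - b | a b. a \<in> K \<and> b \<in> rot \<theta> ` K}"
proof -
  have "compact (rot \<theta> ` K)"
    using linear_rot linear_continuous_on linear_linear compact_continuous_image assms by blast
  from compact_differences[OF assms this] show ?thesis by (simp add: conj_commute)
qed

text \<open>The number of generators may grow without bound, but the zonotopes eventually lie in a
  ball slightly larger than one around \<open>K\<close>, which bounds the sum of the norms.\<close>

lemma hausdorff_limit_sum_norm_bounded:
  assumes K: "compact K" "K \<noteq> {}" and lim: "(\<lambda>n. hausdorff_dist (zonotope (W n)) K) \<longlonglongrightarrow> 0"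
  shows "\<exists>R. eventually (\<lambda>n. (\<Sum>u\<leftarrow>W n. norm u) \<le> R) sequentially"
proof -
  obtain R where R: "\<And>x. x \<in> K \<Longrightarrow> norm x \<le> R" using compact_imp_bounded[OF K(1)] unfolding bounded_iff by blast
  have "eventually (\<lambda>n. hausdorff_dist (zonotope (W n)) K < 1) sequentially"
    using order_tendstoD(2)[OF lim, of 1] by simp
  then have "eventually (\<lambda>n. (\<Sum>u\<leftarrow>W n. norm u) \<le> 4 * (R + 1)) sequentially"
  proof eventually_elim
    case (elim n)
    have "zonotope (W n) \<subseteq> cball 0 (R + 1)"
    proof
      fix a assume "a \<in> zonotope (W n)"
      then obtain b where "b \<in> K" "dist a b \<le> hausdorff_dist (zonotope (W n)) K"
        using hausdorff_dist_attained(1)[OF compact_zonotope K(1) zonotope_nonempty K(2)] by blast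
      then show "a \<in> cball 0 (R + 1)" using R[of b] elim norm_triangle_sub[of a b] by (simp add: dist_norm)
    qed
    then show ?case by (rule zonotope_bound_sum_norm)
  qed
  then show ?thesis by blast
qed

text \<open>Rotations are isometries, so difference sets inherit the Hausdorff closeness with twice
  the distance. The two one-sided estimates for areas of neighbouring sets then squeeze the
  limit.\<close>

theorem excluded_area_tendsto:
  assumes K: "compact K" "K \<noteq> {}" and lim: "(\<lambda>n. hausdorff_dist (zonotope (W n)) K) \<longlonglongrightarrow> 0"
  shows "(\<lambda>n. excluded_area \<theta> (zonotope (W n))) \<longlonglongrightarrow> excluded_area \<theta> K"
proof -
  define h where "h n = hausdorff_dist (zonotope (W n)) K" for n
  define D where "D = {a - b | a b. a \<in> K \<and> b \<in> rot \<theta> ` K}"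
  define E where "E n = {a - b | a b. a \<in> zonotope (W n) \<and> b \<in> rot \<theta> ` zonotope (W n)}" for n
  define U where "U n = W n @ map (rot \<theta>) (W n)" for n
  have E: "E n = zonotope (U n)" for n unfolding E_def U_def by (rule excluded_set_zonotope)
  have att: "a \<in> zonotope (W n) \<Longrightarrow> \<exists>b\<in>K. dist a b \<le> h n"
      "b \<in> K \<Longrightarrow> \<exists>a\<in>zonotope (W n). dist b a \<le> h n" for a b n
    unfolding h_def by (fact hausdorff_dist_attained[OF compact_zonotope K(1) zonotope_nonempty K(2)])+
  have rot_dist: "norm ((a - rot \<theta> b) - (a' - rot \<theta> b')) \<le> norm (a - a') + norm (b - b')" for a b a' b'
  proof -
    have "(a - rot \<theta> b) - (a' - rot \<theta> b') = (a - a') - rot \<theta> (b - b')"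
      by (simp add: linear_diff[OF linear_rot])
    then show ?thesis using norm_triangle_ineq4[of "a - a'" "rot \<theta> (b - b')"] by (simp only: norm_rot)
  qed
  have DE: "\<exists>d\<in>E n. norm (x - d) \<le> 2 * h n" if x: "x \<in> D" for x n
  proof -
    obtain a b where ab: "a \<in> K" "b \<in> K" "x = a - rot \<theta> b" using x unfolding D_def by blast
    obtain a' b' where ab': "a' \<in> zonotope (W n)" "b' \<in> zonotope (W n)" "dist a a' \<le> h n" "dist b b' \<le> h n"
      using att(2)[OF ab(1)] att(2)[OF ab(2)] by metis
    have "a' - rot \<theta> b' \<in> E n" using ab' unfolding E_def by blast
    moreover have "norm (x - (a' - rot \<theta> b')) \<le> 2 * h n"
      using rot_dist[of a b a' b'] ab' ab(3) by (simp add: dist_norm)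
    ultimately show ?thesis by blast
  qed
  have ED: "\<exists>d\<in>D. dist d x \<le> 2 * h n" if x: "x \<in> E n" for x n
  proof -
    obtain a b where ab: "a \<in> zonotope (W n)" "b \<in> zonotope (W n)" "x = a - rot \<theta> b" using x unfolding
        E_def by blast
    obtain a' b' where ab': "a' \<in> K" "b' \<in> K" "dist a a' \<le> h n" "dist b b' \<le> h n"
      using att(1)[OF ab(1)] att(1)[OF ab(2)] by metis
    have "a' - rot \<theta> b' \<in> D" using ab' unfolding D_def by blast
    moreover have "dist (a' - rot \<theta> b') x \<le> 2 * h n"
      using rot_dist[of a b a' b'] ab' ab(3) by (subst dist_commute) (simp add: dist_norm)
    ultimately show ?thesis by blast
  qed
  have cD: "compact D" unfolding D_def by (rule compact_excluded_set[OF K(1)])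
  then have Dm: "D \<in> lmeasurable" by (rule lmeasurable_compact)
  have h0: "h n \<ge> 0" for n
    unfolding h_def by (intro hausdorff_dist_nonneg compact_imp_bounded compact_zonotope K zonotope_nonempty)
  have h_lim: "h \<longlonglongrightarrow> 0" using lim unfolding h_def .
  obtain R where R: "eventually (\<lambda>n. (\<Sum>u\<leftarrow>W n. norm u) \<le> R) sequentially"
    using hausdorff_limit_sum_norm_bounded[OF K lim] by blast
  have sum_U: "(\<Sum>u\<leftarrow>U n. norm u) = 2 * (\<Sum>u\<leftarrow>W n. norm u)" for n
    by (simp add: U_def o_def norm_rot)
  have U_bd: "eventually (\<lambda>n. (\<Sum>u\<leftarrow>U n. norm u) \<le> 2 * R) sequentially"
    using R by (rule eventually_mono) (simp add: sum_U)
  have mE: "measure lebesgue (E n) = zarea (U n)" for n by (simp add: E measure_zonotope)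
  \<comment> \<open>The error of \<open>measure_near_zonotope\<close> for distance
    \<open>2 * h n\<close> and for generators whose norms sum to at most
    \<open>2 * R\<close>.\<close>
  define b where "b n = 8 * h n * (2 * R) + 4 * (2 * h n)\<^sup>2" for n
  have "(\<lambda>n. 8 * h n * (2 * R) + 4 * (2 * h n)\<^sup>2) \<longlonglongrightarrow> 8 * 0 * (2 * R) + 4 * (2 * 0)\<^sup>2"
    by (intro tendsto_intros h_lim)
  then have b: "b \<longlonglongrightarrow> 0" unfolding b_def[abs_def] by simp
  have "(\<lambda>n. measure lebesgue (E n)) \<longlonglongrightarrow> measure lebesgue D"
  proof (rule order_tendstoI)
    fix y assume y: "y < measure lebesgue D"
    then have "eventually (\<lambda>n. b n < measure lebesgue D - y) sequentially"
      using order_tendstoD(2)[OF b] by simp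
    with U_bd show "eventually (\<lambda>n. y < measure lebesgue (E n)) sequentially"
    proof eventually_elim
      case (elim n)
      have "measure lebesgue D \<le> zarea (U n) + 4 * (2 * h n) * (\<Sum>u\<leftarrow>U n. norm u) + 4 * (2 * h n)\<^sup>2"
        by (rule measure_near_zonotope[OF Dm]) (use DE E h0 in auto)
      also have "\<dots> \<le> zarea (U n) + 4 * (2 * h n) * (2 * R) + 4 * (2 * h n)\<^sup>2"
        using elim(1) h0[of n] by (intro add_mono mult_left_mono) auto
      also have "\<dots> = zarea (U n) + b n" by (simp add: b_def)
      finally show ?case using elim(2) mE by simp
    qed
  next
    fix y assume y: "measure lebesgue D < y"
    define e where "e = (y - measure lebesgue D) / 2"
    have e: "e > 0" "measure lebesgue D + e < y" using y by (auto simp: e_def field_simps)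
    obtain d where d: "d > 0" "\<forall>X\<in>lmeasurable. (\<forall>x\<in>X. \<exists>a\<in>D. dist a x \<le> d) \<longrightarrow> measure lebesgue X \<le> measure
        lebesgue D + e"
      using measure_near_compact[OF cD e(1)] by blast
    have "eventually (\<lambda>n. h n < d / 2) sequentially" using order_tendstoD(2)[OF h_lim, of "d/2"] d(1) by simp
    then show "eventually (\<lambda>n. measure lebesgue (E n) < y) sequentially"
    proof eventually_elim
      case (elim n)
      have "measure lebesgue (E n) \<le> measure lebesgue D + e"
      proof (rule d(2)[rule_format])
        show "E n \<in> lmeasurable" by (simp add: E lmeasurable_compact compact_zonotope)
        fix x assume "x \<in> E n"
        from ED[OF this] elim show "\<exists>a\<in>D. dist a x \<le> d" by force
      qed
      then show ?case using e(2) by simp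
    qed
  qed
  then show ?thesis by (simp add: excluded_area_def E_def D_def)
qed

subsection \<open>Periodic semiconvex functions\<close>

lemma finite_measure_circ: "finite_measure circ"
  by (rule finite_measureI) (simp add: emeasure_restrict_space)

lemma measure_circ: "measure circ {0<..<2*pi} = 2 * pi"
  by (simp add: measure_restrict_space)

lemma borel_measurable_circ: "g \<in> borel_measurable borel \<Longrightarrow> g \<in> borel_measurable circ"
  by (intro measurable_restrict_space1 measurable_completion) simp

lemma integrable_circ_bounded:
  fixes g :: "real \<Rightarrow> real"
  assumes "g \<in> borel_measurable circ" "\<And>x. x \<in> {0<..<2*pi} \<Longrightarrow> \<bar>g x\<bar> \<le> B"
  shows "integrable circ g"
  by (rule finite_measure.integrable_const_bound[OF finite_measure_circ, of _ B])
     (use assms in \<open>auto intro!: AE_I2\<close>)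

lemma integrable_circ_continuous:
  fixes g :: "real \<Rightarrow> real"
  assumes "continuous_on UNIV g"
  shows "integrable circ g"
proof -
  have "compact (g ` {0..2*pi})"
    by (intro compact_continuous_image continuous_on_subset[OF assms]) auto
  then obtain B where "\<forall>y\<in>g ` {0..2*pi}. norm y \<le> B"
    using compact_imp_bounded bounded_iff by blast
  then show ?thesis
    by (intro integrable_circ_bounded[of _ B] borel_measurable_circ borel_measurable_continuous_onI assms) auto
qed

lemma integral_circ_eq:
  fixes g :: "real \<Rightarrow> real"
  assumes "integrable circ g"
  shows "(\<integral>x. g x \<partial>circ) = integral {0..2*pi} g"
  using lebesgue_integral_eq_integral[OF assms] by (simp add: integral_open_interval_real)

lemma AE_circ_countable:
  assumes "countable N"
  shows "AE x in circ. x \<notin> N"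
proof -
  have "AE x in lborel. x \<notin> N"
    by (rule AE_not_in[OF countable_imp_null_set_lborel[OF assms]])
  then have "AE x in lebesgue. x \<notin> N" by (rule AE_completion)
  then show ?thesis by (subst AE_restrict_space_iff) auto
qed

text \<open>Translation invariance over a full period. It is the discrete integration by parts: a
  difference quotient moves from one factor of a product to the other.\<close>

lemma integral_circ_shift:
  fixes F :: "real \<Rightarrow> real"
  assumes F: "continuous_on UNIV F" and per: "\<And>x. F (x + 2*pi) = F x" and h: "0 \<le> h" "h \<le> 2*pi"
  shows "(\<integral>x. F (x + h) \<partial>circ) = (\<integral>x. F x \<partial>circ)"
proof -
  have int: "F integrable_on {a..b}" for a b
    by (intro integrable_continuous_interval continuous_on_subset[OF F]) auto
  have "integral {0..2*pi} (\<lambda>x. F (x + h)) = integral {h..2*pi+h} F"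
    using integral_shift_real_ivl[of h h "2*pi+h" F] by simp
  also have "\<dots> = integral {h..2*pi} F + integral {2*pi..2*pi+h} F"
    using h int by (intro Henstock_Kurzweil_Integration.integral_combine[symmetric]) auto
  also have "integral {2*pi..2*pi+h} F = integral {0..h} (\<lambda>x. F (x + 2*pi))"
    using integral_shift_real_ivl[of "2*pi" "2*pi" "2*pi+h" F] by simp
  also have "\<dots> = integral {0..h} F" by (simp add: per)
  also have "integral {h..2*pi} F + integral {0..h} F = integral {0..2*pi} F"
    using h int by (subst add.commute, intro Henstock_Kurzweil_Integration.integral_combine) auto
  finally show ?thesis
    using F by (subst (1 2) integral_circ_eq)
       (auto intro!: integrable_circ_continuous continuous_intros continuous_on_compose2[OF F])
qed

text \<open>After adding \<open>C / 2 * x\<^sup>2\<close> to \<open>u\<close>, the last condition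
  says that \<open>d x + C * x\<close> is a subgradient at every point; \<open>d\<close> is a
  selection, defined also at kinks. One constant serves as slope bound and as semiconvexity constant
  because the amplitude of a sinusoid bounds both its first and its second derivative.\<close>

locale semiconvex =
  fixes C :: real and u d :: "real \<Rightarrow> real"
  assumes periodic: "u (x + 2*pi) = u x"
    and bound: "\<bar>d x\<bar> \<le> C"
    and support: "u x + d x * (y - x) - C / 2 * (y - x)\<^sup>2 \<le> u y"
begin

lemma C_nonneg: "C \<ge> 0"
  using bound[of 0] by simp

lemma support_upper: "u y \<le> u x + d y * (y - x) + C / 2 * (y - x)\<^sup>2"
proof -
  have "d y * (x - y) = - (d y * (y - x))" by (simp add: algebra_simps)
  then show ?thesis using support[of y x] power2_commute[of x y] by simp
qed

text \<open>Monotonicity of subgradients: combine the support inequalities at \<open>x\<close> and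
  at \<open>y\<close>. It yields measurability of \<open>d\<close> and continuity off a countable
  set.\<close>

lemma mono_deriv: "mono (\<lambda>x. d x + C * x)"
proof (rule monoI)
  fix x y :: real assume "x \<le> y"
  show "d x + C * x \<le> d y + C * y"
  proof (cases "x = y")
    case False
    with \<open>x \<le> y\<close> have pos: "y - x > 0" by simp
    have "d x * (y - x) - C / 2 * (y - x)\<^sup>2 \<le> d y * (y - x) + C / 2 * (y - x)\<^sup>2"
      using support[of x y] support_upper[of y x] by linarith
    then have "d x * (y - x) \<le> (d y + C * (y - x)) * (y - x)"
      by (simp add: algebra_simps power2_eq_square)
    then have "d x \<le> d y + C * (y - x)" using pos by (simp only: mult_le_cancel_right_pos)
    then show ?thesis by (simp add: algebra_simps)
  qed simp
qed

lemma modulus: "\<bar>u y - u x\<bar> \<le> C * \<bar>y - x\<bar> + C / 2 * (y - x)\<^sup>2"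
proof -
  have "\<bar>d z * (y - x)\<bar> \<le> C * \<bar>y - x\<bar>" for z
    unfolding abs_mult by (intro mult_right_mono bound) auto
  from this[of x] this[of y] show ?thesis
    using support[of x y] support_upper[of y x] by linarith
qed

lemma isCont_u: "isCont u x"
proof -
  have "((\<lambda>y. C * \<bar>y - x\<bar> + C / 2 * (y - x)\<^sup>2) \<longlongrightarrow> C * \<bar>x - x\<bar> + C / 2 * (x - x)\<^sup>2) (at x)"
    by (intro tendsto_intros)
  then have "((\<lambda>y. C * \<bar>y - x\<bar> + C / 2 * (y - x)\<^sup>2) \<longlongrightarrow> 0) (at x)" by simp
  moreover have "eventually (\<lambda>y. norm (u y - u x) \<le> C * \<bar>y - x\<bar> + C / 2 * (y - x)\<^sup>2) (at x)"
    using modulus by simp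
  ultimately have "((\<lambda>y. u y - u x) \<longlongrightarrow> 0) (at x)" by (rule Lim_null_comparison[rotated])
  then show ?thesis unfolding isCont_def by (simp add: LIM_zero_cancel)
qed

lemma continuous_u: "continuous_on S u"
  by (simp add: continuous_at_imp_continuous_on isCont_u)

lemma countable_discont: "countable {x. \<not> isCont d x}"
proof -
  have "{x. \<not> isCont d x} \<subseteq> {x. \<not> isCont (\<lambda>x. d x + C * x) x}"
  proof safe
    fix x assume "isCont (\<lambda>x. d x + C * x) x" "\<not> isCont d x"
    moreover from this(1) have "isCont (\<lambda>x. (d x + C * x) - C * x) x"
      by (rule isCont_diff) (intro continuous_intros)
    moreover have "(\<lambda>x. (d x + C * x) - C * x) = d" by auto
    ultimately show False by metis
  qed
  then show ?thesis using mono_ctble_discont[OF mono_deriv] countable_subset by blast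
qed

lemma borel_measurable_d: "d \<in> borel_measurable borel"
proof -
  have "(\<lambda>x. (d x + C * x) - C * x) \<in> borel_measurable borel"
    by (intro borel_measurable_diff borel_measurable_mono[OF mono_deriv]) auto
  then show ?thesis by simp
qed

lemma integrable_u: "integrable circ u"
  by (rule integrable_circ_continuous[OF continuous_u])

lemma integrable_d: "integrable circ d"
  by (rule integrable_circ_bounded[OF borel_measurable_circ[OF borel_measurable_d] bound])

text \<open>A forward quotient is trapped between the slopes at its two ends, up to an error linear
  in \<open>h\<close>. Both the differentiability of \<open>u\<close> where \<open>d\<close> is
  continuous and the convergence of slopes rest on this.\<close>

lemma quotient_bounds:
  assumes "h > 0"
  shows "d x - C / 2 * h \<le> (u (x + h) - u x) / h" "(u (x + h) - u x) / h \<le> d (x + h) + C / 2 * h"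
proof -
  have "d x * h - C / 2 * h\<^sup>2 \<le> u (x + h) - u x" "u (x + h) - u x \<le> d (x + h) * h + C / 2 * h\<^sup>2"
    using support[of x "x + h"] support_upper[of "x + h" x] by simp_all
  then show "d x - C / 2 * h \<le> (u (x + h) - u x) / h" "(u (x + h) - u x) / h \<le> d (x + h) + C / 2 * h"
    using assms by (simp_all add: field_simps power2_eq_square)
qed

lemma quotient_tendsto:
  assumes "isCont d x"
  shows "(\<lambda>n. (u (x + 1 / Suc n) - u x) / (1 / Suc n)) \<longlonglongrightarrow> d x"
proof -
  have h: "(\<lambda>n. 1 / real (Suc n)) \<longlonglongrightarrow> 0"
    using LIMSEQ_inverse_real_of_nat by (simp add: inverse_eq_divide)
  have lower: "(\<lambda>n. d x - C / 2 * (1 / real (Suc n))) \<longlonglongrightarrow> d x - C / 2 * 0"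
    by (intro tendsto_intros h)
  have "(\<lambda>n. x + 1 / real (Suc n)) \<longlonglongrightarrow> x + 0" by (intro tendsto_intros h)
  then have "(\<lambda>n. d (x + 1 / real (Suc n))) \<longlonglongrightarrow> d x"
    using isCont_tendsto_compose[OF assms] by simp
  then have upper: "(\<lambda>n. d (x + 1 / real (Suc n)) + C / 2 * (1 / real (Suc n))) \<longlonglongrightarrow> d x + C / 2 * 0"
    by (intro tendsto_intros h)
  show ?thesis
  proof (rule tendsto_sandwich)
    show "\<forall>\<^sub>F n in sequentially. d x - C / 2 * (1 / Suc n) \<le> (u (x + 1 / Suc n) - u x) / (1 / Suc n)"
      by (intro always_eventually allI quotient_bounds(1)) simp
    show "\<forall>\<^sub>F n in sequentially. (u (x + 1 / Suc n) - u x) / (1 / Suc n) \<le> d (x + 1 / Suc n) + C / 2 *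
        (1 / Suc n)"
      by (intro always_eventually allI quotient_bounds(2)) simp
  qed (use lower upper in simp_all)
qed

text \<open>The discrete form of a second derivative bounded below by \<open>- C\<close>: the linear
  terms of the supports at \<open>x\<close> cancel.\<close>

lemma second_difference: "u (x + h) + u (x - h) - 2 * u x \<ge> - C * h\<^sup>2"
  using support[of x "x + h"] support[of x "x - h"] by simp

end

text \<open>The quotient is a backward one because translation invariance turns a forward shift of
  \<open>u\<close> into a backward shift of the test function; hence the minus sign in the
  limit.\<close>

lemma quotient_tendsto_deriv:
  fixes \<phi> :: "real \<Rightarrow> real"
  assumes "(\<phi> has_real_derivative D) (at x)"
  shows "(\<lambda>n. (\<phi> (x - 1 / Suc n) - \<phi> x) / (1 / Suc n)) \<longlonglongrightarrow> - D"
proof -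
  have h: "filterlim (\<lambda>n. - 1 / real (Suc n)) (at 0) sequentially"
    unfolding filterlim_at using tendsto_minus[OF LIMSEQ_inverse_real_of_nat] by (simp add: inverse_eq_divide)
  have "(\<lambda>n. (\<phi> (x + - 1 / Suc n) - \<phi> x) / (- 1 / Suc n)) \<longlonglongrightarrow> D"
    using filterlim_compose[OF assms[unfolded DERIV_def] h] by simp
  from tendsto_minus[OF this] show ?thesis by simp
qed

lemma quotient_bounded:
  fixes \<phi> :: "real \<Rightarrow> real"
  assumes "\<And>x. (\<phi> has_real_derivative \<phi>' x) (at x)" "continuous_on UNIV \<phi>'"
  shows "\<exists>B. \<forall>x\<in>{0<..<2*pi}. \<forall>h\<in>{0<..1}. \<bar>(\<phi> (x - h) - \<phi> x) / h\<bar> \<le> B"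
proof -
  have "compact (\<phi>' ` {-1..2*pi})"
    by (intro compact_continuous_image continuous_on_subset[OF assms(2)]) auto
  then obtain B where B: "\<And>x. x \<in> {-1..2*pi} \<Longrightarrow> \<bar>\<phi>' x\<bar> \<le> B"
    using compact_imp_bounded bounded_iff by (metis image_eqI real_norm_def)
  have "\<bar>(\<phi> (x - h) - \<phi> x) / h\<bar> \<le> B" if x: "x \<in> {0<..<2*pi}" and h: "h \<in> {0<..1}" for x h
  proof -
    obtain z where z: "x - h < z" "z < x" "\<phi> x - \<phi> (x - h) = (x - (x - h)) * \<phi>' z"
      using MVT2[of "x - h" x \<phi> \<phi>'] assms(1) h by auto
    have "(\<phi> (x - h) - \<phi> x) / h = - \<phi>' z" using z(3) h by (simp add: field_simps)
    then show ?thesis using B[of z] z x h by simp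
  qed
  then show ?thesis by blast
qed

context semiconvex
begin

text \<open>The quotients of \<open>u\<close> tend to \<open>d\<close> off a countable set and those
  of the test function tend to \<open>- \<phi>'\<close> everywhere, both boundedly. Dominated
  convergence passes to the limit on the two sides of the discrete identity.\<close>

lemma weak_deriv:
  fixes \<phi> \<phi>' :: "real \<Rightarrow> real"
  assumes \<phi>: "\<And>x. (\<phi> has_real_derivative \<phi>' x) (at x)" and \<phi>': "continuous_on UNIV \<phi>'"
    and per: "\<And>x. \<phi> (x + 2*pi) = \<phi> x"
  shows "(\<integral>x. u x * \<phi>' x \<partial>circ) = - (\<integral>x. d x * \<phi> x \<partial>circ)"
proof -
  define h where "h n = 1 / real (Suc n)" for n
  have h: "0 < h n" "h n \<le> 1" for n by (simp_all add: h_def)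
  have c\<phi>: "continuous_on S \<phi>" for S
    using \<phi> by (meson DERIV_isCont continuous_at_imp_continuous_on)
  have cu': "continuous_on UNIV (\<lambda>x. u (x + h n))" for n
    by (intro continuous_on_compose2[OF continuous_u[of UNIV]] continuous_intros) auto
  have c\<phi>': "continuous_on UNIV (\<lambda>x. \<phi> (x - h n))" for n
    by (intro continuous_on_compose2[OF c\<phi>[of UNIV]] continuous_intros) auto
  note ic = integrable_circ_continuous
  \<comment> \<open>Discrete integration by parts: shifting the product by \<open>h n\<close> leaves
    the integral over a period unchanged.\<close>
  have eq: "(\<integral>x. (u (x + h n) - u x) / h n * \<phi> x \<partial>circ) = (\<integral>x. u x * ((\<phi> (x - h n) - \<phi> x) / h n) \<partial>circ)" for n
  proof -
    have "(\<integral>x. u (x + h n) * \<phi> (x + h n - h n) \<partial>circ) = (\<integral>x. u x * \<phi> (x - h n) \<partial>circ)"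
    proof (rule integral_circ_shift)
      show "continuous_on UNIV (\<lambda>x. u x * \<phi> (x - h n))" by (intro continuous_intros continuous_u c\<phi>')
      show "u (x + 2*pi) * \<phi> (x + 2*pi - h n) = u x * \<phi> (x - h n)" for x
        using periodic[of x] per[of "x - h n"] by (simp add: algebra_simps)
      show "h n \<le> 2*pi" using h(2)[of n] pi_gt3 by linarith
    qed (use h[of n] in auto)
    moreover have "integrable circ (\<lambda>x. u (x + h n) * \<phi> x)" "integrable circ (\<lambda>x. u x * \<phi> x)"
        "integrable circ (\<lambda>x. u x * \<phi> (x - h n))"
      by (intro ic continuous_intros continuous_u c\<phi>' c\<phi> cu')+
    ultimately have "(\<integral>x. u (x + h n) * \<phi> x - u x * \<phi> x \<partial>circ) = (\<integral>x. u x * \<phi> (x - h n) - u x * \<phi> x \<partial>circ)"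
      by simp
    then have "(\<integral>x. (u (x + h n) * \<phi> x - u x * \<phi> x) / h n \<partial>circ) = (\<integral>x. (u x * \<phi> (x - h n) - u x * \<phi> x)
        / h n \<partial>circ)"
      by simp
    then show ?thesis by (simp add: algebra_simps diff_divide_distrib)
  qed
  obtain B\<phi> where B\<phi>: "\<And>x n. x \<in> {0<..<2*pi} \<Longrightarrow> \<bar>(\<phi> (x - h n) - \<phi> x) / h n\<bar> \<le> B\<phi>"
    using quotient_bounded[OF \<phi> \<phi>'] h by (metis greaterThanAtMost_iff)
  have "(\<lambda>n. \<integral>x. (u (x + h n) - u x) / h n * \<phi> x \<partial>circ) \<longlonglongrightarrow> (\<integral>x. d x * \<phi> x \<partial>circ)"
  proof (rule integral_dominated_convergence[where w = "\<lambda>x. (C + C / 2) * \<bar>\<phi> x\<bar>"])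
    show "(\<lambda>x. d x * \<phi> x) \<in> borel_measurable circ"
      by (intro borel_measurable_times borel_measurable_circ borel_measurable_d
          borel_measurable_continuous_onI c\<phi>)
    show "(\<lambda>x. (u (x + h n) - u x) / h n * \<phi> x) \<in> borel_measurable circ" for n
      by (intro borel_measurable_circ borel_measurable_continuous_onI continuous_intros continuous_u c\<phi> cu')
        (use h in \<open>auto simp: less_imp_neq[symmetric]\<close>)
    show "integrable circ (\<lambda>x. (C + C / 2) * \<bar>\<phi> x\<bar>)" by (intro ic continuous_intros c\<phi>)
    show "AE x in circ. (\<lambda>n. (u (x + h n) - u x) / h n * \<phi> x) \<longlonglongrightarrow> d x * \<phi> x"
      using AE_circ_countable[OF countable_discont]
      by eventually_elim (use quotient_tendsto in \<open>auto intro!: tendsto_mult simp: h_def simp del: of_nat_Suc\<close>)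
    show "AE x in circ. norm ((u (x + h n) - u x) / h n * \<phi> x) \<le> (C + C / 2) * \<bar>\<phi> x\<bar>" for n
    proof (rule AE_I2)
      fix x
      have "C / 2 * h n \<le> C / 2"
        using h(1)[of n] h(2)[of n] C_nonneg by (intro mult_right_le_one_le) simp_all
      then have "\<bar>(u (x + h n) - u x) / h n\<bar> \<le> C + C / 2"
        using quotient_bounds[OF h(1), of x n] bound[of x] bound[of "x + h n"] by linarith
      then show "norm ((u (x + h n) - u x) / h n * \<phi> x) \<le> (C + C / 2) * \<bar>\<phi> x\<bar>"
        unfolding real_norm_def abs_mult[of _ "\<phi> x"] by (rule mult_right_mono) simp
    qed
  qed
  moreover have "(\<lambda>n. \<integral>x. u x * ((\<phi> (x - h n) - \<phi> x) / h n) \<partial>circ) \<longlonglongrightarrow> (\<integral>x. u x * - \<phi>' x \<partial>circ)"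
  proof (rule integral_dominated_convergence[where w = "\<lambda>x. \<bar>u x\<bar> * B\<phi>"])
    show "(\<lambda>x. u x * - \<phi>' x) \<in> borel_measurable circ"
      by (intro borel_measurable_circ borel_measurable_continuous_onI continuous_intros continuous_u \<phi>')
    show "(\<lambda>x. u x * ((\<phi> (x - h n) - \<phi> x) / h n)) \<in> borel_measurable circ" for n
      by (intro borel_measurable_circ borel_measurable_continuous_onI continuous_intros continuous_u c\<phi> c\<phi>')
        (use h in \<open>auto simp: less_imp_neq[symmetric]\<close>)
    show "integrable circ (\<lambda>x. \<bar>u x\<bar> * B\<phi>)" by (intro ic continuous_intros continuous_u)
    show "AE x in circ. (\<lambda>n. u x * ((\<phi> (x - h n) - \<phi> x) / h n)) \<longlonglongrightarrow> u x * - \<phi>' x"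
      unfolding h_def by (intro AE_I2 tendsto_mult tendsto_const quotient_tendsto_deriv \<phi>)
    show "AE x in circ. norm (u x * ((\<phi> (x - h n) - \<phi> x) / h n)) \<le> \<bar>u x\<bar> * B\<phi>" for n
      unfolding real_norm_def abs_mult[of "u _"] by (intro AE_I2 mult_left_mono B\<phi>) auto
  qed
  ultimately have "(\<integral>x. d x * \<phi> x \<partial>circ) = (\<integral>x. u x * - \<phi>' x \<partial>circ)"
    unfolding eq by (rule LIMSEQ_unique)
  then show ?thesis by simp
qed

end

subsection \<open>Limits of semiconvex functions\<close>

text \<open>A slope for the limit at \<open>x\<close> is any cluster point of the slopes
  \<open>dw j x\<close>, which lie in a compact interval. The subsequence may depend on
  \<open>x\<close>, since the support inequality is needed at one base point at a time and is closed
  under limits.\<close>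

lemma semiconvex_limit:
  assumes sc: "\<And>j. semiconvex C (w j) (dw j)" and lim: "\<And>x. (\<lambda>j. w j x) \<longlonglongrightarrow> u x"
  obtains d where "semiconvex C u d"
proof -
  have "\<exists>l. \<bar>l\<bar> \<le> C \<and> (\<forall>y. u x + l * (y - x) - C / 2 * (y - x)\<^sup>2 \<le> u y)" for x
  proof -
    have "\<forall>j. dw j x \<in> {-C..C}"
    proof
      show "dw j x \<in> {-C..C}" for j using semiconvex.bound[OF sc, of j x] by (simp add: abs_le_iff)
    qed
    moreover have "seq_compact {-C..C}" by (simp add: compact_imp_seq_compact)
    ultimately obtain l r where l: "l \<in> {-C..C}" "strict_mono r" "((\<lambda>j. dw j x) \<circ> r) \<longlonglongrightarrow> l"
      using seq_compactE[of "{-C..C}" "\<lambda>j. dw j x"] by metis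
    have "u x + l * (y - x) - C / 2 * (y - x)\<^sup>2 \<le> u y" for y
    proof (rule LIMSEQ_le)
      show "(\<lambda>j. w (r j) x + dw (r j) x * (y - x) - C / 2 * (y - x)\<^sup>2) \<longlonglongrightarrow> u x + l * (y - x) - C / 2 * (y - x)\<^sup>2"
        using l(3) LIMSEQ_subseq_LIMSEQ[OF lim l(2)] unfolding o_def by (intro tendsto_intros)
      show "(\<lambda>j. w (r j) y) \<longlonglongrightarrow> u y"
        using LIMSEQ_subseq_LIMSEQ[OF lim l(2)] unfolding o_def .
      show "\<exists>N. \<forall>n\<ge>N. w (r n) x + dw (r n) x * (y - x) - C / 2 * (y - x)\<^sup>2 \<le> w (r n) y"
        using semiconvex.support[OF sc] by blast
    qed
    then show ?thesis using l(1) by (auto intro!: exI[of _ l])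
  qed
  then obtain d where d: "\<And>x. \<bar>d x\<bar> \<le> C" "\<And>x y. u x + d x * (y - x) - C / 2 * (y - x)\<^sup>2 \<le> u y"
    by metis
  have "u (x + 2*pi) = u x" for x
  proof (rule LIMSEQ_unique)
    show "(\<lambda>j. w j (x + 2*pi)) \<longlonglongrightarrow> u (x + 2*pi)" by (rule lim)
    show "(\<lambda>j. w j (x + 2*pi)) \<longlonglongrightarrow> u x" using lim[of x] by (simp add: semiconvex.periodic[OF sc])
  qed
  with d have "semiconvex C u d" by unfold_locales
  then show thesis by (rule that)
qed

text \<open>For fixed \<open>h\<close>, the forward quotient at \<open>x\<close> bounds
  \<open>dw j x\<close> from above and the quotient ending at \<open>x\<close> bounds it from below,
  up to \<open>C / 2 * h\<close>. These quotients converge with \<open>j\<close>, and continuity of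
  \<open>d\<close> puts their limits near \<open>d x\<close>.\<close>

lemma semiconvex_deriv_tendsto:
  assumes sc: "\<And>j. semiconvex C (w j) (dw j)" and u: "semiconvex C u d"
    and lim: "\<And>x. (\<lambda>j. w j x) \<longlonglongrightarrow> u x" and cont: "isCont d x"
  shows "(\<lambda>j. dw j x) \<longlonglongrightarrow> d x"
proof -
  interpret semiconvex C u d by fact
  show ?thesis
  proof (rule LIMSEQ_I)
    fix e :: real assume e: "e > 0"
    obtain s where s: "s > 0" "\<And>y. \<bar>y - x\<bar> < s \<Longrightarrow> \<bar>d y - d x\<bar> < e / 4"
      using cont e unfolding continuous_at_eps_delta dist_real_def by (metis zero_less_divide_iff
          zero_less_numeral)
    \<comment> \<open>Small enough for \<open>x + h\<close> and \<open>x - h\<close> to lie within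
      the continuity radius \<open>s\<close> and for the curvature error \<open>C / 2 * h\<close> to
      be at most \<open>e / 8\<close>. The summand 1 covers \<open>C = 0\<close>.\<close>
    define h where "h = min (s / 2) (e / (4 * (C + 1)))"
    have h: "h > 0" "h < s" using s(1) e C_nonneg by (auto simp: h_def)
    have "C * h \<le> (C + 1) * (e / (4 * (C + 1)))"
      using C_nonneg h(1) by (intro mult_mono) (auto simp: h_def)
    also have "(C + 1) * (e / (4 * (C + 1))) = e / 4" using C_nonneg by (simp add: field_simps)
    finally have Ch: "C * h \<le> e / 4" .
    have near: "\<bar>d (x + h) - d x\<bar> < e / 4" "\<bar>d (x - h) - d x\<bar> < e / 4" "C / 2 * h \<le> e / 8"
      using s(2)[of "x + h"] s(2)[of "x - h"] h Ch by simp_all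
    have "(\<lambda>j. (w j (x + h) - w j x) / h) \<longlonglongrightarrow> (u (x + h) - u x) / h"
      by (intro tendsto_intros lim) (use h in auto)
    moreover have "(u (x + h) - u x) / h < d x + e / 2"
      using quotient_bounds(2)[OF h(1), of x] near e by linarith
    ultimately have "eventually (\<lambda>j. (w j (x + h) - w j x) / h < d x + e / 2) sequentially"
      by (rule order_tendstoD)
    moreover have "(\<lambda>j. (w j (x - h + h) - w j (x - h)) / h) \<longlonglongrightarrow> (u (x - h + h) - u (x - h)) / h"
      by (intro tendsto_intros lim) (use h in auto)
    moreover have "(u (x - h + h) - u (x - h)) / h > d x - e / 2"
      using quotient_bounds(1)[OF h(1), of "x - h"] near e by linarith
    ultimately have "eventually (\<lambda>j. (w j (x + h) - w j x) / h < d x + e / 2 \<and>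
        (w j (x - h + h) - w j (x - h)) / h > d x - e / 2) sequentially"
      by (intro eventually_conj) (auto dest: order_tendstoD)
    then have "eventually (\<lambda>j. norm (dw j x - d x) < e) sequentially"
    proof eventually_elim
      case (elim j)
      interpret j: semiconvex C "w j" "dw j" by (rule sc)
      show ?case
        using elim j.quotient_bounds(1)[OF h(1), of x] j.quotient_bounds(2)[OF h(1), of "x - h"] near(3) e
        by (simp add: abs_less_iff)
    qed
    then show "\<exists>N. \<forall>n\<ge>N. norm (dw n x - d x) < e" by (simp add: eventually_sequentially)
  qed
qed

section \<open>Sobolev convergence\<close>

lemma in_Lp_bounded:
  assumes "g \<in> borel_measurable circ" "\<And>x. \<bar>g x\<bar> \<le> B" "p \<ge> 0"
  shows "in_Lp p g"
  unfolding in_Lp_def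
proof
  show "integrable circ (\<lambda>\<theta>. \<bar>g \<theta>\<bar> powr p)"
    by (rule integrable_circ_bounded[where B = "B powr p"]) (use assms in \<open>auto intro!: powr_mono2\<close>)
qed fact

lemma Lp_norm_tendsto_0:
  assumes meas: "\<And>j. g j \<in> borel_measurable circ" and bd: "\<And>j x. \<bar>g j x\<bar> \<le> B"
    and p: "p > 0" and lim: "AE x in circ. (\<lambda>j. g j x) \<longlonglongrightarrow> 0"
  shows "(\<lambda>j. Lp_norm p (g j)) \<longlonglongrightarrow> 0"
proof -
  have "(\<lambda>j. \<integral>x. \<bar>g j x\<bar> powr p \<partial>circ) \<longlonglongrightarrow> (\<integral>x. 0 \<partial>circ)"
  proof (rule integral_dominated_convergence[where w = "\<lambda>x. B powr p"])
    show "AE x in circ. (\<lambda>j. \<bar>g j x\<bar> powr p) \<longlonglongrightarrow> 0"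
      using lim by eventually_elim (rule tendsto_zero_powrI[OF tendsto_rabs_zero tendsto_const], use p in auto)
    show "AE x in circ. norm (\<bar>g j x\<bar> powr p) \<le> B powr p" for j
      using bd p by (auto intro!: AE_I2 powr_mono2)
  qed (use meas finite_measure_circ in \<open>auto simp: finite_measure.integrable_const\<close>)
  then show ?thesis
    unfolding Lp_norm_def
    by (intro tendsto_zero_powrI[OF _ tendsto_const]) (use p in auto)
qed

lemma smooth_circle_deriv:
  assumes "\<phi> \<in> smooth_circle"
  shows "((deriv ^^ n) \<phi> has_real_derivative (deriv ^^ Suc n) \<phi> x) (at x)" "continuous_on S ((deriv ^^ n) \<phi>)"
    "\<phi> (x + 2*pi) = \<phi> x"
proof -
  have "(deriv ^^ n) \<phi> differentiable (at x)" for x using assms by (simp add: smooth_circle_def)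
  then show "((deriv ^^ n) \<phi> has_real_derivative (deriv ^^ Suc n) \<phi> x) (at x)" for x
    using DERIV_deriv_iff_real_differentiable by auto
  then show "continuous_on S ((deriv ^^ n) \<phi>)"
    by (meson DERIV_isCont continuous_at_imp_continuous_on)
  show "\<phi> (x + 2*pi) = \<phi> x" using assms by (simp add: smooth_circle_def periodic_2pi_def)
qed

lemma (in semiconvex) has_weak_deriv: "has_weak_deriv u d"
  unfolding has_weak_deriv_def
proof (intro conjI ballI integrable_u integrable_d)
  fix \<phi> assume \<phi>: "\<phi> \<in> smooth_circle"
  note D = smooth_circle_deriv[OF \<phi>]
  show "(\<integral>\<theta>. u \<theta> * deriv \<phi> \<theta> \<partial>circ) = - (\<integral>\<theta>. d \<theta> * \<phi> \<theta> \<partial>circ)"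
    by (rule weak_deriv) (use D(1)[of 0] D(2)[of UNIV 1] D(3) in auto)
qed

lemma integral_circ_tendsto:
  fixes B :: real
  assumes meas: "\<And>j. g j \<in> borel_measurable circ" "h \<in> borel_measurable circ" and bd: "\<And>j x. \<bar>g j x\<bar> \<le> B"
    and lim: "AE x in circ. (\<lambda>j. g j x) \<longlonglongrightarrow> h x" and \<psi>: "integrable circ \<psi>"
  shows "(\<lambda>j. \<integral>x. g j x * \<psi> x \<partial>circ) \<longlonglongrightarrow> (\<integral>x. h x * \<psi> x \<partial>circ)"
proof (rule integral_dominated_convergence[where w = "\<lambda>x. B * \<bar>\<psi> x\<bar>"])
  have [measurable]: "\<psi> \<in> borel_measurable circ" using \<psi> by (rule borel_measurable_integrable)
  show "(\<lambda>x. h x * \<psi> x) \<in> borel_measurable circ" "\<And>j. (\<lambda>x. g j x * \<psi> x) \<in> borel_measurable circ"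
    using meas by auto
  show "integrable circ (\<lambda>x. B * \<bar>\<psi> x\<bar>)" using \<psi> by simp
  show "AE x in circ. (\<lambda>j. g j x * \<psi> x) \<longlonglongrightarrow> h x * \<psi> x"
    using lim by eventually_elim (rule tendsto_mult_right)
  show "AE x in circ. norm (g j x * \<psi> x) \<le> B * \<bar>\<psi> x\<bar>" for j
    by (rule AE_I2) (simp add: abs_mult mult_right_mono bd)
qed

context
  fixes C B :: real and w dw :: "nat \<Rightarrow> real \<Rightarrow> real" and u d :: "real \<Rightarrow> real"
  assumes sc: "\<And>j. semiconvex C (w j) (dw j)" and u: "semiconvex C u d"
    and lim: "\<And>x. (\<lambda>j. w j x) \<longlonglongrightarrow> u x" and bd: "\<And>j x. \<bar>w j x\<bar> \<le> B"
begin

lemma limit_bounded: "\<bar>u x\<bar> \<le> B"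
  by (rule LIMSEQ_le_const2[OF tendsto_rabs[OF lim]]) (use bd in auto)

text \<open>Almost everywhere convergence of slopes bounded by \<open>C\<close> is the common source
  of weak-* convergence and of strong convergence for all finite exponents, each by dominated
  convergence.\<close>

lemma deriv_AE_tendsto: "AE x in circ. (\<lambda>j. dw j x) \<longlonglongrightarrow> d x"
  using AE_circ_countable[OF semiconvex.countable_discont[OF u]]
  by eventually_elim (auto intro: semiconvex_deriv_tendsto[OF sc u lim])

lemma semiconvex_measurable:
  assumes "semiconvex C v e"
  shows "v \<in> borel_measurable circ" "e \<in> borel_measurable circ"
  using semiconvex.continuous_u[OF assms] semiconvex.borel_measurable_d[OF assms]
  by (auto intro!: borel_measurable_circ borel_measurable_continuous_onI)

lemmas meas = semiconvex_measurable[OF sc] semiconvex_measurable[OF u]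

lemma weakstar_W1inf_limit: "weakstar_W1inf w u"
  unfolding weakstar_W1inf_def
proof (intro exI[of _ dw] exI[of _ d] conjI allI impI)
  show "in_Linf (w j)" "in_Linf (dw j)" for j
    unfolding in_Linf_def
    by (intro conjI meas exI[of _ B] exI[of _ C] AE_I2 bd semiconvex.bound[OF sc])+
  show "in_Linf u" "in_Linf d"
    unfolding in_Linf_def
    by (intro conjI meas exI[of _ B] exI[of _ C] AE_I2 limit_bounded semiconvex.bound[OF u])+
  show "has_weak_deriv (w j) (dw j)" "has_weak_deriv u d" for j
    using sc u by (auto intro: semiconvex.has_weak_deriv)
  fix \<psi> :: "real \<Rightarrow> real" assume \<psi>: "integrable circ \<psi>"
  show "(\<lambda>j. \<integral>\<theta>. w j \<theta> * \<psi> \<theta> \<partial>circ) \<longlonglongrightarrow> (\<integral>\<theta>. u \<theta> * \<psi> \<theta> \<partial>circ)"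
    by (rule integral_circ_tendsto[OF _ _ bd _ \<psi>]) (use meas lim in auto)
  show "(\<lambda>j. \<integral>\<theta>. dw j \<theta> * \<psi> \<theta> \<partial>circ) \<longlonglongrightarrow> (\<integral>\<theta>. d \<theta> * \<psi> \<theta> \<partial>circ)"
    by (rule integral_circ_tendsto[OF _ _ semiconvex.bound[OF sc] deriv_AE_tendsto \<psi>]) (use meas in auto)
qed

lemma Lp_tendsto:
  assumes p: "p > 0"
  shows "(\<lambda>j. Lp_norm p (\<lambda>\<theta>. w j \<theta> - u \<theta>)) \<longlonglongrightarrow> 0"
proof (rule Lp_norm_tendsto_0[OF _ _ p, where B = "2 * B"])
  show "\<bar>w j x - u x\<bar> \<le> 2 * B" for j x
    using abs_triangle_ineq4[of "w j x" "u x"] bd[of j x] limit_bounded[of x] by linarith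
  show "AE x in circ. (\<lambda>j. w j x - u x) \<longlonglongrightarrow> 0"
    by (intro AE_I2 LIM_zero lim)
qed (use meas in auto)

lemma tendsto_W1p_limit:
  assumes p: "p \<ge> 1"
  shows "tendsto_W1p p w u"
  unfolding tendsto_W1p_def
proof (intro exI[of _ dw] exI[of _ d] conjI allI impI)
  have p0: "p \<ge> 0" "p > 0" using p by auto
  show "in_Lp p (w j)" "in_Lp p (dw j)" for j
    using in_Lp_bounded[OF meas(1) bd p0(1)] in_Lp_bounded[OF meas(2) semiconvex.bound[OF sc] p0(1)] by auto
  show "in_Lp p u" "in_Lp p d"
    using in_Lp_bounded[OF meas(3) limit_bounded p0(1)] in_Lp_bounded[OF meas(4) semiconvex.bound[OF u]
        p0(1)] by auto
  show "has_weak_deriv (w j) (dw j)" "has_weak_deriv u d" for j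
    using sc u by (auto intro: semiconvex.has_weak_deriv)
  show "(\<lambda>j. Lp_norm p (\<lambda>\<theta>. w j \<theta> - u \<theta>)) \<longlonglongrightarrow> 0" by (rule Lp_tendsto[OF p0(2)])
  show "(\<lambda>j. Lp_norm p (\<lambda>\<theta>. dw j \<theta> - d \<theta>)) \<longlonglongrightarrow> 0"
  proof (rule Lp_norm_tendsto_0[OF _ _ p0(2), where B = "2 * C"])
    show "\<bar>dw j x - d x\<bar> \<le> 2 * C" for j x
      using abs_triangle_ineq4[of "dw j x" "d x"] semiconvex.bound[OF sc, of j x] semiconvex.bound[OF u,
          of x] by linarith
    show "AE x in circ. (\<lambda>j. dw j x - d x) \<longlonglongrightarrow> 0"
      using deriv_AE_tendsto by eventually_elim (rule LIM_zero)
  qed (use meas in auto)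
qed

end

section \<open>Bounds for second derivatives\<close>

lemma smooth_circle_add_cmult:
  assumes "\<phi> \<in> smooth_circle" "\<psi> \<in> smooth_circle"
  shows "(deriv ^^ n) (\<lambda>x. a * \<phi> x + b * \<psi> x) = (\<lambda>x. a * (deriv ^^ n) \<phi> x + b * (deriv ^^ n) \<psi> x)"
    "(\<lambda>x. a * \<phi> x + b * \<psi> x) \<in> smooth_circle"
proof -
  have D: "((\<lambda>x. a * (deriv ^^ n) \<phi> x + b * (deriv ^^ n) \<psi> x) has_real_derivative
      a * (deriv ^^ Suc n) \<phi> x + b * (deriv ^^ Suc n) \<psi> x) (at x)" for n x
    by (intro DERIV_add DERIV_cmult smooth_circle_deriv(1)[OF assms(1)] smooth_circle_deriv(1)[OF assms(2)])
  show eq: "(deriv ^^ n) (\<lambda>x. a * \<phi> x + b * \<psi> x) = (\<lambda>x. a * (deriv ^^ n) \<phi> x + b * (deriv ^^ n) \<psi> x)" for n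
  proof (induction n)
    case (Suc n)
    have "(deriv ^^ Suc n) (\<lambda>x. a * \<phi> x + b * \<psi> x) x = a * (deriv ^^ Suc n) \<phi> x + b * (deriv ^^ Suc n) \<psi>
        x" for x
      using DERIV_imp_deriv[OF D] Suc by simp
    then show ?case by blast
  qed simp
  show "(\<lambda>x. a * \<phi> x + b * \<psi> x) \<in> smooth_circle"
    unfolding smooth_circle_def periodic_2pi_def using smooth_circle_deriv(3)[OF assms(1)]
        smooth_circle_deriv(3)[OF assms(2)]
    by (auto simp: eq real_differentiable_def intro: D)
qed

text \<open>The first-order terms of the two expansions cancel. Writing the quotient as a mean of
  values of \<open>\<phi>''\<close> near \<open>x\<close> gives both its limit and its
  domination.\<close>

lemma Taylor_symmetric:
  fixes \<phi> :: "real \<Rightarrow> real"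
  assumes D: "\<And>x. (\<phi> has_real_derivative \<phi>' x) (at x)" "\<And>x. (\<phi>' has_real_derivative \<phi>'' x) (at x)" and
      h: "h > 0"
  shows "\<exists>s t. \<bar>s - x\<bar> \<le> h \<and> \<bar>t - x\<bar> \<le> h \<and> (\<phi> (x + h) + \<phi> (x - h) - 2 * \<phi> x) / h\<^sup>2 = (\<phi>'' s + \<phi>'' t) / 2"
proof -
  define diff where "diff m = (if m = 0 then \<phi> else if m = 1 then \<phi>' else \<phi>'')" for m :: nat
  have diff: "\<forall>m t. m < 2 \<and> x - h \<le> t \<and> t \<le> x + h \<longrightarrow> DERIV (diff m) t :> diff (Suc m) t"
    using D by (auto simp: diff_def less_2_cases_iff)
  obtain s where s: "x < s" "s < x + h" "\<phi> (x + h) = (\<Sum>m<2. diff m x / fact m * (x + h - x) ^ m) + diff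
      2 s / fact 2 * (x + h - x)\<^sup>2"
    using Taylor_up[of 2 diff \<phi> "x - h" "x + h" x] diff h by (auto simp: diff_def)
  obtain t where t: "x - h < t" "t < x" "\<phi> (x - h) = (\<Sum>m<2. diff m x / fact m * (x - h - x) ^ m) + diff
      2 t / fact 2 * (x - h - x)\<^sup>2"
    using Taylor_down[of 2 diff \<phi> "x - h" "x + h" x] diff h by (auto simp: diff_def)
  have "\<phi> (x + h) + \<phi> (x - h) - 2 * \<phi> x = (\<phi>'' s + \<phi>'' t) / 2 * h\<^sup>2"
    using s(3) t(3) by (simp add: diff_def numeral_2_eq_2 algebra_simps power2_eq_square)
  then show ?thesis using s t h by (intro exI[of _ s] exI[of _ t]) auto
qed

context semiconvex
begin

text \<open>The distribution u'' + C is non-negative. It is the limit of the non-negative second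
  differences of \<open>u\<close>, whose shifts are moved onto the test function.\<close>

lemma second_deriv_nonneg:
  assumes D: "\<And>x. (\<phi> has_real_derivative \<phi>' x) (at x)" "\<And>x. (\<phi>' has_real_derivative \<phi>'' x) (at x)"
    and c: "continuous_on UNIV \<phi>''" and per: "\<And>x. \<phi> (x + 2*pi) = \<phi> x" and pos: "\<And>x. \<phi> x \<ge> 0"
  shows "(\<integral>x. u x * \<phi>'' x \<partial>circ) + C * (\<integral>x. \<phi> x \<partial>circ) \<ge> 0"
proof -
  define h where "h n = 1 / real (Suc n)" for n
  have h: "0 < h n" "h n \<le> 1" "h n \<le> 2*pi" for n
  proof -
    show *: "0 < h n" "h n \<le> 1" by (simp_all add: h_def)
    show "h n \<le> 2*pi" using *(2) pi_gt3 by linarith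
  qed
  have h_lim: "h \<longlonglongrightarrow> 0"
    using LIMSEQ_inverse_real_of_nat by (simp add: h_def[abs_def] inverse_eq_divide)
  have c\<phi>: "continuous_on S \<phi>" for S
    using D(1) by (meson DERIV_isCont continuous_at_imp_continuous_on)
  have cs: "continuous_on UNIV (\<lambda>x. u (x + s))" "continuous_on UNIV (\<lambda>x. \<phi> (x + s))"
      "continuous_on UNIV (\<lambda>x. u (x - s))" "continuous_on UNIV (\<lambda>x. \<phi> (x - s))" for s
    by (intro continuous_on_compose2[OF c\<phi>[of UNIV]] continuous_on_compose2[OF continuous_u[of UNIV]]
        continuous_intros; simp)+
  note ic = integrable_circ_continuous
  have int: "integrable circ (\<lambda>x. u (x + s) * \<phi> x)" "integrable circ (\<lambda>x. u (x - s) * \<phi> x)"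
     "integrable circ (\<lambda>x. u x * \<phi> (x - s))" "integrable circ (\<lambda>x. u x * \<phi> (x + s))" "integrable circ
         (\<lambda>x. u x * \<phi> x)" for s
    by (intro ic continuous_intros continuous_u c\<phi> cs)+
  have ge: "(\<integral>x. u x * ((\<phi> (x + h n) + \<phi> (x - h n) - 2 * \<phi> x) / (h n)\<^sup>2) \<partial>circ) \<ge> - C * (\<integral>x. \<phi> x \<partial>circ)" for n
  proof -
    have *: "(\<integral>x. u (x + h n) * \<phi> (x + h n - h n) \<partial>circ) = (\<integral>x. u x * \<phi> (x - h n) \<partial>circ)"
    proof (rule integral_circ_shift)
      show "u (x + 2*pi) * \<phi> (x + 2*pi - h n) = u x * \<phi> (x - h n)" for x
        using periodic[of x] per[of "x - h n"] by (simp add: algebra_simps)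
    qed (use h[of n] in \<open>auto intro!: continuous_intros continuous_u cs\<close>)
    have **: "(\<integral>x. u (x + h n - h n) * \<phi> (x + h n) \<partial>circ) = (\<integral>x. u (x - h n) * \<phi> x \<partial>circ)"
    proof (rule integral_circ_shift)
      show "u (x + 2*pi - h n) * \<phi> (x + 2*pi) = u (x - h n) * \<phi> x" for x
        using periodic[of "x - h n"] per[of x] by (simp add: algebra_simps)
    qed (use h[of n] in \<open>auto intro!: continuous_intros c\<phi> cs\<close>)
    have "- C * (h n)\<^sup>2 * (\<integral>x. \<phi> x \<partial>circ) = (\<integral>x. - C * (h n)\<^sup>2 * \<phi> x \<partial>circ)" by simp
    also have "\<dots> \<le> (\<integral>x. u (x + h n) * \<phi> x + u (x - h n) * \<phi> x - 2 * (u x * \<phi> x) \<partial>circ)"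
    proof (rule integral_mono)
      fix x
      show "- C * (h n)\<^sup>2 * \<phi> x \<le> u (x + h n) * \<phi> x + u (x - h n) * \<phi> x - 2 * (u x * \<phi> x)"
        using mult_right_mono[OF second_difference pos, of "h n" x x] by (simp add: algebra_simps)
    qed (use int in \<open>auto intro!: ic continuous_intros c\<phi>\<close>)
    also have "\<dots> = (\<integral>x. u x * \<phi> (x + h n) + u x * \<phi> (x - h n) - 2 * (u x * \<phi> x) \<partial>circ)"
      using * ** int by simp
    also have "\<dots> = (\<integral>x. (h n)\<^sup>2 * (u x * ((\<phi> (x + h n) + \<phi> (x - h n) - 2 * \<phi> x) / (h n)\<^sup>2)) \<partial>circ)"
    proof -
      have "(h n)\<^sup>2 * (u x * (X / (h n)\<^sup>2)) = u x * X" for x X using h(1)[of n] by simp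
      then show ?thesis by (simp only: right_diff_distrib distrib_left mult.left_commute[of "u _" 2])
    qed
    also have "\<dots> = (h n)\<^sup>2 * (\<integral>x. u x * ((\<phi> (x + h n) + \<phi> (x - h n) - 2 * \<phi> x) / (h n)\<^sup>2) \<partial>circ)"
      by (rule integral_mult_right_zero)
    also have "- C * (h n)\<^sup>2 * (\<integral>x. \<phi> x \<partial>circ) = (h n)\<^sup>2 * (- C * (\<integral>x. \<phi> x \<partial>circ))" by simp
    finally have "(h n)\<^sup>2 * (- C * (\<integral>x. \<phi> x \<partial>circ)) \<le> (h n)\<^sup>2 * (\<integral>x. u x * ((\<phi> (x + h n) + \<phi> (x - h n) -
        2 * \<phi> x) / (h n)\<^sup>2) \<partial>circ)" .
    then show ?thesis using h(1)[of n] by (subst (asm) mult_le_cancel_left_pos) auto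
  qed
  have "compact (\<phi>'' ` {-1..2*pi+1})"
    by (intro compact_continuous_image continuous_on_subset[OF c]) auto
  then obtain B where B: "\<And>x. x \<in> {-1..2*pi+1} \<Longrightarrow> \<bar>\<phi>'' x\<bar> \<le> B"
    using compact_imp_bounded bounded_iff by (metis image_eqI real_norm_def)
  have "(\<lambda>n. \<integral>x. u x * ((\<phi> (x + h n) + \<phi> (x - h n) - 2 * \<phi> x) / (h n)\<^sup>2) \<partial>circ) \<longlonglongrightarrow> (\<integral>x. u x * \<phi>'' x \<partial>circ)"
  proof (rule integral_dominated_convergence[where w = "\<lambda>x. \<bar>u x\<bar> * B"])
    show "(\<lambda>x. u x * \<phi>'' x) \<in> borel_measurable circ"
      by (intro borel_measurable_circ borel_measurable_continuous_onI continuous_intros continuous_u c)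
    show "(\<lambda>x. u x * ((\<phi> (x + h n) + \<phi> (x - h n) - 2 * \<phi> x) / (h n)\<^sup>2)) \<in> borel_measurable circ" for n
      by (intro borel_measurable_circ borel_measurable_continuous_onI continuous_intros continuous_u c\<phi> cs)
         (use h(1)[of n] in auto)
    show "integrable circ (\<lambda>x. \<bar>u x\<bar> * B)" by (intro ic continuous_intros continuous_u)
    have "(\<lambda>n. (\<phi> (x + h n) + \<phi> (x - h n) - 2 * \<phi> x) / (h n)\<^sup>2) \<longlonglongrightarrow> \<phi>'' x" for x
    proof -
      have "\<forall>n. \<exists>s t. \<bar>s - x\<bar> \<le> h n \<and> \<bar>t - x\<bar> \<le> h n \<and>
          (\<phi> (x + h n) + \<phi> (x - h n) - 2 * \<phi> x) / (h n)\<^sup>2 = (\<phi>'' s + \<phi>'' t) / 2"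
        using Taylor_symmetric[OF D h(1)] by blast
      then obtain s t where st: "\<And>n. \<bar>s n - x\<bar> \<le> h n" "\<And>n. \<bar>t n - x\<bar> \<le> h n"
          "\<And>n. (\<phi> (x + h n) + \<phi> (x - h n) - 2 * \<phi> x) / (h n)\<^sup>2 = (\<phi>'' (s n) + \<phi>'' (t n)) / 2" by metis
      have "s \<longlonglongrightarrow> x" "t \<longlonglongrightarrow> x"
        using Lim_null_comparison[of "\<lambda>n. s n - x" h] Lim_null_comparison[of "\<lambda>n. t n - x" h] st h_lim
        by (auto intro: LIM_zero_cancel)
      moreover have "isCont \<phi>'' x" using c by (simp add: continuous_on_eq_continuous_at)
      ultimately have "(\<lambda>n. (\<phi>'' (s n) + \<phi>'' (t n)) / 2) \<longlonglongrightarrow> (\<phi>'' x + \<phi>'' x) / 2"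
        by (intro tendsto_intros isCont_tendsto_compose[of x \<phi>'']) auto
      then show ?thesis by (simp add: st(3))
    qed
    then show "AE x in circ. (\<lambda>n. u x * ((\<phi> (x + h n) + \<phi> (x - h n) - 2 * \<phi> x) / (h n)\<^sup>2)) \<longlonglongrightarrow> u x * \<phi>'' x"
      by (intro AE_I2 tendsto_mult_left)
    have "\<bar>(\<phi> (x + h n) + \<phi> (x - h n) - 2 * \<phi> x) / (h n)\<^sup>2\<bar> \<le> B" if "x \<in> {0<..<2*pi}" for x n
    proof -
      obtain s t where st: "\<bar>s - x\<bar> \<le> h n" "\<bar>t - x\<bar> \<le> h n"
          "(\<phi> (x + h n) + \<phi> (x - h n) - 2 * \<phi> x) / (h n)\<^sup>2 = (\<phi>'' s + \<phi>'' t) / 2"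
        using Taylor_symmetric[OF D h(1)] by blast
      have "\<bar>\<phi>'' s\<bar> \<le> B" "\<bar>\<phi>'' t\<bar> \<le> B"
        using st(1,2) h(2)[of n] that by (intro B; simp add: abs_le_iff)+
      then show ?thesis unfolding st(3) using abs_triangle_ineq[of "\<phi>'' s" "\<phi>'' t"] by simp
    qed
    then show "AE x in circ. norm (u x * ((\<phi> (x + h n) + \<phi> (x - h n) - 2 * \<phi> x) / (h n)\<^sup>2)) \<le> \<bar>u x\<bar> * B" for n
      unfolding real_norm_def abs_mult[of "u _"] by (intro AE_I2 mult_left_mono) auto
  qed
  then have "- C * (\<integral>x. \<phi> x \<partial>circ) \<le> (\<integral>x. u x * \<phi>'' x \<partial>circ)"
    by (rule LIMSEQ_le_const) (use ge in blast)
  then show ?thesis by simp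
qed

text \<open>Formally, the non-negative measure u'' + C has mass \<open>2 * pi * C\<close>, because
  u'' has mean zero, so the total variation of u'' is at most \<open>4 * pi * C\<close>. Hence
  pairing with u'' is Lipschitz in the uniform norm, which allows extension from smooth to
  continuous test functions.\<close>

lemma second_deriv_bound:
  assumes p: "p \<in> smooth_circle" and q: "q \<in> smooth_circle" and le: "\<And>x. \<bar>p x - q x\<bar> \<le> e"
  shows "\<bar>(\<integral>x. u x * (deriv ^^ 2) p x \<partial>circ) - (\<integral>x. u x * (deriv ^^ 2) q x \<partial>circ)\<bar> \<le> 4 * pi * C * e"
proof -
  have *: "(\<integral>x. u x * (deriv ^^ 2) p x \<partial>circ) - (\<integral>x. u x * (deriv ^^ 2) q x \<partial>circ) \<le> 4 * pi * C * e"
    if p: "p \<in> smooth_circle" and q: "q \<in> smooth_circle" and le: "\<And>x. \<bar>p x - q x\<bar> \<le> e" for p q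
  proof -
    note P = smooth_circle_deriv[OF p] and Q = smooth_circle_deriv[OF q]
    have ints: "integrable circ p" "integrable circ q"
      "integrable circ (\<lambda>x. u x * (deriv ^^ 2) p x)" "integrable circ (\<lambda>x. u x * (deriv ^^ 2) q x)"
      using P(2)[of UNIV 0] Q(2)[of UNIV 0] P(2)[of UNIV 2] Q(2)[of UNIV 2]
      by (auto intro!: integrable_circ_continuous continuous_intros continuous_u)
    \<comment> \<open>Non-negativity is applied to the difference raised by \<open>e\<close>; the
      added constant does not affect the second derivative and keeps the integral below
      \<open>4 * pi * e\<close>.\<close>
    have "(\<integral>x. u x * ((deriv ^^ 2) q x - (deriv ^^ 2) p x) \<partial>circ) + C * (\<integral>x. (q x - p x + e) \<partial>circ) \<ge> 0"
    proof (rule second_deriv_nonneg)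
      show "((\<lambda>x. q x - p x + e) has_real_derivative ((deriv ^^ 1) q x - (deriv ^^ 1) p x)) (at x)" for x
        using P(1)[of 0] Q(1)[of 0] by (auto intro!: derivative_eq_intros)
      show "((\<lambda>x. (deriv ^^ 1) q x - (deriv ^^ 1) p x) has_real_derivative ((deriv ^^ 2) q x - (deriv ^^
          2) p x)) (at x)" for x
        using P(1)[of 1 x] Q(1)[of 1 x] unfolding Suc_1 by (intro DERIV_diff)
      show "continuous_on UNIV (\<lambda>x. (deriv ^^ 2) q x - (deriv ^^ 2) p x)"
        by (intro continuous_intros P Q)
      show "q x - p x + e \<ge> 0" for x using le[of x] by linarith
    qed (simp add: P(3) Q(3))
    moreover have "(\<integral>x. u x * ((deriv ^^ 2) q x - (deriv ^^ 2) p x) \<partial>circ) =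
        (\<integral>x. u x * (deriv ^^ 2) q x \<partial>circ) - (\<integral>x. u x * (deriv ^^ 2) p x \<partial>circ)"
      using ints by (simp add: right_diff_distrib)
    moreover have "(\<integral>x. (q x - p x + e) \<partial>circ) \<le> (\<integral>x. 2 * e \<partial>circ)"
    proof (rule integral_mono)
      show "q x - p x + e \<le> 2 * e" for x using le[of x] by linarith
    qed (use ints finite_measure_circ in \<open>auto simp: finite_measure.integrable_const\<close>)
    then have "C * (\<integral>x. (q x - p x + e) \<partial>circ) \<le> C * (4 * pi * e)"
      using C_nonneg by (intro mult_left_mono) (auto simp: measure_circ)
    ultimately show ?thesis by (simp add: algebra_simps)
  qed
  show ?thesis
    using *[OF p q le] *[OF q p] le by (simp add: abs_le_iff abs_minus_commute)
qed

end

section \<open>Density of trigonometric polynomials\<close>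

inductive trig_poly :: "(real \<Rightarrow> real) \<Rightarrow> bool" where
  const: "trig_poly (\<lambda>x. c)"
| cos: "trig_poly cos"
| sin: "trig_poly sin"
| add: "trig_poly f \<Longrightarrow> trig_poly g \<Longrightarrow> trig_poly (\<lambda>x. f x + g x)"
| mult: "trig_poly f \<Longrightarrow> trig_poly g \<Longrightarrow> trig_poly (\<lambda>x. f x * g x)"

text \<open>The algebra generated by the constants, sine and cosine is closed under differentiation,
  so the existence of one derivative yields smoothness by iteration.\<close>

lemma trig_poly_deriv:
  "trig_poly f \<Longrightarrow> \<exists>g. trig_poly g \<and> (\<forall>x. (f has_real_derivative g x) (at x))"
proof (induction rule: trig_poly.induct)
  case (const c)
  then show ?case by (intro exI[of _ "\<lambda>x. 0"] conjI trig_poly.const) auto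
next
  case cos
  have "trig_poly (\<lambda>x. - 1 * sin x)" by (intro trig_poly.intros)
  then show ?case by (intro exI[of _ "\<lambda>x. - 1 * sin x"]) (auto intro!: derivative_eq_intros)
next
  case sin
  show ?case by (rule exI[of _ cos]) (auto intro: trig_poly.intros DERIV_sin)
next
  case (add f g)
  then obtain f' g' where "trig_poly f'" "trig_poly g'"
    "\<And>x. (f has_real_derivative f' x) (at x)" "\<And>x. (g has_real_derivative g' x) (at x)" by blast
  then show ?case by (intro exI[of _ "\<lambda>x. f' x + g' x"] conjI trig_poly.add allI DERIV_add)
next
  case (mult f g)
  then obtain f' g' where "trig_poly f'" "trig_poly g'"
    "\<And>x. (f has_real_derivative f' x) (at x)" "\<And>x. (g has_real_derivative g' x) (at x)" by blast
  then show ?case using mult(1,2)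
    by (intro exI[of _ "\<lambda>x. f' x * g x + g' x * f x"] conjI trig_poly.add trig_poly.mult allI DERIV_mult)
qed

lemma trig_poly_smooth:
  assumes "trig_poly f"
  shows "f \<in> smooth_circle"
proof -
  have *: "trig_poly (deriv g)" if g: "trig_poly g" for g
  proof -
    obtain g' where "trig_poly g'" "\<And>x. (g has_real_derivative g' x) (at x)" using trig_poly_deriv[OF g]
        by blast
    moreover from this(2) have "deriv g = g'" by (auto intro: DERIV_imp_deriv)
    ultimately show ?thesis by simp
  qed
  have "trig_poly ((deriv ^^ n) f)" for n by (induction n) (use assms * in auto)
  then have "(deriv ^^ n) f differentiable (at x)" for n x
    using trig_poly_deriv real_differentiable_def by blast
  moreover have "f (x + 2*pi) = f x" for x
    using assms by (induction rule: trig_poly.induct) auto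
  ultimately show ?thesis by (simp add: smooth_circle_def periodic_2pi_def)
qed

lemma real_polynomial_function_cis:
  fixes p :: "complex \<Rightarrow> real"
  assumes "real_polynomial_function p"
  shows "trig_poly (\<lambda>t. p (cis t))"
  using assms
proof (induction rule: real_polynomial_function.induct)
  case (linear f)
  interpret bounded_linear f by fact
  have "f (cis t) = cos t * f 1 + sin t * f \<i>" for t
  proof -
    have "cis t = cos t *\<^sub>R 1 + sin t *\<^sub>R \<i>" by (simp add: complex_eq_iff)
    then show ?thesis by (simp only: add scaleR real_scaleR_def)
  qed
  then show ?case by (simp add: trig_poly.intros)
qed (auto intro: trig_poly.intros)

text \<open>A periodic function factors through the unit circle, a compact set on which the
  Stone-Weierstrass theorem applies.\<close>

lemma periodic_cis_eq:
  assumes per: "\<And>x :: real. \<phi> (x + 2*pi) = \<phi> x" and eq: "cis a = cis b"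
  shows "\<phi> a = \<phi> b"
proof -
  have nat: "\<phi> (x + 2*pi * real n) = \<phi> x" for x n
  proof (induction n)
    case (Suc n)
    have "\<phi> (x + 2*pi * real (Suc n)) = \<phi> (x + 2*pi * real n + 2*pi)" by (simp add: algebra_simps)
    then show ?case by (simp only: per Suc)
  qed simp
  have "cos a = cos b" "sin a = sin b" using eq by (auto simp: complex_eq_iff)
  then obtain n :: int where n: "a = b + 2*pi * n" using sin_cos_eq_iff by blast
  show ?thesis
  proof (cases "n \<ge> 0")
    case True
    then show ?thesis using nat[of b "nat n"] n by simp
  next
    case False
    then have "b = a + 2*pi * real (nat (- n))" using n by (simp add: algebra_simps)
    then show ?thesis using nat[of a "nat (- n)"] by simp
  qed
qed

text \<open>\<open>\<phi>\<close> composed with the argument is continuous on the unit circle, and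
  polynomials approximating it there pull back along \<open>cis\<close> to trigonometric
  polynomials.\<close>

lemma C_circle_approx:
  assumes \<phi>: "\<phi> \<in> C_circle" and e: "e > 0"
  shows "\<exists>q\<in>smooth_circle. \<forall>x. \<bar>\<phi> x - q x\<bar> \<le> e"
proof -
  have per: "\<phi> (x + 2*pi) = \<phi> x" for x
    using \<phi> by (simp add: C_circle_def periodic_2pi_def)
  have cont: "isCont \<phi> x" for x
    using \<phi> by (simp add: C_circle_def continuous_on_eq_continuous_at)
  define F where "F z = \<phi> (Arg z)" for z
  have contF: "continuous (at z) F" if z: "z \<noteq> 0" for z
  proof (cases "z \<in> \<real>\<^sub>\<le>\<^sub>0")
    case False
    then show ?thesis unfolding F_def
      by (intro continuous_at_compose[of z Arg \<phi>, unfolded o_def] continuous_at_Arg cont)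
  next
    case True
    \<comment> \<open>On its branch cut \<open>Arg\<close> jumps, but \<open>Arg (- w) + pi\<close>
      is continuous there and has the same \<open>cis\<close> value as \<open>Arg w\<close>, so
      \<open>\<phi>\<close> does not distinguish them.\<close>
    have m: "- z \<notin> \<real>\<^sub>\<le>\<^sub>0"
      using True z by (auto simp: complex_nonpos_Reals_iff complex_eq_iff)
    have "continuous (at z) (\<lambda>w. Arg (- w))"
      using continuous_at_compose[of z uminus Arg, unfolded o_def] continuous_at_Arg[OF m] by (simp add:
          continuous_intros)
    then have "continuous (at z) (\<lambda>w. Arg (- w) + pi)" by (intro continuous_intros)
    then have c: "continuous (at z) (\<lambda>w. \<phi> (Arg (- w) + pi))"
      by (intro continuous_at_compose[of z _ \<phi>, unfolded o_def] cont)
    have eq: "\<phi> (Arg (- w) + pi) = F w" if "w \<noteq> 0" for w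
      unfolding F_def
      by (rule periodic_cis_eq[of \<phi>, OF per]) (use that in \<open>simp add: cis_mult[symmetric] cis_Arg sgn_minus\<close>)
    have "eventually (\<lambda>w. w \<noteq> 0) (nhds z)" using z by (rule t1_space_nhds)
    then have "eventually (\<lambda>w. \<phi> (Arg (- w) + pi) = F w) (nhds z)" by eventually_elim (rule eq)
    from isCont_cong[OF this] show ?thesis using c by simp
  qed
  then have "continuous_on (sphere 0 1) F"
    by (intro continuous_at_imp_continuous_on ballI) (metis mem_sphere_0 norm_zero zero_neq_one)
  then obtain p where p: "real_polynomial_function p" "\<And>z. z \<in> sphere 0 1 \<Longrightarrow> \<bar>F z - p z\<bar> < e"
    using Stone_Weierstrass_real_polynomial_function[of "sphere 0 1" F e] e by auto
  have "\<phi> x = F (cis x)" for x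
    unfolding F_def by (rule periodic_cis_eq[of \<phi>, OF per]) (simp add: cis_Arg sgn_div_norm)
  then have "\<bar>\<phi> x - p (cis x)\<bar> \<le> e" for x using p(2)[of "cis x"] by simp
  then show ?thesis
    using trig_poly_smooth[OF real_polynomial_function_cis[OF p(1)]] by (intro bexI[of _ "\<lambda>x. p (cis x)"]) auto
qed

text \<open>A functional that is Lipschitz for the uniform norm on a dense class extends: its values
  along any approximating sequence are Cauchy. The estimate against every smooth \<open>q\<close> is
  kept as the conclusion because it determines the extension completely.\<close>

lemma C_dual_extension:
  assumes bd: "\<And>p q e. p \<in> smooth_circle \<Longrightarrow> q \<in> smooth_circle \<Longrightarrow> (\<And>x. \<bar>p x - q x\<bar> \<le> e) \<Longrightarrow> \<bar>L p - L q\<bar> \<le> A * e"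
  obtains T where "\<And>\<phi> q e. \<phi> \<in> C_circle \<Longrightarrow> q \<in> smooth_circle \<Longrightarrow> (\<And>x. \<bar>\<phi> x - q x\<bar> \<le> e) \<Longrightarrow> \<bar>T \<phi> - L q\<bar> \<le> A * e"
proof -
  have "\<exists>t. \<forall>q\<in>smooth_circle. \<forall>e. (\<forall>x. \<bar>\<phi> x - q x\<bar> \<le> e) \<longrightarrow> \<bar>t - L q\<bar> \<le> A * e" if \<phi>: "\<phi> \<in> C_circle" for \<phi>
  proof -
    define h where "h n = 1 / real (Suc n)" for n
    have h0: "h n > 0" for n by (simp add: h_def)
    have h_lim: "h \<longlonglongrightarrow> 0"
      using LIMSEQ_inverse_real_of_nat by (simp add: h_def[abs_def] inverse_eq_divide)
    obtain P where P: "\<And>n. P n \<in> smooth_circle" "\<And>n x. \<bar>\<phi> x - P n x\<bar> \<le> h n"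
      using C_circle_approx[OF \<phi> h0] by metis
    have near: "\<bar>L (P n) - L q\<bar> \<le> A * (h n + e)" if q: "q \<in> smooth_circle" "\<And>x. \<bar>\<phi> x - q x\<bar> \<le> e" for n q e
    proof (rule bd[OF P(1) q(1)])
      show "\<bar>P n x - q x\<bar> \<le> h n + e" for x using P(2)[of x n] q(2)[of x] by linarith
    qed
    have "Cauchy (\<lambda>n. L (P n))"
    proof (rule metric_CauchyI)
      fix e :: real assume e: "e > 0"
      have "(\<lambda>n. A * h n) \<longlonglongrightarrow> A * 0" by (intro tendsto_intros h_lim)
      then have "eventually (\<lambda>n. A * h n < e / 2) sequentially" using e by (intro order_tendstoD) auto
      then obtain N where N: "\<And>n. n \<ge> N \<Longrightarrow> A * h n < e / 2" unfolding eventually_sequentially by blast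
      have "dist (L (P m)) (L (P n)) < e" if "m \<ge> N" "n \<ge> N" for m n
        using near[OF P(1) P(2), of m n] N[OF that(1)] N[OF that(2)] by (simp add: dist_real_def distrib_left)
      then show "\<exists>N. \<forall>m\<ge>N. \<forall>n\<ge>N. dist (L (P m)) (L (P n)) < e" by blast
    qed
    then obtain t where t: "(\<lambda>n. L (P n)) \<longlonglongrightarrow> t" using Cauchy_convergent convergentD by blast
    have "\<bar>t - L q\<bar> \<le> A * e" if q: "q \<in> smooth_circle" "\<forall>x. \<bar>\<phi> x - q x\<bar> \<le> e" for q e
    proof (rule LIMSEQ_le)
      show "(\<lambda>n. \<bar>L (P n) - L q\<bar>) \<longlonglongrightarrow> \<bar>t - L q\<bar>" by (intro tendsto_intros t)
      have "(\<lambda>n. A * (h n + e)) \<longlonglongrightarrow> A * (0 + e)" by (intro tendsto_intros h_lim)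
      then show "(\<lambda>n. A * (h n + e)) \<longlonglongrightarrow> A * e" by simp
    qed (use near q in blast)
    then show ?thesis by blast
  qed
  then show thesis using that by metis
qed

section \<open>Second derivatives as functionals on continuous functions\<close>

lemma C_circle_add: "\<phi> \<in> C_circle \<Longrightarrow> \<psi> \<in> C_circle \<Longrightarrow> (\<lambda>x. \<phi> x + \<psi> x) \<in> C_circle"
  by (auto simp: C_circle_def periodic_2pi_def intro: continuous_intros)

lemma C_circle_cmult: "\<phi> \<in> C_circle \<Longrightarrow> (\<lambda>x. c * \<phi> x) \<in> C_circle"
  by (auto simp: C_circle_def periodic_2pi_def intro: continuous_intros)

lemma smooth_circle_subset: "smooth_circle \<subseteq> C_circle"
  using smooth_circle_deriv(2)[of _ UNIV 0] by (auto simp: C_circle_def smooth_circle_def)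

text \<open>Periodicity reduces boundedness to the compact interval of arguments, so the supremum is
  a genuine uniform norm.\<close>

lemma C_circle_SUP:
  assumes "\<phi> \<in> C_circle"
  shows "\<bar>\<phi> x\<bar> \<le> (SUP \<theta>. \<bar>\<phi> \<theta>\<bar>)"
proof -
  have per: "\<phi> (x + 2*pi) = \<phi> x" for x
    using assms by (simp add: C_circle_def periodic_2pi_def)
  have cont: "continuous_on S \<phi>" for S
    using assms by (auto simp: C_circle_def intro: continuous_on_subset)
  have "compact (\<phi> ` {-pi..pi})" by (intro compact_continuous_image cont) auto
  then obtain B where B: "\<And>x. x \<in> {-pi..pi} \<Longrightarrow> \<bar>\<phi> x\<bar> \<le> B"
    using compact_imp_bounded bounded_iff by (metis image_eqI real_norm_def)
  have "\<bar>\<phi> x\<bar> \<le> B" for x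
  proof -
    have "\<phi> x = \<phi> (Arg (cis x))" by (rule periodic_cis_eq[of \<phi>, OF per]) (simp add: cis_Arg sgn_div_norm)
    moreover have "Arg (cis x) \<in> {-pi..pi}" using Arg_bounded[of "cis x"] by auto
    ultimately show ?thesis using B by metis
  qed
  then have "bdd_above (range (\<lambda>\<theta>. \<bar>\<phi> \<theta>\<bar>))" by (intro bdd_aboveI2[of _ _ B])
  then show ?thesis by (intro cSUP_upper) auto
qed

text \<open>\<open>T\<close> is described only through its distance from the distributional pairing.
  Linearity, boundedness and agreement on smooth functions all follow from this one quantified
  estimate.\<close>

definition approx_second_deriv :: "real \<Rightarrow> (real \<Rightarrow> real) \<Rightarrow> ((real \<Rightarrow> real) \<Rightarrow> real) \<Rightarrow> bool" where
  "approx_second_deriv A u T \<longleftrightarrow> (\<forall>\<phi>\<in>C_circle. \<forall>q\<in>smooth_circle. \<forall>e. (\<forall>x. \<bar>\<phi> x - q x\<bar> \<le> e) \<longrightarrow>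
     \<bar>T \<phi> - (\<integral>x. u x * (deriv ^^ 2) q x \<partial>circ)\<bar> \<le> A * e)"

lemma (in semiconvex) approx_second_deriv_exists: "\<exists>T. approx_second_deriv (4*pi*C) u T"
proof -
  obtain T where "\<And>\<phi> q e. \<phi> \<in> C_circle \<Longrightarrow> q \<in> smooth_circle \<Longrightarrow> (\<And>x. \<bar>\<phi> x - q x\<bar> \<le> e) \<Longrightarrow>
      \<bar>T \<phi> - (\<integral>x. u x * (deriv ^^ 2) q x \<partial>circ)\<bar> \<le> 4*pi*C * e"
    using C_dual_extension[of "\<lambda>q. \<integral>x. u x * (deriv ^^ 2) q x \<partial>circ" "4*pi*C", OF second_deriv_bound] by blast
  then show ?thesis unfolding approx_second_deriv_def by blast
qed

lemma le_of_le_mult_eps: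
  fixes a A :: real
  assumes "\<And>e. e > 0 \<Longrightarrow> a \<le> A * e"
  shows "a \<le> 0"
proof (rule LIMSEQ_le_const)
  have "(\<lambda>n. A * inverse (real (Suc n))) \<longlonglongrightarrow> A * 0" by (intro tendsto_intros LIMSEQ_inverse_real_of_nat)
  then show "(\<lambda>n. A * inverse (real (Suc n))) \<longlonglongrightarrow> 0" by simp
  show "\<exists>N. \<forall>n\<ge>N. a \<le> A * inverse (real (Suc n))" using assms by simp
qed

lemma has_second_deriv_C_dual_approx:
  assumes T: "approx_second_deriv A u T" and u: "continuous_on UNIV u"
  shows "has_second_deriv_C_dual u T"
proof -
  define L where "L q = (\<integral>x. u x * (deriv ^^ 2) q x \<partial>circ)" for q
  have T: "\<bar>T \<phi> - L q\<bar> \<le> A * e" if "\<phi> \<in> C_circle" "q \<in> smooth_circle" "\<And>x. \<bar>\<phi> x - q x\<bar> \<le> e" for \<phi> q e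
    using T that unfolding approx_second_deriv_def L_def by blast
  have L: "L (\<lambda>x. a * p x + b * q x) = a * L p + b * L q" if pq: "p \<in> smooth_circle" "q \<in> smooth_circle"
      for p q a b
  proof -
    have "integrable circ (\<lambda>x. u x * (deriv ^^ 2) p x)" "integrable circ (\<lambda>x. u x * (deriv ^^ 2) q x)"
      using smooth_circle_deriv(2)[OF pq(1), of UNIV 2] smooth_circle_deriv(2)[OF pq(2), of UNIV 2]
      by (auto intro!: integrable_circ_continuous continuous_intros u)
    then have "(\<integral>x. a * (u x * (deriv ^^ 2) p x) + b * (u x * (deriv ^^ 2) q x) \<partial>circ) = a * L p + b * L q"
      unfolding L_def by simp
    moreover have "a * (u x * (deriv ^^ 2) p x) + b * (u x * (deriv ^^ 2) q x) =
        u x * (a * (deriv ^^ 2) p x + b * (deriv ^^ 2) q x)" for x by (simp add: algebra_simps)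
    ultimately show ?thesis unfolding L_def smooth_circle_add_cmult(1)[OF pq] by simp
  qed
  have lin: "T (\<lambda>x. a * \<phi> x + b * \<psi> x) = a * T \<phi> + b * T \<psi>" if \<phi>\<psi>: "\<phi> \<in> C_circle" "\<psi> \<in> C_circle" for \<phi> \<psi> a b
  proof -
    have "\<bar>T (\<lambda>x. a * \<phi> x + b * \<psi> x) - (a * T \<phi> + b * T \<psi>)\<bar> \<le> (2 * A * (\<bar>a\<bar> + \<bar>b\<bar>)) * e" if e: "e > 0" for e
    proof -
      obtain p where p: "p \<in> smooth_circle" "\<And>x. \<bar>\<phi> x - p x\<bar> \<le> e" using C_circle_approx[OF \<phi>\<psi>(1) e] by blast
      obtain q where q: "q \<in> smooth_circle" "\<And>x. \<bar>\<psi> x - q x\<bar> \<le> e" using C_circle_approx[OF \<phi>\<psi>(2) e] by blast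
      have ab: "\<bar>a * s\<bar> \<le> \<bar>a\<bar> * r" "\<bar>b * s\<bar> \<le> \<bar>b\<bar> * r" if "\<bar>s\<bar> \<le> r" for s r
        using that by (auto simp: abs_mult mult_left_mono)
      have "\<bar>T (\<lambda>x. a * \<phi> x + b * \<psi> x) - L (\<lambda>x. a * p x + b * q x)\<bar> \<le> A * ((\<bar>a\<bar> + \<bar>b\<bar>) * e)"
      proof (rule T)
        show "(\<lambda>x. a * \<phi> x + b * \<psi> x) \<in> C_circle" by (intro C_circle_add C_circle_cmult \<phi>\<psi>)
        show "(\<lambda>x. a * p x + b * q x) \<in> smooth_circle" by (rule smooth_circle_add_cmult[OF p(1) q(1)])
        show "\<bar>(a * \<phi> x + b * \<psi> x) - (a * p x + b * q x)\<bar> \<le> (\<bar>a\<bar> + \<bar>b\<bar>) * e" for x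
        proof -
          have "(a * \<phi> x + b * \<psi> x) - (a * p x + b * q x) = a * (\<phi> x - p x) + b * (\<psi> x - q x)" by (simp
              add: algebra_simps)
          then show ?thesis using ab(1)[OF p(2)[of x]] ab(2)[OF q(2)[of x]]
              abs_triangle_ineq[of "a * (\<phi> x - p x)" "b * (\<psi> x - q x)"] by (simp only: distrib_right)
        qed
      qed
      moreover have "\<bar>a * (T \<phi> - L p)\<bar> \<le> \<bar>a\<bar> * (A * e)" by (rule ab(1)[OF T[OF \<phi>\<psi>(1) p]])
      moreover have "\<bar>b * (T \<psi> - L q)\<bar> \<le> \<bar>b\<bar> * (A * e)" by (rule ab(2)[OF T[OF \<phi>\<psi>(2) q]])
      moreover have "(2 * A * (\<bar>a\<bar> + \<bar>b\<bar>)) * e = A * ((\<bar>a\<bar> + \<bar>b\<bar>) * e) + \<bar>a\<bar> * (A * e) + \<bar>b\<bar> * (A * e)"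
        by (simp add: algebra_simps)
      ultimately show ?thesis
        unfolding L[OF p(1) q(1)] right_diff_distrib by linarith
    qed
    from le_of_le_mult_eps[OF this] show ?thesis by simp
  qed
  have "\<bar>T \<phi>\<bar> \<le> A * (SUP \<theta>. \<bar>\<phi> \<theta>\<bar>)" if "\<phi> \<in> C_circle" for \<phi>
  proof -
    \<comment> \<open>Boundedness is the estimate with \<open>q = 0\<close> and \<open>e\<close> the
      uniform norm of \<open>\<phi>\<close>.\<close>
    have z: "(\<lambda>x. 0) \<in> smooth_circle" by (intro trig_poly_smooth trig_poly.const)
    have "L (\<lambda>x. 0) = 0" using L[OF z z, of 0 0] by simp
    then show ?thesis using T[OF that z, of "SUP \<theta>. \<bar>\<phi> \<theta>\<bar>"] C_circle_SUP[OF that] by simp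
  qed
  then have "C_dual T"
    unfolding C_dual_def using lin[of _ _ 1 1] lin[of _ _ _ 0] by (intro conjI ballI allI exI[of _ A]) auto
  \<comment> \<open>On smooth functions the estimate may be used with error
    \<open>e = 0\<close>.\<close>
  moreover have "T q = L q" if "q \<in> smooth_circle" for q
    using T[of q q 0] smooth_circle_subset that by auto
  ultimately show ?thesis
    unfolding has_second_deriv_C_dual_def L_def[symmetric] using integrable_circ_continuous[OF u] by blast
qed

text \<open>All functionals share the Lipschitz constant \<open>4 * pi * C\<close>, so a continuous
  test function may be replaced by one smooth function uniformly in \<open>j\<close>. For that fixed
  function the pairing converges because \<open>w j\<close> does.\<close>

lemma weakstar_second_deriv_limit:
  assumes sc: "\<And>j. semiconvex C (w j) (dw j)" and u: "semiconvex C u d"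
    and lim: "\<And>x. (\<lambda>j. w j x) \<longlonglongrightarrow> u x" and bd: "\<And>j x. \<bar>w j x\<bar> \<le> B"
  shows "weakstar_second_deriv w u"
proof -
  define L where "L v q = (\<integral>x. v x * (deriv ^^ 2) q x \<partial>circ)" for v q
  obtain S where S: "\<And>j. approx_second_deriv (4*pi*C) (w j) (S j)"
    using semiconvex.approx_second_deriv_exists[OF sc] by metis
  obtain T where T: "approx_second_deriv (4*pi*C) u T"
    using semiconvex.approx_second_deriv_exists[OF u] by metis
  have "(\<lambda>j. S j \<phi>) \<longlonglongrightarrow> T \<phi>" if \<phi>: "\<phi> \<in> C_circle" for \<phi>
  proof (rule LIMSEQ_I)
    fix r :: real assume r: "r > 0"
    \<comment> \<open>Makes both replacement errors at most \<open>r / 4\<close>, leaving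
      \<open>r / 2\<close> for the convergence in \<open>j\<close>; the summand 1 avoids division by
      zero when \<open>C = 0\<close>.\<close>
    define e where "e = r / (4 * (4*pi*C + 1))"
    have "4*pi*C \<ge> 0" using semiconvex.C_nonneg[OF u] by simp
    then have e: "e > 0" "4*pi*C * e \<le> r / 4" using r by (auto simp: e_def field_simps)
    obtain q where q: "q \<in> smooth_circle" "\<forall>x. \<bar>\<phi> x - q x\<bar> \<le> e" using C_circle_approx[OF \<phi> e(1)] by blast
    have Sq: "\<bar>S j \<phi> - L (w j) q\<bar> \<le> r / 4" for j
      using S[of j] q \<phi> e(2) unfolding approx_second_deriv_def L_def by (meson order_trans)
    have Tq: "\<bar>T \<phi> - L u q\<bar> \<le> r / 4"
      using T q \<phi> e(2) unfolding approx_second_deriv_def L_def by (meson order_trans)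
    have "(\<lambda>j. L (w j) q) \<longlonglongrightarrow> L u q"
      unfolding L_def
      by (rule integral_circ_tendsto[OF _ _ bd])
         (use semiconvex_measurable[OF sc u lim bd] sc u lim smooth_circle_deriv(2)[OF q(1), of UNIV 2] in
           \<open>auto intro!: integrable_circ_continuous\<close>)
    then have "(\<lambda>j. \<bar>L (w j) q - L u q\<bar>) \<longlonglongrightarrow> 0"
      by (intro tendsto_rabs_zero LIM_zero)
    then have "eventually (\<lambda>j. \<bar>L (w j) q - L u q\<bar> < r / 2) sequentially"
      using r by (intro order_tendstoD) auto
    then have "eventually (\<lambda>j. norm (S j \<phi> - T \<phi>) < r) sequentially"
    proof eventually_elim
      case (elim j)
      then show ?case using Sq[of j] Tq unfolding real_norm_def by linarith
    qed
    then show "\<exists>N. \<forall>n\<ge>N. norm (S n \<phi> - T \<phi>) < r" by (simp add: eventually_sequentially)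
  qed
  moreover have "has_second_deriv_C_dual (w j) (S j)" for j
    by (rule has_second_deriv_C_dual_approx[OF S semiconvex.continuous_u[OF sc]])
  moreover have "has_second_deriv_C_dual u T"
    by (rule has_second_deriv_C_dual_approx[OF T semiconvex.continuous_u[OF u]])
  ultimately show ?thesis unfolding weakstar_second_deriv_def by blast
qed

subsection \<open>Projection onto the even modes\<close>

text \<open>The case \<open>p = 2\<close> with squares in place of real powers, suited to Hilbert
  space algebra.\<close>

definition sq_int :: "(real \<Rightarrow> real) \<Rightarrow> bool" where
  "sq_int g \<longleftrightarrow> g \<in> borel_measurable circ \<and> integrable circ (\<lambda>x. (g x)\<^sup>2)"

lemma in_Lp_2_iff: "in_Lp 2 g \<longleftrightarrow> sq_int g"
  by (simp add: in_Lp_def sq_int_def)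

lemma Lp_norm_2_sq: "(Lp_norm 2 g)\<^sup>2 = (\<integral>x. (g x)\<^sup>2 \<partial>circ)"
  by (simp add: Lp_norm_def powr_half_sqrt)

lemma sq_int_mult:
  assumes "sq_int g" "sq_int h"
  shows "integrable circ (\<lambda>x. g x * h x)"
proof (rule Bochner_Integration.integrable_bound)
  show "integrable circ (\<lambda>x. (g x)\<^sup>2 + (h x)\<^sup>2)" using assms by (simp add: sq_int_def)
  show "(\<lambda>x. g x * h x) \<in> borel_measurable circ" using assms by (auto simp: sq_int_def)
  have "\<bar>a * b\<bar> \<le> a\<^sup>2 + b\<^sup>2" for a b :: real
  proof -
    have "(\<bar>a\<bar> - \<bar>b\<bar>)\<^sup>2 \<ge> 0" by simp
    then have "2 * (\<bar>a\<bar> * \<bar>b\<bar>) \<le> a\<^sup>2 + b\<^sup>2" by (simp add: power2_eq_square algebra_simps)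
    moreover have "\<bar>a\<bar> * \<bar>b\<bar> \<ge> 0" by simp
    ultimately show ?thesis unfolding abs_mult by linarith
  qed
  then show "AE x in circ. norm (g x * h x) \<le> norm ((g x)\<^sup>2 + (h x)\<^sup>2)" by simp
qed

lemma sq_int_lincomb:
  assumes "sq_int g" "sq_int h"
  shows "sq_int (\<lambda>x. a * g x + b * h x)"
  unfolding sq_int_def
proof
  show "(\<lambda>x. a * g x + b * h x) \<in> borel_measurable circ" using assms by (auto simp: sq_int_def)
  have "integrable circ (\<lambda>x. a\<^sup>2 * (g x)\<^sup>2 + b\<^sup>2 * (h x)\<^sup>2 + 2 * a * b * (g x * h x))"
    using assms sq_int_mult[OF assms] by (simp add: sq_int_def)
  then show "integrable circ (\<lambda>x. (a * g x + b * h x)\<^sup>2)"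
    by (simp add: power2_eq_square algebra_simps)
qed

lemma sq_int_add: "sq_int g \<Longrightarrow> sq_int h \<Longrightarrow> sq_int (\<lambda>x. g x + h x)"
  and sq_int_diff: "sq_int g \<Longrightarrow> sq_int h \<Longrightarrow> sq_int (\<lambda>x. g x - h x)"
  using sq_int_lincomb[of g h 1 1] sq_int_lincomb[of g h 1 "-1"] by simp_all

lemma sq_int_continuous: "continuous_on UNIV g \<Longrightarrow> sq_int g"
  unfolding sq_int_def
  by (intro conjI borel_measurable_circ borel_measurable_continuous_onI integrable_circ_continuous
      continuous_intros)

text \<open>The square norm of \<open>s * g + t * h\<close> is a non-negative quadratic form in
  \<open>s\<close> and \<open>t\<close>; evaluating it at \<open>s = c\<close>,
  \<open>t = - b\<close> gives the inequality when \<open>c > 0\<close>.\<close>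

lemma Cauchy_Schwarz_circ:
  assumes g: "sq_int g" and h: "sq_int h"
  shows "\<bar>\<integral>x. g x * h x \<partial>circ\<bar> \<le> sqrt (\<integral>x. (g x)\<^sup>2 \<partial>circ) * sqrt (\<integral>x. (h x)\<^sup>2 \<partial>circ)"
proof -
  define a b c where "a = (\<integral>x. (g x)\<^sup>2 \<partial>circ)" and "b = (\<integral>x. g x * h x \<partial>circ)" and "c = (\<integral>x. (h x)\<^sup>2 \<partial>circ)"
  have ints: "integrable circ (\<lambda>x. (g x)\<^sup>2)" "integrable circ (\<lambda>x. (h x)\<^sup>2)" "integrable circ (\<lambda>x. g x * h x)"
    using g h sq_int_mult[OF g h] by (auto simp: sq_int_def)
  have quad: "s\<^sup>2 * a + t\<^sup>2 * c + 2 * s * t * b \<ge> 0" for s t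
  proof -
    have "(\<integral>x. (s * g x + t * h x)\<^sup>2 \<partial>circ) \<ge> 0" by simp
    moreover have "(\<integral>x. (s * g x + t * h x)\<^sup>2 \<partial>circ) =
        (\<integral>x. s\<^sup>2 * (g x)\<^sup>2 + t\<^sup>2 * (h x)\<^sup>2 + 2 * s * t * (g x * h x) \<partial>circ)"
      by (rule arg_cong[where f = "integral\<^sup>L circ"]) (auto simp: power2_eq_square algebra_simps)
    moreover have "\<dots> = s\<^sup>2 * a + t\<^sup>2 * c + 2 * s * t * b"
      using ints by (simp add: a_def b_def c_def)
    ultimately show ?thesis by simp
  qed
  have "a \<ge> 0" "c \<ge> 0" unfolding a_def c_def by simp_all
  have "b\<^sup>2 \<le> a * c"
  proof (cases "c = 0")
    case True
    show ?thesis
    proof (cases "b = 0")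
      case False
      \<comment> \<open>With \<open>c = 0\<close> the form is affine in \<open>t\<close>, and this
        choice of \<open>t\<close> gives it the value -1, a contradiction unless
        \<open>b = 0\<close>.\<close>
      have "1\<^sup>2 * a + (- (a + 1) / (2 * b))\<^sup>2 * c + 2 * 1 * (- (a + 1) / (2 * b)) * b \<ge> 0" by (rule quad)
      then show ?thesis using True False by (simp add: field_simps)
    qed (simp add: True)
  next
    case False
    then have "c > 0" using \<open>c \<ge> 0\<close> by simp
    have "c\<^sup>2 * a + (- b)\<^sup>2 * c + 2 * c * (- b) * b \<ge> 0" by (rule quad)
    then have "c * (a * c - b\<^sup>2) \<ge> 0" by (simp add: power2_eq_square algebra_simps)
    then show ?thesis using \<open>c > 0\<close> by (simp add: zero_le_mult_iff)
  qed
  then have "sqrt (b\<^sup>2) \<le> sqrt (a * c)" by (rule real_sqrt_le_mono)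
  then show ?thesis by (simp add: real_sqrt_mult a_def b_def c_def)
qed

section \<open>Orthogonality of the cosines\<close>

lemma integral_cos_int:
  assumes "k \<noteq> (0 :: int)"
  shows "(\<integral>x. cos (2 * real_of_int k * x) \<partial>circ) = 0"
proof -
  have "((\<lambda>x. cos (2 * real_of_int k * x)) has_integral
      (sin (2 * real_of_int k * (2*pi)) / (2 * real_of_int k) - sin (2 * real_of_int k * 0) / (2 *
          real_of_int k))) {0..2*pi}"
    by (rule fundamental_theorem_of_calculus)
       (use assms in \<open>auto intro!: derivative_eq_intros simp:
           has_real_derivative_iff_has_vector_derivative[symmetric]\<close>)
  moreover have "sin (2 * real_of_int k * (2*pi)) = 0"
    using sin_integer_2pi[of "2 * real_of_int k"] by (simp add: mult.assoc mult.commute)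
  ultimately show ?thesis
    by (subst integral_circ_eq) (auto intro!: integrable_circ_continuous continuous_intros simp:
        integral_unique)
qed

definition mode_norm :: "nat \<Rightarrow> real" where
  "mode_norm m = (if m = 0 then 2 * pi else pi)"

lemma mode_norm_neq_0: "mode_norm m \<noteq> 0"
  by (simp add: mode_norm_def)

lemma integral_cos_cos:
  "(\<integral>x. cos (2 * real m * x) * cos (2 * real n * x) \<partial>circ) = (if m = n then mode_norm m else 0)"
proof -
  have i: "integrable circ (\<lambda>x. cos (2 * real_of_int k * x))" for k
    by (intro integrable_circ_continuous continuous_intros)
  have J: "(\<integral>x. cos (2 * real_of_int k * x) \<partial>circ) = (if k = 0 then 2 * pi else 0)" for k
    using integral_cos_int[of k] by (simp add: measure_circ)
  \<comment> \<open>Frequencies are taken as integers because \<open>m - n\<close> may be negative.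
    Either of the two may vanish, and both do exactly for \<open>m = n = 0\<close>, which doubles
    the norm of the constant mode.\<close>
  have "(\<integral>x. cos (2 * real m * x) * cos (2 * real n * x) \<partial>circ) =
      (\<integral>x. (cos (2 * real_of_int (int m - int n) * x) + cos (2 * real_of_int (int m + int n) * x)) / 2 \<partial>circ)"
    by (simp add: cos_times_cos algebra_simps)
  also have "\<dots> = ((if int m - int n = 0 then 2 * pi else 0) + (if int m + int n = 0 then 2 * pi else 0)) / 2"
    using i by (simp only: J integral_divide_zero Bochner_Integration.integral_add)
  also have "\<dots> = (if m = n then mode_norm m else 0)"
    by (auto simp: mode_norm_def)
  finally show ?thesis .
qed

lemma continuous_even_modes: "q \<in> even_modes M \<Longrightarrow> continuous_on S q"
  by (auto simp: even_modes_def intro!: continuous_intros)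

lemma sq_int_even_modes: "q \<in> even_modes M \<Longrightarrow> sq_int q"
  by (rule sq_int_continuous[OF continuous_even_modes])

lemma even_modes_lincomb:
  assumes "p \<in> even_modes M" "q \<in> even_modes M"
  shows "(\<lambda>x. a * p x + b * q x) \<in> even_modes M"
proof -
  obtain c d where "p = (\<lambda>\<theta>. \<Sum>m\<le>M. c m * cos (2 * real m * \<theta>))" "q = (\<lambda>\<theta>. \<Sum>m\<le>M. d m * cos (2 * real m * \<theta>))"
    using assms by (auto simp: even_modes_def)
  then have "(\<lambda>x. a * p x + b * q x) = (\<lambda>\<theta>. \<Sum>m\<le>M. (a * c m + b * d m) * cos (2 * real m * \<theta>))"
    by (auto simp: sum_distrib_left sum.distrib[symmetric] algebra_simps)
  then show ?thesis unfolding even_modes_def by (intro CollectI exI[of _ "\<lambda>m. a * c m + b * d m"]) simp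
qed

lemma even_modes_mono:
  assumes "M \<le> N"
  shows "even_modes M \<subseteq> even_modes N"
proof
  fix q assume "q \<in> even_modes M"
  then obtain c where "q = (\<lambda>\<theta>. \<Sum>m\<le>M. c m * cos (2 * real m * \<theta>))" by (auto simp: even_modes_def)
  moreover have "(\<Sum>m\<le>M. c m * cos (2 * real m * \<theta>)) = (\<Sum>m\<le>N. (if m \<le> M then c m else 0) * cos (2 * real
      m * \<theta>))" for \<theta>
    using assms by (intro sum.mono_neutral_cong_left) auto
  ultimately show "q \<in> even_modes N"
    unfolding even_modes_def by (intro CollectI exI[of _ "\<lambda>m. if m \<le> M then c m else 0"]) simp
qed

lemma cos_even_modes: "(\<lambda>\<theta>. cos (2 * real m * \<theta>)) \<in> even_modes m"
proof -
  have "cos (2 * real m * \<theta>) = (\<Sum>n\<le>m. (if n = m then 1 else 0) * cos (2 * real n * \<theta>))" for \<theta>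
    by (subst sum.remove[of _ m]) auto
  then show ?thesis unfolding even_modes_def by (intro CollectI exI[of _ "\<lambda>n. if n = m then 1 else 0"]) auto
qed

lemma const_even_modes: "(\<lambda>\<theta>. c) \<in> even_modes M"
  using even_modes_lincomb[OF cos_even_modes[of 0] cos_even_modes[of 0], of c 0] even_modes_mono[of 0 M] by auto

lemma integral_even_mode_cos:
  assumes "n \<le> M"
  shows "(\<integral>x. (\<Sum>m\<le>M. c m * cos (2 * real m * x)) * cos (2 * real n * x) \<partial>circ) = c n * mode_norm n"
proof -
  have "(\<integral>x. (\<Sum>m\<le>M. c m * cos (2 * real m * x)) * cos (2 * real n * x) \<partial>circ) =
      (\<integral>x. (\<Sum>m\<le>M. c m * (cos (2 * real m * x) * cos (2 * real n * x))) \<partial>circ)"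
    by (simp add: sum_distrib_right mult.assoc)
  also have "\<dots> = (\<Sum>m\<le>M. \<integral>x. c m * (cos (2 * real m * x) * cos (2 * real n * x)) \<partial>circ)"
    by (intro Bochner_Integration.integral_sum integrable_circ_continuous continuous_intros)
  also have "\<dots> = (\<Sum>m\<le>M. if m = n then c n * mode_norm n else 0)"
    by (intro sum.cong) (auto simp: integral_cos_cos)
  also have "\<dots> = c n * mode_norm n" using assms by simp
  finally show ?thesis .
qed

text \<open>Existence comes from the Fourier coefficients, uniqueness from testing against each
  cosine. This is what makes the description in \<open>even_proj\<close> meaningful.\<close>

lemma even_proj_ex1:
  assumes g: "sq_int g"
  shows "\<exists>!p. p \<in> even_modes M \<and> (\<forall>q\<in>even_modes M. (\<integral>\<theta>. (g \<theta> - p \<theta>) * q \<theta> \<partial>circ) = 0)"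
proof -
  define c where "c m = (\<integral>x. g x * cos (2 * real m * x) \<partial>circ) / mode_norm m" for m
  have gcos: "integrable circ (\<lambda>x. g x * cos (2 * real m * x))" for m
    by (intro sq_int_mult g sq_int_even_modes[OF cos_even_modes])
  have key: "(\<integral>x. (g x - (\<Sum>m\<le>M. b m * cos (2 * real m * x))) * cos (2 * real n * x) \<partial>circ) = (c n - b n)
      * mode_norm n"
    if "n \<le> M" for b n
  proof -
    have "integrable circ (\<lambda>x. (\<Sum>m\<le>M. b m * cos (2 * real m * x)) * cos (2 * real n * x))"
      by (intro integrable_circ_continuous continuous_intros)
    then show ?thesis
      using gcos[of n] integral_even_mode_cos[OF that, of b] mode_norm_neq_0[of n]
      by (simp add: left_diff_distrib c_def)
  qed
  define p where "p = (\<lambda>\<theta>. \<Sum>m\<le>M. c m * cos (2 * real m * \<theta>))"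
  have p: "p \<in> even_modes M" unfolding p_def even_modes_def by blast
  have orth: "(\<integral>\<theta>. (g \<theta> - p \<theta>) * q \<theta> \<partial>circ) = 0" if qM: "q \<in> even_modes M" for q
  proof -
    obtain e where q: "q = (\<lambda>\<theta>. \<Sum>m\<le>M. e m * cos (2 * real m * \<theta>))" using qM by (auto simp: even_modes_def)
    have "(\<integral>\<theta>. (g \<theta> - p \<theta>) * q \<theta> \<partial>circ) = (\<integral>\<theta>. (\<Sum>m\<le>M. e m * ((g \<theta> - p \<theta>) * cos (2 * real m * \<theta>))) \<partial>circ)"
      by (simp add: q sum_distrib_left algebra_simps)
    also have "\<dots> = (\<Sum>m\<le>M. \<integral>\<theta>. e m * ((g \<theta> - p \<theta>) * cos (2 * real m * \<theta>)) \<partial>circ)"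
      by (intro Bochner_Integration.integral_sum integrable_mult_right sq_int_mult sq_int_diff g
          sq_int_even_modes[OF p] sq_int_even_modes[OF cos_even_modes])
    also have "\<dots> = 0" by (intro sum.neutral ballI) (simp add: p_def key)
    finally show ?thesis .
  qed
  show ?thesis
  proof (rule ex1I[of _ p])
    show "p \<in> even_modes M \<and> (\<forall>q\<in>even_modes M. (\<integral>\<theta>. (g \<theta> - p \<theta>) * q \<theta> \<partial>circ) = 0)"
      using p orth by blast
    fix p' assume p': "p' \<in> even_modes M \<and> (\<forall>q\<in>even_modes M. (\<integral>\<theta>. (g \<theta> - p' \<theta>) * q \<theta> \<partial>circ) = 0)"
    then obtain b where b: "p' = (\<lambda>\<theta>. \<Sum>m\<le>M. b m * cos (2 * real m * \<theta>))" by (auto simp: even_modes_def)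
    have "b n = c n" if n: "n \<le> M" for n
    proof -
      have "(\<lambda>\<theta>. cos (2 * real n * \<theta>)) \<in> even_modes M"
        using cos_even_modes even_modes_mono[OF n] by blast
      then have "(\<integral>x. (g x - p' x) * cos (2 * real n * x) \<partial>circ) = 0"
        using bspec[OF conjunct2[OF p']] by simp
      then show ?thesis using key[OF n, of b] mode_norm_neq_0[of n] by (simp add: b)
    qed
    then show "p' = p" unfolding b p_def by auto
  qed
qed

lemma
  assumes g: "sq_int g"
  shows even_proj_in: "even_proj M g \<in> even_modes M"
    and even_proj_orth: "q \<in> even_modes M \<Longrightarrow> (\<integral>\<theta>. (g \<theta> - even_proj M g \<theta>) * q \<theta> \<partial>circ) = 0"
  using theI'[OF even_proj_ex1[OF g, of M], folded even_proj_def] by auto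

lemma even_proj_pythagoras:
  assumes g: "sq_int g"
  shows "(\<integral>x. (g x - even_proj M g x)\<^sup>2 \<partial>circ) = (\<integral>x. (g x)\<^sup>2 \<partial>circ) - (\<integral>x. (even_proj M g x)\<^sup>2 \<partial>circ)"
proof -
  define p where "p = even_proj M g"
  have p: "p \<in> even_modes M" and sp: "sq_int p"
    unfolding p_def using even_proj_in[OF g] sq_int_even_modes by auto
  have "(\<integral>x. (g x)\<^sup>2 \<partial>circ) = (\<integral>x. (g x - p x)\<^sup>2 + 2 * ((g x - p x) * p x) + (p x)\<^sup>2 \<partial>circ)"
    by (simp add: power2_eq_square algebra_simps)
  also have "\<dots> = (\<integral>x. (g x - p x)\<^sup>2 \<partial>circ) + 2 * (\<integral>x. (g x - p x) * p x \<partial>circ) + (\<integral>x. (p x)\<^sup>2 \<partial>circ)"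
    using sq_int_diff[OF g sp] sp sq_int_mult[OF sq_int_diff[OF g sp] sp] by (simp add: sq_int_def)
  also have "(\<integral>x. (g x - p x) * p x \<partial>circ) = 0"
    unfolding p_def by (rule even_proj_orth[OF g even_proj_in[OF g]])
  finally show ?thesis by (simp add: p_def)
qed

lemma even_proj_norm_le:
  assumes g: "sq_int g"
  shows "(\<integral>x. (even_proj M g x)\<^sup>2 \<partial>circ) \<le> (\<integral>x. (g x)\<^sup>2 \<partial>circ)"
    "(\<integral>x. (g x - even_proj M g x)\<^sup>2 \<partial>circ) \<le> (\<integral>x. (g x)\<^sup>2 \<partial>circ)"
proof -
  have "(\<integral>x. (g x - even_proj M g x)\<^sup>2 \<partial>circ) \<ge> 0" "(\<integral>x. (even_proj M g x)\<^sup>2 \<partial>circ) \<ge> 0" by simp_all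
  then show "(\<integral>x. (even_proj M g x)\<^sup>2 \<partial>circ) \<le> (\<integral>x. (g x)\<^sup>2 \<partial>circ)"
    "(\<integral>x. (g x - even_proj M g x)\<^sup>2 \<partial>circ) \<le> (\<integral>x. (g x)\<^sup>2 \<partial>circ)"
    using even_proj_pythagoras[OF g, of M] by linarith+
qed

text \<open>With \<open>P\<close> the projection, \<open>\<parallel>g\<parallel>\<^sup>2 - \<parallel>h\<parallel>\<^sup>2 - \<parallel>P g\<parallel>\<^sup>2 + \<parallel>P h\<parallel>\<^sup>2 = \<langle>g - h, (1 - P) (g + h)\<rangle>\<close>, and \<open>q\<close>
  may be subtracted from \<open>g - h\<close> because it lies in the range of \<open>P\<close>.\<close>

lemma even_proj_comparison:
  assumes g: "sq_int g" and h: "sq_int h" and q: "q \<in> even_modes M"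
    and le: "(\<integral>x. (even_proj M g x)\<^sup>2 \<partial>circ) \<le> (\<integral>x. (even_proj M h x)\<^sup>2 \<partial>circ)"
  shows "(\<integral>x. (g x)\<^sup>2 \<partial>circ) - (\<integral>x. (h x)\<^sup>2 \<partial>circ) \<le>
    sqrt (\<integral>x. (g x - h x - q x)\<^sup>2 \<partial>circ) * sqrt (2 * (\<integral>x. (g x)\<^sup>2 \<partial>circ) + 2 * (\<integral>x. (h x)\<^sup>2 \<partial>circ))"
proof -
  define a b where "a = even_proj M g" and "b = even_proj M h"
  define r s where "r x = g x - a x" and "s x = h x - b x" for x
  have ab: "a \<in> even_modes M" "b \<in> even_modes M"
    unfolding a_def b_def by (simp_all add: even_proj_in g h)
  note sqs = sq_int_even_modes[OF ab(1)] sq_int_even_modes[OF ab(2)] sq_int_even_modes[OF q] g h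
  have rs: "sq_int r" "sq_int s" unfolding r_def s_def by (intro sq_int_diff sqs)+
  have orth: "(\<integral>x. r x * v x \<partial>circ) = 0" "(\<integral>x. s x * v x \<partial>circ) = 0" if "v \<in> even_modes M" for v
    unfolding r_def s_def a_def b_def by (rule even_proj_orth; fact)+
  define y where "y x = r x + s x" for x
  have y: "sq_int y" unfolding y_def by (intro sq_int_add rs)
  have yo: "(\<integral>x. v x * y x \<partial>circ) = 0" if v: "v \<in> even_modes M" for v
  proof -
    have "(\<integral>x. v x * y x \<partial>circ) = (\<integral>x. r x * v x + s x * v x \<partial>circ)" by (simp add: y_def algebra_simps)
    then show ?thesis using orth[OF v] sq_int_mult[OF rs(1) sq_int_even_modes[OF v]]
        sq_int_mult[OF rs(2) sq_int_even_modes[OF v]] by simp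
  qed
  have rr: "(\<integral>x. (r x)\<^sup>2 \<partial>circ) = (\<integral>x. (g x)\<^sup>2 \<partial>circ) - (\<integral>x. (a x)\<^sup>2 \<partial>circ)"
    and ss: "(\<integral>x. (s x)\<^sup>2 \<partial>circ) = (\<integral>x. (h x)\<^sup>2 \<partial>circ) - (\<integral>x. (b x)\<^sup>2 \<partial>circ)"
    unfolding r_def s_def a_def b_def by (rule even_proj_pythagoras; fact)+
  have "(\<integral>x. (g x)\<^sup>2 \<partial>circ) - (\<integral>x. (h x)\<^sup>2 \<partial>circ) \<le> (\<integral>x. (r x)\<^sup>2 \<partial>circ) - (\<integral>x. (s x)\<^sup>2 \<partial>circ)"
    using le unfolding rr ss a_def b_def by linarith
  also have "\<dots> = (\<integral>x. (r x)\<^sup>2 - (s x)\<^sup>2 \<partial>circ)"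
    using rs by (simp add: sq_int_def)
  also have "\<dots> = (\<integral>x. (g x - h x - q x) * y x + q x * y x - a x * y x + b x * y x \<partial>circ)"
    by (rule arg_cong[where f = "integral\<^sup>L circ"]) (auto simp: r_def s_def y_def power2_eq_square
        algebra_simps)
  also have "\<dots> = (\<integral>x. (g x - h x - q x) * y x \<partial>circ)"
    using yo[OF q] yo[OF ab(1)] yo[OF ab(2)] by (simp add: sq_int_mult sq_int_diff sqs y)
  also have "\<dots> \<le> sqrt (\<integral>x. (g x - h x - q x)\<^sup>2 \<partial>circ) * sqrt (\<integral>x. (y x)\<^sup>2 \<partial>circ)"
    using Cauchy_Schwarz_circ[of "\<lambda>x. g x - h x - q x" y] by (simp add: sq_int_diff sqs y)
  also have "\<dots> \<le> sqrt (\<integral>x. (g x - h x - q x)\<^sup>2 \<partial>circ) * sqrt (2 * (\<integral>x. (g x)\<^sup>2 \<partial>circ) + 2 * (\<integral>x. (h x)\<^sup>2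
      \<partial>circ))"
  proof (intro mult_left_mono real_sqrt_le_mono)
    have "(\<integral>x. (y x)\<^sup>2 \<partial>circ) \<le> (\<integral>x. 2 * (r x)\<^sup>2 + 2 * (s x)\<^sup>2 \<partial>circ)"
    proof (rule integral_mono)
      show "(y x)\<^sup>2 \<le> 2 * (r x)\<^sup>2 + 2 * (s x)\<^sup>2" for x
        using zero_le_power2[of "r x - s x"] by (simp add: y_def power2_eq_square algebra_simps)
    qed (use y rs in \<open>auto simp: sq_int_def\<close>)
    also have "\<dots> = 2 * (\<integral>x. (r x)\<^sup>2 \<partial>circ) + 2 * (\<integral>x. (s x)\<^sup>2 \<partial>circ)"
      using rs by (simp add: sq_int_def)
    also have "\<dots> \<le> 2 * (\<integral>x. (g x)\<^sup>2 \<partial>circ) + 2 * (\<integral>x. (h x)\<^sup>2 \<partial>circ)"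
      using even_proj_norm_le(2)[OF g, of M] even_proj_norm_le(2)[OF h, of M] unfolding r_def s_def
          a_def b_def by linarith
    finally show "(\<integral>x. (y x)\<^sup>2 \<partial>circ) \<le> 2 * (\<integral>x. (g x)\<^sup>2 \<partial>circ) + 2 * (\<integral>x. (h x)\<^sup>2 \<partial>circ)" .
  qed simp
  finally show ?thesis .
qed

section \<open>Uniform approximation by even modes\<close>

definition even_trig :: "(real \<Rightarrow> real) \<Rightarrow> bool" where
  "even_trig f \<longleftrightarrow> (\<exists>M. f \<in> even_modes M)"

lemma even_trig_lincomb:
  assumes "even_trig f" "even_trig g"
  shows "even_trig (\<lambda>x. a * f x + b * g x)"
proof -
  obtain M N where "f \<in> even_modes M" "g \<in> even_modes N" using assms unfolding even_trig_def by blast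
  then have "f \<in> even_modes (max M N)" "g \<in> even_modes (max M N)"
    using even_modes_mono[of M "max M N"] even_modes_mono[of N "max M N"] by auto
  then show ?thesis unfolding even_trig_def using even_modes_lincomb by blast
qed

lemma even_trig_cos: "even_trig (\<lambda>x. cos (2 * real m * x))"
  unfolding even_trig_def using cos_even_modes by blast

lemma even_trig_sum:
  assumes "\<And>i. i \<in> I \<Longrightarrow> even_trig (f i)"
  shows "even_trig (\<lambda>x. \<Sum>i\<in>I. c i * f i x)"
  using assms
proof (induction I rule: infinite_finite_induct)
  case (insert i I)
  then show ?case using even_trig_lincomb[of "f i" "\<lambda>x. \<Sum>i\<in>I. c i * f i x" "c i" 1] by simp
qed (auto simp: even_trig_def intro: const_even_modes)

text \<open>The product-to-sum formula, which raises the degree by one. The constant mode is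
  separate because there the lower frequency would be -1. Iteration makes every polynomial in
  \<open>cos (2 * x)\<close> an even mode.\<close>

lemma even_trig_mult_cos:
  assumes "even_trig f"
  shows "even_trig (\<lambda>x. cos (2 * x) * f x)"
proof -
  have *: "even_trig (\<lambda>x. cos (2 * x) * cos (2 * real m * x))" for m
  proof (cases m)
    case 0
    then show ?thesis using even_trig_cos[of 1] by simp
  next
    case (Suc n)
    have "cos (2 * x) * cos (2 * real m * x) = 1/2 * cos (2 * real n * x) + 1/2 * cos (2 * real (Suc m)
        * x)" for x
      using cos_times_cos[of "2 * real m * x" "2 * x"] by (simp add: Suc algebra_simps)
    then show ?thesis using even_trig_lincomb[OF even_trig_cos[of n] even_trig_cos[of "Suc m"], of "1/2"
        "1/2"] by simp
  qed
  obtain M c where f: "f = (\<lambda>\<theta>. \<Sum>m\<le>M. c m * cos (2 * real m * \<theta>))"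
    using assms unfolding even_trig_def even_modes_def by blast
  have "(\<lambda>x. cos (2 * x) * f x) = (\<lambda>x. \<Sum>m\<le>M. c m * (cos (2 * x) * cos (2 * real m * x)))"
    by (auto simp: f sum_distrib_left algebra_simps)
  then show ?thesis using even_trig_sum[of "{..M}" "\<lambda>m x. cos (2 * x) * cos (2 * real m * x)" c] * by simp
qed

text \<open>An even function of period \<open>pi\<close> is a function of
  \<open>cos (2 * x)\<close>, so the claim reduces to polynomial approximation on [-1, 1] after
  composing with \<open>arccos\<close>.\<close>

lemma even_modes_dense:
  assumes cont: "continuous_on UNIV E" and even: "\<And>x. E (- x) = E x" and per: "\<And>x. E (x + pi) = E x" and
      e: "e > 0"
  shows "\<exists>M. \<exists>q\<in>even_modes M. \<forall>x. \<bar>E x - q x\<bar> \<le> e"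
proof -
  \<comment> \<open>Halving the variable stretches the period from \<open>pi\<close> to
    \<open>2 * pi\<close>, so that \<open>cis\<close> classifies the arguments.\<close>
  define \<psi> where "\<psi> x = E (x / 2)" for x
  have \<psi>: "\<psi> (x + 2*pi) = \<psi> x" for x using per[of "x / 2"] by (simp add: \<psi>_def add_divide_distrib)
  have cos_\<psi>: "\<psi> x = \<psi> y" if xy: "cos x = cos y" for x y
  proof -
    have "cis x = cis y \<or> cis x = cis (- y)"
    proof -
      have "(sin x)\<^sup>2 = (sin y)\<^sup>2" using xy by (simp add: sin_squared_eq)
      then have "sin x = sin y \<or> sin x = - sin y" by (simp add: power2_eq_iff)
      then show ?thesis using xy by (auto simp: complex_eq_iff)
    qed
    moreover have "\<psi> (- y) = \<psi> y" using even[of "y / 2"] by (simp add: \<psi>_def)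
    ultimately show ?thesis using periodic_cis_eq[of \<psi>, OF \<psi>] by metis
  qed
  have c\<psi>: "continuous_on S \<psi>" for S
    unfolding \<psi>_def by (intro continuous_on_compose2[OF cont] continuous_intros) auto
  have "continuous_on {-1..1} (\<lambda>t. \<psi> (arccos t))"
    by (intro continuous_on_compose2[OF c\<psi>[of UNIV]] continuous_on_arccos') auto
  then obtain p where p: "real_polynomial_function p" "\<And>t. t \<in> {-1..1} \<Longrightarrow> \<bar>\<psi> (arccos t) - p t\<bar> < e"
    using Stone_Weierstrass_real_polynomial_function[of "{-1..1}" "\<lambda>t. \<psi> (arccos t)" e] e by auto
  obtain a n where an: "p = (\<lambda>t. \<Sum>i\<le>n. a i * t ^ i)"
    using p(1) unfolding real_polynomial_function_iff_sum by blast
  have "even_trig (\<lambda>x. cos (2 * x) ^ i)" for i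
  proof (induction i)
    case 0
    then show ?case using even_trig_cos[of 0] by simp
  next
    case (Suc i)
    then show ?case using even_trig_mult_cos[OF Suc] by simp
  qed
  then have "even_trig (\<lambda>x. p (cos (2 * x)))" unfolding an by (intro even_trig_sum)
  then obtain M where M: "(\<lambda>x. p (cos (2 * x))) \<in> even_modes M" unfolding even_trig_def by blast
  have "\<bar>E x - p (cos (2 * x))\<bar> \<le> e" for x
  proof -
    have "E x = \<psi> (2 * x)" by (simp add: \<psi>_def)
    also have "\<dots> = \<psi> (arccos (cos (2 * x)))" by (rule cos_\<psi>) (simp add: cos_arccos)
    finally show ?thesis using p(2)[of "cos (2 * x)"] by simp
  qed
  then show ?thesis using M by (intro exI[of _ M] bexI[of _ "\<lambda>x. p (cos (2 * x))"]) auto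
qed

text \<open>Dominated convergence after dropping an initial segment. The bound is required only
  eventually because an arbitrary sequence of zonotopes tending to a zonoid is controlled only from
  some index on.\<close>

lemma integral_square_tendsto:
  assumes meas: "\<And>j. w j \<in> borel_measurable circ" "u \<in> borel_measurable circ" and s: "sq_int s"
    and bd: "eventually (\<lambda>j. \<forall>x. \<bar>w j x\<bar> \<le> B) sequentially" and lim: "\<And>x. (\<lambda>j. w j x) \<longlonglongrightarrow> u x"
  shows "(\<lambda>j. \<integral>x. (w j x - s x)\<^sup>2 \<partial>circ) \<longlonglongrightarrow> (\<integral>x. (u x - s x)\<^sup>2 \<partial>circ)"
proof -
  obtain N where N: "\<And>j x. j \<ge> N \<Longrightarrow> \<bar>w j x\<bar> \<le> B" using bd unfolding eventually_sequentially by blast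
  have "(\<lambda>j. \<integral>x. (w (j + N) x - s x)\<^sup>2 \<partial>circ) \<longlonglongrightarrow> (\<integral>x. (u x - s x)\<^sup>2 \<partial>circ)"
  proof (rule integral_dominated_convergence[where w = "\<lambda>x. 2 * B\<^sup>2 + 2 * (s x)\<^sup>2"])
    have [measurable]: "s \<in> borel_measurable circ" using s by (simp add: sq_int_def)
    show "(\<lambda>x. (u x - s x)\<^sup>2) \<in> borel_measurable circ" "(\<lambda>x. (w (j + N) x - s x)\<^sup>2) \<in> borel_measurable
        circ" for j
      using meas by auto
    show "integrable circ (\<lambda>x. 2 * B\<^sup>2 + 2 * (s x)\<^sup>2)"
      using s finite_measure_circ by (auto simp: sq_int_def finite_measure.integrable_const)
    show "AE x in circ. (\<lambda>j. (w (j + N) x - s x)\<^sup>2) \<longlonglongrightarrow> (u x - s x)\<^sup>2"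
      by (intro AE_I2 tendsto_intros LIMSEQ_ignore_initial_segment lim)
    show "AE x in circ. norm ((w (j + N) x - s x)\<^sup>2) \<le> 2 * B\<^sup>2 + 2 * (s x)\<^sup>2" for j
    proof (rule AE_I2)
      fix x
      have "(w (j + N) x)\<^sup>2 \<le> B\<^sup>2" using N[of "j + N" x] abs_le_square_iff[of "w (j + N) x" B] by simp
      moreover have "(w (j + N) x - s x)\<^sup>2 \<le> 2 * (w (j + N) x)\<^sup>2 + 2 * (s x)\<^sup>2"
        using zero_le_power2[of "w (j + N) x + s x"] by (simp add: power2_eq_square algebra_simps)
      ultimately show "norm ((w (j + N) x - s x)\<^sup>2) \<le> 2 * B\<^sup>2 + 2 * (s x)\<^sup>2" by simp
    qed
  qed
  then show ?thesis by (rule LIMSEQ_offset)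
qed

subsection \<open>The excluded area of a zonotope\<close>

lemma semiconvex_const: "semiconvex 0 (\<lambda>_. c) (\<lambda>_. 0)"
  by unfold_locales auto

lemma semiconvex_mono:
  assumes "semiconvex C u d" "C \<le> C'"
  shows "semiconvex C' u d"
proof -
  interpret semiconvex C u d by fact
  show ?thesis
  proof
    fix x y
    have "C / 2 * (y - x)\<^sup>2 \<le> C' / 2 * (y - x)\<^sup>2" using assms(2) by (intro mult_right_mono) auto
    then show "u x + d x * (y - x) - C' / 2 * (y - x)\<^sup>2 \<le> u y" using support[of x y] by linarith
    show "\<bar>d x\<bar> \<le> C'" using bound[of x] assms(2) by linarith
  qed (rule periodic)
qed

lemma semiconvex_add:
  assumes "semiconvex C u d" "semiconvex C' u' d'"
  shows "semiconvex (C + C') (\<lambda>x. u x + u' x) (\<lambda>x. d x + d' x)"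
proof -
  interpret u: semiconvex C u d by fact
  interpret u': semiconvex C' u' d' by fact
  show ?thesis
  proof
    fix x y
    show "(u x + u' x) + (d x + d' x) * (y - x) - (C + C') / 2 * (y - x)\<^sup>2 \<le> u y + u' y"
      using u.support[of x y] u'.support[of x y] by (simp add: algebra_simps add_divide_distrib)
    show "\<bar>d x + d' x\<bar> \<le> C + C'" using u.bound[of x] u'.bound[of x] by linarith
  qed (simp add: u.periodic u'.periodic)
qed

lemma semiconvex_sum_list:
  assumes "\<And>v. v \<in> set V \<Longrightarrow> \<exists>d. semiconvex (C v) (u v) d"
  shows "\<exists>d. semiconvex (\<Sum>v\<leftarrow>V. C v) (\<lambda>x. \<Sum>v\<leftarrow>V. u v x) d"
  using assms
proof (induction V)
  case Nil
  show ?case using semiconvex_const[of 0] by auto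
next
  case (Cons v V)
  obtain d where d: "semiconvex (C v) (u v) d" using Cons.prems[of v] by auto
  obtain d' where "semiconvex (\<Sum>v\<leftarrow>V. C v) (\<lambda>x. \<Sum>v\<leftarrow>V. u v x) d'"
    using Cons.IH Cons.prems by auto
  from semiconvex_add[OF d this] show ?case by auto
qed

text \<open>The squares of a sinusoid and of its derivative add up to the square of the
  amplitude.\<close>

lemma sinusoid_bound:
  fixes p q r :: real
  assumes "p\<^sup>2 + q\<^sup>2 = r\<^sup>2" "r \<ge> 0"
  shows "\<bar>p * cos x + q * sin x\<bar> \<le> r" "\<bar>- p * sin x + q * cos x\<bar> \<le> r"
proof -
  have "(p * c + q * s)\<^sup>2 + (- p * s + q * c)\<^sup>2 = (p\<^sup>2 + q\<^sup>2) * (s\<^sup>2 + c\<^sup>2)" for c s :: real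
    by (simp add: power2_eq_square algebra_simps)
  from this[of "cos x" "sin x"] have *: "(p * cos x + q * sin x)\<^sup>2 + (- p * sin x + q * cos x)\<^sup>2 = r\<^sup>2"
    by (simp add: assms(1))
  moreover have "(p * cos x + q * sin x)\<^sup>2 \<ge> 0" "(- p * sin x + q * cos x)\<^sup>2 \<ge> 0" by simp_all
  ultimately have "(p * cos x + q * sin x)\<^sup>2 \<le> r\<^sup>2" "(- p * sin x + q * cos x)\<^sup>2 \<le> r\<^sup>2" by linarith+
  then show "\<bar>p * cos x + q * sin x\<bar> \<le> r" "\<bar>- p * sin x + q * cos x\<bar> \<le> r"
    using assms(2) abs_le_square_iff[of _ r] by (metis abs_of_nonneg)+
qed

text \<open>Choosing the sign of \<open>f\<close> at \<open>x\<close> gives a sinusoid that lies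
  below \<bar>f\<bar> everywhere and touches it at \<open>x\<close>. Its Taylor remainder is at most
  \<open>r / 2 * (y - x)\<^sup>2\<close>, since the second derivative is bounded by the
  amplitude.\<close>

lemma semiconvex_abs_sinusoid:
  fixes p q r :: real
  assumes pq: "p\<^sup>2 + q\<^sup>2 = r\<^sup>2" and r: "r \<ge> 0"
  shows "\<exists>d. semiconvex r (\<lambda>x. \<bar>p * cos x + q * sin x\<bar>) d"
proof -
  define f f' where "f x = p * cos x + q * sin x" and "f' x = - p * sin x + q * cos x" for x
  \<comment> \<open>At a zero of \<open>f\<close> either sign gives a valid slope; the value 1 is
    chosen there.\<close>
  define s :: "real \<Rightarrow> real" where "s x = (if f x \<ge> 0 then 1 else -1)" for x
  note bnd = sinusoid_bound[OF pq r, folded f_def f'_def]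
  have D: "(f has_real_derivative f' x) (at x)" "(f' has_real_derivative - f x) (at x)" for x
    unfolding f_def f'_def by (auto intro!: derivative_eq_intros)
  have taylor: "\<bar>f y - f x - f' x * (y - x)\<bar> \<le> r / 2 * (y - x)\<^sup>2" for x y
  proof (cases "x = y")
    case False
    define diff where "diff m = (if m = 0 then f else if m = 1 then f' else (\<lambda>x. - f x))" for m :: nat
    have "\<forall>m t. m < 2 \<and> min x y \<le> t \<and> t \<le> max x y \<longrightarrow> DERIV (diff m) t :> diff (Suc m) t"
      using D by (auto simp: diff_def less_2_cases_iff)
    then obtain t where t: "f y = (\<Sum>m<2. diff m x / fact m * (y - x) ^ m) + diff 2 t / fact 2 * (y - x)\<^sup>2"
      using Taylor[of 2 diff f "min x y" "max x y" x y] False by (auto simp: diff_def)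
    then have "f y - f x - f' x * (y - x) = - f t / 2 * (y - x)\<^sup>2"
      by (simp add: diff_def numeral_2_eq_2)
    then show ?thesis using bnd(1)[of t] by (simp add: abs_mult mult_right_mono)
  qed simp
  have "semiconvex r (\<lambda>x. \<bar>f x\<bar>) (\<lambda>x. s x * f' x)"
  proof
    fix x y
    show "\<bar>f (x + 2*pi)\<bar> = \<bar>f x\<bar>" by (simp add: f_def)
    show "\<bar>s x * f' x\<bar> \<le> r" using bnd(2)[of x] by (simp add: s_def)
    show "\<bar>f x\<bar> + s x * f' x * (y - x) - r / 2 * (y - x)\<^sup>2 \<le> \<bar>f y\<bar>"
    proof -
      have "\<bar>s x\<bar> = 1" by (simp add: s_def)
      then have "\<bar>s x * (f y - f x - f' x * (y - x))\<bar> \<le> r / 2 * (y - x)\<^sup>2"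
        using taylor[of y x] by (simp only: abs_mult mult_1)
      then have "s x * (f y - f x - f' x * (y - x)) \<ge> - (r / 2 * (y - x)\<^sup>2)"
        by (simp only: abs_le_iff minus_le_iff)
      moreover have "s x * f y \<le> \<bar>f y\<bar>" "s x * f x = \<bar>f x\<bar>" by (auto simp: s_def)
      ultimately show ?thesis by (simp add: algebra_simps)
    qed
  qed
  then show ?thesis unfolding f_def by blast
qed

lemma det2_inner_sq: "(det2 v w)\<^sup>2 + (v \<bullet> w)\<^sup>2 = (norm v * norm w)\<^sup>2"
  unfolding power_mult_distrib power2_norm_eq_inner
  by (simp add: det2_def inner_vec_def sum_2 power2_eq_square algebra_simps)

lemma semiconvex_excluded_area:
  assumes "(\<Sum>v\<leftarrow>V. norm v) \<le> R"
  shows "\<exists>d. semiconvex (R\<^sup>2) (\<lambda>\<theta>. excluded_area \<theta> (zonotope V)) d"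
proof -
  define S where "S = (\<Sum>v\<leftarrow>V. norm v)"
  have "\<exists>d. semiconvex (norm v * norm w) (\<lambda>\<theta>. \<bar>det2 v w * cos \<theta> + (v \<bullet> w) * sin \<theta>\<bar>) d" for v w
    by (rule semiconvex_abs_sinusoid[OF det2_inner_sq]) simp
  then have "\<exists>d. semiconvex (\<Sum>v\<leftarrow>V. \<Sum>w\<leftarrow>V. norm v * norm w)
      (\<lambda>\<theta>. \<Sum>v\<leftarrow>V. \<Sum>w\<leftarrow>V. \<bar>det2 v w * cos \<theta> + (v \<bullet> w) * sin \<theta>\<bar>) d"
    by (intro semiconvex_sum_list)
  moreover have "(\<Sum>v\<leftarrow>V. \<Sum>w\<leftarrow>V. norm v * norm w) = S\<^sup>2"
    by (simp add: S_def power2_eq_square sum_list_const_mult sum_list_mult_const)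
  ultimately obtain d where "semiconvex (S\<^sup>2) (\<lambda>\<theta>. \<Sum>v\<leftarrow>V. \<Sum>w\<leftarrow>V. \<bar>det2 v w * cos \<theta> + (v \<bullet> w) * sin \<theta>\<bar>) d"
    by auto
  from semiconvex_add[OF semiconvex_const this, of "2 * zarea V"]
  have "semiconvex (S\<^sup>2) (\<lambda>\<theta>. excluded_area \<theta> (zonotope V)) d"
    by (simp add: excluded_area_zonotope)
  moreover have "S \<ge> 0" unfolding S_def by (rule sum_list_nonneg) auto
  then have "S\<^sup>2 \<le> R\<^sup>2" using assms unfolding S_def by (intro power_mono)
  ultimately show ?thesis using semiconvex_mono by blast
qed

text \<open>The factor 3 collects two areas, each at most the square of the sum of norms, and the
  sinusoids, whose amplitudes add up to the same square.\<close>

lemma excluded_area_bound: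
  assumes "(\<Sum>v\<leftarrow>V. norm v) \<le> R"
  shows "\<bar>excluded_area \<theta> (zonotope V)\<bar> \<le> 3 * R\<^sup>2"
proof -
  define S where "S = (\<Sum>v\<leftarrow>V. norm v)"
  have "(\<Sum>v\<leftarrow>V. \<Sum>w\<leftarrow>V. \<bar>det2 v w * cos \<theta> + (v \<bullet> w) * sin \<theta>\<bar>) \<le> (\<Sum>v\<leftarrow>V. \<Sum>w\<leftarrow>V. norm v * norm w)"
    by (intro sum_list_mono sinusoid_bound(1)[OF det2_inner_sq]) simp
  also have "\<dots> = S\<^sup>2"
    by (simp add: S_def power2_eq_square sum_list_const_mult sum_list_mult_const)
  finally have "excluded_area \<theta> (zonotope V) \<le> 3 * S\<^sup>2"
    using zarea_bound[of V] by (simp add: excluded_area_zonotope S_def)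
  moreover have "S \<ge> 0" unfolding S_def by (rule sum_list_nonneg) auto
  then have "S\<^sup>2 \<le> R\<^sup>2" using assms unfolding S_def by (intro power_mono)
  moreover have "excluded_area \<theta> (zonotope V) \<ge> 0" by (simp add: excluded_area_def)
  ultimately show ?thesis by simp
qed

text \<open>The square is at most \<open>r\<close> times the absolute value and integrates to
  \<open>pi * r\<^sup>2\<close>. This gives a lower bound linear in the amplitude without locating
  the zeros.\<close>

lemma integral_abs_sinusoid:
  fixes p q r :: real
  assumes pq: "p\<^sup>2 + q\<^sup>2 = r\<^sup>2" and r: "r \<ge> 0"
  shows "(\<integral>x. \<bar>p * cos x + q * sin x\<bar> \<partial>circ) \<ge> pi * r"
proof (cases "r = 0")
  case False
  \<comment> \<open>An antiderivative of the square, found from the double angle formulas. Only its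
    linear term survives over a full period.\<close>
  define F where "F x = (p\<^sup>2 + q\<^sup>2) / 2 * x + (p\<^sup>2 - q\<^sup>2) / 2 * (sin x * cos x) + p * q * (sin x)\<^sup>2" for x
  have "((\<lambda>x. (p * cos x + q * sin x)\<^sup>2) has_integral F (2*pi) - F 0) {0..2*pi}"
  proof (rule fundamental_theorem_of_calculus)
    fix x
    have "(F has_real_derivative (p\<^sup>2 + q\<^sup>2) / 2 + (p\<^sup>2 - q\<^sup>2) / 2 * ((cos x)\<^sup>2 - (sin x)\<^sup>2) + p * q *
        (2 * sin x * cos x)) (at x)"
      unfolding F_def by (auto intro!: derivative_eq_intros simp: power2_eq_square)
    moreover have "(p\<^sup>2 + q\<^sup>2) / 2 * (s\<^sup>2 + c\<^sup>2) + (p\<^sup>2 - q\<^sup>2) / 2 * (c\<^sup>2 - s\<^sup>2) + p * q * (2 * s * c) =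
        (p * c + q * s)\<^sup>2" for c s
      by (simp add: power2_eq_square field_simps)
    from this[of "sin x" "cos x"]
    have "(p\<^sup>2 + q\<^sup>2) / 2 + (p\<^sup>2 - q\<^sup>2) / 2 * ((cos x)\<^sup>2 - (sin x)\<^sup>2) + p * q * (2 * sin x * cos x) = (p
        * cos x + q * sin x)\<^sup>2"
      by simp
    ultimately have "(F has_real_derivative (p * cos x + q * sin x)\<^sup>2) (at x)" by simp
    then show "(F has_vector_derivative (p * cos x + q * sin x)\<^sup>2) (at x within {0..2*pi})"
      by (simp add: has_real_derivative_iff_has_vector_derivative has_vector_derivative_at_within)
  qed simp
  then have "(\<integral>x. (p * cos x + q * sin x)\<^sup>2 \<partial>circ) = pi * r\<^sup>2"
    by (subst integral_circ_eq) (auto intro!: integrable_circ_continuous continuous_intros simp: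
        integral_unique F_def pq)
  moreover have "(\<integral>x. (p * cos x + q * sin x)\<^sup>2 \<partial>circ) \<le> (\<integral>x. r * \<bar>p * cos x + q * sin x\<bar> \<partial>circ)"
  proof (rule integral_mono)
    show "(p * cos x + q * sin x)\<^sup>2 \<le> r * \<bar>p * cos x + q * sin x\<bar>" for x
      using mult_right_mono[OF sinusoid_bound(1)[OF pq r, of x], of "\<bar>p * cos x + q * sin x\<bar>"]
      by (simp add: power2_eq_square flip: abs_mult)
  qed (auto intro!: integrable_circ_continuous continuous_intros)
  ultimately have "r * (pi * r) \<le> r * (\<integral>x. \<bar>p * cos x + q * sin x\<bar> \<partial>circ)"
    by (simp add: power2_eq_square mult_ac)
  then show ?thesis using False r by simp
qed simp

lemma integral_sum_list_ge:
  fixes u :: "'a \<Rightarrow> real \<Rightarrow> real"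
  assumes "\<And>v. v \<in> set V \<Longrightarrow> continuous_on UNIV (u v) \<and> c v \<le> (\<integral>x. u v x \<partial>circ)"
  shows "continuous_on UNIV (\<lambda>x. \<Sum>v\<leftarrow>V. u v x) \<and> (\<Sum>v\<leftarrow>V. c v) \<le> (\<integral>x. (\<Sum>v\<leftarrow>V. u v x) \<partial>circ)"
  using assms
proof (induction V)
  case (Cons v V)
  then have v: "continuous_on UNIV (u v)" "c v \<le> (\<integral>x. u v x \<partial>circ)"
    and V: "continuous_on UNIV (\<lambda>x. \<Sum>v\<leftarrow>V. u v x)" "(\<Sum>v\<leftarrow>V. c v) \<le> (\<integral>x. (\<Sum>v\<leftarrow>V. u v x) \<partial>circ)" by auto
  then have "(\<integral>x. u v x + (\<Sum>v\<leftarrow>V. u v x) \<partial>circ) = (\<integral>x. u v x \<partial>circ) + (\<integral>x. (\<Sum>v\<leftarrow>V. u v x) \<partial>circ)"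
    by (intro Bochner_Integration.integral_add integrable_circ_continuous)
  then show ?case using v V by (auto intro!: continuous_intros)
qed simp

text \<open>The coercivity estimate: a bound on the mean of the excluded area bounds the generators.
  The constant area term is dropped since it is non-negative.\<close>

lemma integral_excluded_area_ge:
  "pi * (\<Sum>v\<leftarrow>V. norm v)\<^sup>2 \<le> (\<integral>\<theta>. excluded_area \<theta> (zonotope V) \<partial>circ)"
proof -
  define u where "u \<theta> = (\<Sum>v\<leftarrow>V. \<Sum>w\<leftarrow>V. \<bar>det2 v w * cos \<theta> + (v \<bullet> w) * sin \<theta>\<bar>)" for \<theta>
  have *: "continuous_on UNIV u \<and> (\<Sum>v\<leftarrow>V. \<Sum>w\<leftarrow>V. pi * (norm v * norm w)) \<le> (\<integral>\<theta>. u \<theta> \<partial>circ)"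
    unfolding u_def
    by (intro integral_sum_list_ge conjI integral_abs_sinusoid[OF det2_inner_sq] continuous_intros) auto
  have "(\<Sum>v\<leftarrow>V. \<Sum>w\<leftarrow>V. pi * (norm v * norm w)) = pi * (\<Sum>v\<leftarrow>V. norm v)\<^sup>2"
    by (simp add: power2_eq_square sum_list_const_mult sum_list_mult_const)
  moreover have "(\<integral>\<theta>. u \<theta> \<partial>circ) \<le> (\<integral>\<theta>. 2 * zarea V + u \<theta> \<partial>circ)"
    using * zarea_nonneg[of V] by (intro integral_mono integrable_circ_continuous continuous_intros) auto
  ultimately show ?thesis using * by (simp add: excluded_area_zonotope u_def)
qed

lemma sum_list_swap:
  fixes g :: "'a \<Rightarrow> 'b \<Rightarrow> real"
  shows "(\<Sum>v\<leftarrow>U. \<Sum>w\<leftarrow>W. g v w) = (\<Sum>w\<leftarrow>W. \<Sum>v\<leftarrow>U. g v w)"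
  by (induction U) (auto simp: sum_list_addf)

text \<open>Reflecting the angle exchanges the roles of \<open>v\<close> and \<open>w\<close> up to
  sign, which the symmetric double sum does not see; a shift by \<open>pi\<close> flips the sign
  inside each absolute value.\<close>

lemma excluded_area_even_periodic:
  "excluded_area (- \<theta>) (zonotope V) = excluded_area \<theta> (zonotope V)"
  "excluded_area (\<theta> + pi) (zonotope V) = excluded_area \<theta> (zonotope V)"
proof -
  have "\<bar>det2 v w * cos (- \<theta>) + (v \<bullet> w) * sin (- \<theta>)\<bar> = \<bar>det2 w v * cos \<theta> + (w \<bullet> v) * sin \<theta>\<bar>" for v w
  proof -
    have "det2 v w * cos (- \<theta>) + (v \<bullet> w) * sin (- \<theta>) = - (det2 w v * cos \<theta> + (w \<bullet> v) * sin \<theta>)"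
      by (simp add: det2_def inner_commute algebra_simps)
    then show ?thesis by (simp only: abs_minus_cancel)
  qed
  then show "excluded_area (- \<theta>) (zonotope V) = excluded_area \<theta> (zonotope V)"
    unfolding excluded_area_zonotope by (subst sum_list_swap) (simp only:)
  have "\<bar>det2 v w * cos (\<theta> + pi) + (v \<bullet> w) * sin (\<theta> + pi)\<bar> = \<bar>det2 v w * cos \<theta> + (v \<bullet> w) * sin \<theta>\<bar>" for v w
  proof -
    have "det2 v w * cos (\<theta> + pi) + (v \<bullet> w) * sin (\<theta> + pi) = - (det2 v w * cos \<theta> + (v \<bullet> w) * sin \<theta>)"
      by simp
    then show ?thesis by (simp only: abs_minus_cancel)
  qed
  then show "excluded_area (\<theta> + pi) (zonotope V) = excluded_area \<theta> (zonotope V)"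
    unfolding excluded_area_zonotope by simp
qed

subsection \<open>Convergence of minimisers\<close>

theorem theorem3p2:
  fixes f :: "real \<Rightarrow> real"
    and V :: "nat \<Rightarrow> nat \<Rightarrow> (real^2) list"
    and M k :: "nat \<Rightarrow> nat"
  assumes f: "in_Lp 2 f"
    and V: "\<And>m n. is_arg_min
              (\<lambda>W. (Lp_norm 2 (even_proj m (\<lambda>\<theta>. excluded_area \<theta> (zonotope W) - f \<theta>)))\<^sup>2)
              (\<lambda>W. length W = n) (V m n)"
    and M: "filterlim M at_top sequentially"
    and k: "filterlim k at_top sequentially"
  shows "\<exists>r :: nat \<Rightarrow> nat. \<exists>K. strict_mono r \<and> zonoid K \<and>
    weakstar_W1inf (\<lambda>j \<theta>. excluded_area \<theta> (zonotope (V (M (r j)) (k (r j)))))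
      (\<lambda>\<theta>. excluded_area \<theta> K) \<and>
    (\<forall>p::real. 1 \<le> p \<longrightarrow>
      tendsto_W1p p (\<lambda>j \<theta>. excluded_area \<theta> (zonotope (V (M (r j)) (k (r j)))))
        (\<lambda>\<theta>. excluded_area \<theta> K)) \<and>
    weakstar_second_deriv (\<lambda>j \<theta>. excluded_area \<theta> (zonotope (V (M (r j)) (k (r j)))))
      (\<lambda>\<theta>. excluded_area \<theta> K) \<and>
    (\<lambda>j. hausdorff_dist (zonotope (V (M (r j)) (k (r j)))) K) \<longlonglongrightarrow> 0 \<and>
    (Lp_norm 2 (\<lambda>\<theta>. excluded_area \<theta> K - f \<theta>))\<^sup>2 =
      (INF N\<in>{N. zonoid N}. (Lp_norm 2 (\<lambda>\<theta>. excluded_area \<theta> N - f \<theta>))\<^sup>2) \<and>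
    ((\<exists>N. zonoid N \<and> (AE \<theta> in circ. f \<theta> = excluded_area \<theta> N)) \<longrightarrow>
      (AE \<theta> in circ. f \<theta> = excluded_area \<theta> K))"
proof -
  have sf: "sq_int f" using f by (simp add: in_Lp_2_iff)
  define Z where "Z W \<theta> = excluded_area \<theta> (zonotope W)" for W \<theta>
  define Q where "Q g = (\<integral>x. (g x)\<^sup>2 \<partial>circ)" for g :: "real \<Rightarrow> real"
  have cZ: "continuous_on UNIV (Z W)" for W
    using semiconvex_excluded_area[OF order_refl, of W] semiconvex.continuous_u unfolding Z_def by blast
  have sZ: "sq_int (Z W)" and mZ: "Z W \<in> borel_measurable circ" for W
    using sq_int_continuous[OF cZ, of W] by (auto simp: sq_int_def)
  have sg: "sq_int (\<lambda>\<theta>. Z W \<theta> - f \<theta>)" for W by (intro sq_int_diff sZ sf)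
  have min_le: "Q (even_proj m (\<lambda>\<theta>. Z (V m n) \<theta> - f \<theta>)) \<le> Q (even_proj m (\<lambda>\<theta>. Z W \<theta> - f \<theta>))"
    if "length W = n" for m n W
    using V[of m n] that unfolding is_arg_min_linorder Lp_norm_2_sq Q_def Z_def by blast

  \<comment> \<open>Solves \<open>pi * S\<^sup>2 \<le> (\<integral>x. f x \<partial>circ) + (Q f + 2
    * pi) / 2\<close> for \<open>S\<close>, the sum of the norms. The right side does not depend on
    \<open>m\<close> or \<open>n\<close>.\<close>
  define R where "R = sqrt (((\<integral>x. f x \<partial>circ) + (Q f + 2 * pi) / 2) / pi)"
  have R: "(\<Sum>v\<leftarrow>V m n. norm v) \<le> R" for m n
  proof -
    define g where "g \<theta> = Z (V m n) \<theta> - f \<theta>" for \<theta>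
    define p where "p = even_proj m g"
    have g: "sq_int g" unfolding g_def by (rule sg)
    have p: "sq_int p" "p \<in> even_modes m"
      unfolding p_def using even_proj_in[OF g] sq_int_even_modes by auto
    have one: "sq_int (\<lambda>_. 1)" by (intro sq_int_continuous continuous_intros)
    \<comment> \<open>The zero list of length \<open>n\<close> is an admissible competitor with
      vanishing excluded area, so its projected error is at most the norm of
      \<open>f\<close>.\<close>
    have "(\<Sum>v\<leftarrow>replicate n (0 :: real^2). norm v) \<le> 0" by (simp add: sum_list_replicate)
    from excluded_area_bound[OF this] have Z0: "Z (replicate n 0) = (\<lambda>_. 0)" by (auto simp: Z_def)
    have "Q p \<le> Q (even_proj m (\<lambda>\<theta>. Z (replicate n 0) \<theta> - f \<theta>))"
      unfolding p_def g_def by (rule min_le) simp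
    also have "\<dots> \<le> Q (\<lambda>\<theta>. Z (replicate n 0) \<theta> - f \<theta>)"
      unfolding Q_def by (rule even_proj_norm_le(1)[OF sg])
    also have "\<dots> = Q f" by (simp add: Z0 Q_def)
    finally have Qp: "Q p \<le> Q f" .
    have "(\<integral>x. (g x - p x) * 1 \<partial>circ) = 0"
      unfolding p_def by (rule even_proj_orth[OF g const_even_modes])
    then have gp: "(\<integral>x. g x \<partial>circ) = (\<integral>x. p x \<partial>circ)"
      using sq_int_mult[OF g one] sq_int_mult[OF p(1) one] by simp
    \<comment> \<open>The projection preserves the mean because constants are even modes. The mean
      is then bounded by the square norm through \<open>p \<le> (p\<^sup>2 + 1) / 2\<close>, and
      \<open>2 * pi\<close> is the length of the circle.\<close>
    have "(\<integral>x. p x \<partial>circ) \<le> (\<integral>x. ((p x)\<^sup>2 + 1) / 2 \<partial>circ)"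
    proof (rule integral_mono)
      show "p x \<le> ((p x)\<^sup>2 + 1) / 2" for x
        using zero_le_power2[of "p x - 1"] by (simp add: power2_eq_square algebra_simps)
    qed (use p(1) sq_int_mult[OF p(1) one] sq_int_mult[OF one one] in \<open>auto simp: sq_int_def\<close>)
    also have "\<dots> = (Q p + 2 * pi) / 2"
      using p(1) sq_int_mult[OF one one] by (simp add: sq_int_def Q_def measure_circ)
    finally have "(\<integral>x. g x \<partial>circ) \<le> (Q f + 2 * pi) / 2" using gp Qp by simp
    moreover have "(\<integral>x. g x \<partial>circ) = (\<integral>x. Z (V m n) x \<partial>circ) - (\<integral>x. f x \<partial>circ)"
      using sq_int_mult[OF sZ one] sq_int_mult[OF sf one] by (simp add: g_def)
    moreover have "pi * (\<Sum>v\<leftarrow>V m n. norm v)\<^sup>2 \<le> (\<integral>x. Z (V m n) x \<partial>circ)"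
      unfolding Z_def by (rule integral_excluded_area_ge)
    ultimately have "pi * (\<Sum>v\<leftarrow>V m n. norm v)\<^sup>2 \<le> (\<integral>x. f x \<partial>circ) + (Q f + 2 * pi) / 2" by linarith
    then show ?thesis unfolding R_def by (intro real_le_rsqrt) (simp add: field_simps)
  qed

  have sub: "zonotope (V (M n) (k n)) \<subseteq> cball 0 R" for n
    using zonotope_subset_cball R subset_cball by blast
  obtain r K where r: "strict_mono r" and K: "compact K" "K \<noteq> {}"
      and haus: "(\<lambda>j. hausdorff_dist (zonotope (V (M (r j)) (k (r j)))) K) \<longlonglongrightarrow> 0"
    using blaschke_selection[of "cball 0 R" "\<lambda>n. zonotope (V (M n) (k n))", OF compact_cball
        zonotope_nonempty sub] .
  have zon: "zonoid K"
    unfolding zonoid_def using K haus by (intro conjI exI[of _ "\<lambda>j. V (M (r j)) (k (r j))"])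
  define w where "w j = Z (V (M (r j)) (k (r j)))" for j
  define u where "u \<theta> = excluded_area \<theta> K" for \<theta>
  have lim: "(\<lambda>j. w j \<theta>) \<longlonglongrightarrow> u \<theta>" for \<theta>
    unfolding w_def Z_def u_def by (rule excluded_area_tendsto[OF K haus])
  have bd: "\<bar>w j \<theta>\<bar> \<le> 3 * R\<^sup>2" for j \<theta>
    unfolding w_def Z_def by (rule excluded_area_bound[OF R])
  then have bd_ev: "eventually (\<lambda>j. \<forall>\<theta>. \<bar>w j \<theta>\<bar> \<le> 3 * R\<^sup>2) sequentially" by simp
  have "\<exists>d. semiconvex (R\<^sup>2) (w j) d" for j
    unfolding w_def Z_def by (rule semiconvex_excluded_area[OF R])
  then obtain dw where sc: "\<And>j. semiconvex (R\<^sup>2) (w j) (dw j)" by metis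
  obtain d where u: "semiconvex (R\<^sup>2) u d" using semiconvex_limit[OF sc lim] .
  have cu: "continuous_on UNIV u" by (rule semiconvex.continuous_u[OF u])
  have su: "sq_int (\<lambda>\<theta>. u \<theta> - f \<theta>)" by (intro sq_int_diff sq_int_continuous cu sf)
  have mu: "u \<in> borel_measurable circ" using sq_int_continuous[OF cu] by (simp add: sq_int_def)
  have mw: "w j \<in> borel_measurable circ" for j unfolding w_def by (rule mZ)
  have Mr: "filterlim (\<lambda>j. M (r j)) at_top sequentially" and kr: "filterlim (\<lambda>j. k (r j)) at_top sequentially"
    using filterlim_compose[OF M filterlim_subseq[OF r]] filterlim_compose[OF k filterlim_subseq[OF r]] by auto

  have opt_zonotope: "Q (\<lambda>\<theta>. u \<theta> - f \<theta>) \<le> Q (\<lambda>\<theta>. Z W \<theta> - f \<theta>)" for W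
  proof -
    define G H where "G = Q (\<lambda>\<theta>. u \<theta> - f \<theta>)" and "H = Q (\<lambda>\<theta>. Z W \<theta> - f \<theta>)"
    have GH: "G \<ge> 0" "H \<ge> 0" by (simp_all add: G_def H_def Q_def)
    have "G - H \<le> (sqrt (2 * pi) * sqrt (2 * G + 2 * H)) * e" if e: "e > 0" for e
    proof -
      have even: "u (- \<theta>) = u \<theta>" "u (\<theta> + pi) = u \<theta>" for \<theta>
        using LIMSEQ_unique[OF lim[of "- \<theta>"], of "u \<theta>"] LIMSEQ_unique[OF lim[of "\<theta> + pi"], of "u \<theta>"] lim[of \<theta>]
        by (simp_all add: w_def Z_def excluded_area_even_periodic)
      \<comment> \<open>The approximated function involves the limit \<open>u\<close>, not
        \<open>w j\<close>, so the degree \<open>M0\<close> is fixed and is eventually dominated by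
        \<open>M (r j)\<close>. The discrepancy between \<open>w j\<close> and \<open>u\<close>
        disappears in the limit.\<close>
      have "\<exists>M. \<exists>q\<in>even_modes M. \<forall>x. \<bar>(u x - Z W x) - q x\<bar> \<le> e"
        by (rule even_modes_dense[OF continuous_on_diff[OF cu cZ] _ _ e])
          (simp_all add: even Z_def excluded_area_even_periodic)
      then obtain M0 q where q: "q \<in> even_modes M0" "\<And>x. \<bar>(u x - Z W x) - q x\<bar> \<le> e" by blast
      have sq: "sq_int (\<lambda>x. Z W x + q x)" by (intro sq_int_add sZ sq_int_even_modes[OF q(1)])
      \<comment> \<open>The comparison lemma holds for each large \<open>j\<close> with the fixed
        \<open>q\<close>; every term in it is a continuous function of square integrals that
        converge.\<close>
      have "G - H \<le> sqrt (Q (\<lambda>x. u x - (Z W x + q x))) * sqrt (2 * G + 2 * H)"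
      proof (rule tendsto_le)
        have Gj: "(\<lambda>j. Q (\<lambda>\<theta>. w j \<theta> - f \<theta>)) \<longlonglongrightarrow> G"
          unfolding Q_def G_def by (rule integral_square_tendsto[OF mw mu sf bd_ev lim])
        then show "(\<lambda>j. Q (\<lambda>\<theta>. w j \<theta> - f \<theta>) - H) \<longlonglongrightarrow> G - H" by (intro tendsto_intros)
        have "(\<lambda>j. Q (\<lambda>x. w j x - (Z W x + q x))) \<longlonglongrightarrow> Q (\<lambda>x. u x - (Z W x + q x))"
          unfolding Q_def by (rule integral_square_tendsto[OF mw mu sq bd_ev lim])
        then show "(\<lambda>j. sqrt (Q (\<lambda>x. w j x - (Z W x + q x))) * sqrt (2 * Q (\<lambda>\<theta>. w j \<theta> - f \<theta>) + 2 * H))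
            \<longlonglongrightarrow> sqrt (Q (\<lambda>x. u x - (Z W x + q x))) * sqrt (2 * G + 2 * H)"
          using Gj by (intro tendsto_intros)
        have "eventually (\<lambda>j. M (r j) \<ge> M0) sequentially" "eventually (\<lambda>j. k (r j) \<ge> length W) sequentially"
          using Mr kr by (simp_all add: filterlim_at_top)
        then show "eventually (\<lambda>j. Q (\<lambda>\<theta>. w j \<theta> - f \<theta>) - H \<le>
            sqrt (Q (\<lambda>x. w j x - (Z W x + q x))) * sqrt (2 * Q (\<lambda>\<theta>. w j \<theta> - f \<theta>) + 2 * H)) sequentially"
        proof eventually_elim
          case (elim j)
          \<comment> \<open>Minimality only compares lists of the same length; zero vectors supply
            the missing entries without changing the set.\<close>
          define W' where "W' = W @ replicate (k (r j) - length W) 0"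
          have "Z W' = Z W" by (simp add: Z_def[abs_def] W'_def zonotope_append_replicate_0)
          moreover have "length W' = k (r j)" using elim(2) by (simp add: W'_def)
          ultimately have le: "Q (even_proj (M (r j)) (\<lambda>\<theta>. w j \<theta> - f \<theta>)) \<le> Q (even_proj (M (r j)) (\<lambda>\<theta>. Z
              W \<theta> - f \<theta>))"
            using min_le[of W' "k (r j)" "M (r j)"] by (simp add: w_def)
          have qj: "q \<in> even_modes (M (r j))" using even_modes_mono[OF elim(1)] q(1) by blast
          have "sq_int (\<lambda>\<theta>. w j \<theta> - f \<theta>)" unfolding w_def by (rule sg)
          from even_proj_comparison[OF this sg qj, of W, folded Q_def, OF le]
          show ?case by (simp add: H_def algebra_simps)
        qed
      qed simp
      also have "\<dots> \<le> (sqrt (2 * pi) * e) * sqrt (2 * G + 2 * H)"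
      proof (rule mult_right_mono)
        have "Q (\<lambda>x. u x - (Z W x + q x)) \<le> (\<integral>x. e\<^sup>2 \<partial>circ)"
          unfolding Q_def
        proof (rule integral_mono)
          show "(u x - (Z W x + q x))\<^sup>2 \<le> e\<^sup>2" for x
            using q(2)[of x] e abs_le_square_iff[of "u x - (Z W x + q x)" e] by (simp add: algebra_simps)
          show "integrable circ (\<lambda>x. (u x - (Z W x + q x))\<^sup>2)"
            by (intro integrable_circ_continuous continuous_intros cu cZ continuous_even_modes[OF q(1)])
        qed (simp add: integrable_circ_continuous)
        also have "\<dots> = 2 * pi * e\<^sup>2" by (simp add: measure_circ)
        finally have "sqrt (Q (\<lambda>x. u x - (Z W x + q x))) \<le> sqrt (2 * pi * e\<^sup>2)" by (rule real_sqrt_le_mono)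
        then show "sqrt (Q (\<lambda>x. u x - (Z W x + q x))) \<le> sqrt (2 * pi) * e"
          using e by (simp add: real_sqrt_mult)
      qed (use GH in simp)
      finally show ?thesis by (simp add: mult_ac)
    qed
    from le_of_le_mult_eps[OF this] show ?thesis by (simp add: G_def H_def)
  qed

  have opt: "Q (\<lambda>\<theta>. u \<theta> - f \<theta>) \<le> Q (\<lambda>\<theta>. excluded_area \<theta> N - f \<theta>)" if N: "zonoid N" for N
  proof -
    obtain W where N: "compact N" "N \<noteq> {}" and W: "(\<lambda>n. hausdorff_dist (zonotope (W n)) N) \<longlonglongrightarrow> 0"
      using N unfolding zonoid_def by blast
    have limN: "(\<lambda>n. Z (W n) \<theta>) \<longlonglongrightarrow> excluded_area \<theta> N" for \<theta>
      unfolding Z_def by (rule excluded_area_tendsto[OF N W])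
    obtain R' where "eventually (\<lambda>n. (\<Sum>v\<leftarrow>W n. norm v) \<le> R') sequentially"
      using hausdorff_limit_sum_norm_bounded[OF N W] by blast
    then have bdN: "eventually (\<lambda>n. \<forall>\<theta>. \<bar>Z (W n) \<theta>\<bar> \<le> 3 * R'\<^sup>2) sequentially"
      by eventually_elim (simp add: Z_def excluded_area_bound)
    \<comment> \<open>For a general zonoid, measurability in the angle comes from pointwise
      approximation by zonotopes.\<close>
    have "(\<lambda>\<theta>. excluded_area \<theta> N) \<in> borel_measurable circ"
      by (rule borel_measurable_LIMSEQ_metric[OF mZ limN])
    from integral_square_tendsto[OF mZ this sf bdN limN]
    have "(\<lambda>n. Q (\<lambda>\<theta>. Z (W n) \<theta> - f \<theta>)) \<longlonglongrightarrow> Q (\<lambda>\<theta>. excluded_area \<theta> N - f \<theta>)" unfolding Q_def .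
    then show ?thesis by (rule LIMSEQ_le_const) (use opt_zonotope in blast)
  qed

  have inf: "(Lp_norm 2 (\<lambda>\<theta>. excluded_area \<theta> K - f \<theta>))\<^sup>2 =
      (INF N\<in>{N. zonoid N}. (Lp_norm 2 (\<lambda>\<theta>. excluded_area \<theta> N - f \<theta>))\<^sup>2)"
  proof (rule antisym)
    show "(Lp_norm 2 (\<lambda>\<theta>. excluded_area \<theta> K - f \<theta>))\<^sup>2 \<le>
        (INF N\<in>{N. zonoid N}. (Lp_norm 2 (\<lambda>\<theta>. excluded_area \<theta> N - f \<theta>))\<^sup>2)"
      using zon opt by (intro cINF_greatest) (auto simp: Lp_norm_2_sq Q_def u_def)
    show "(INF N\<in>{N. zonoid N}. (Lp_norm 2 (\<lambda>\<theta>. excluded_area \<theta> N - f \<theta>))\<^sup>2) \<le>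
        (Lp_norm 2 (\<lambda>\<theta>. excluded_area \<theta> K - f \<theta>))\<^sup>2"
      using zon by (intro cINF_lower bdd_belowI2[of _ 0]) auto
  qed

  have exact: "AE \<theta> in circ. f \<theta> = excluded_area \<theta> K" if N: "zonoid N" "AE \<theta> in circ. f \<theta> =
      excluded_area \<theta> N" for N
  proof -
    \<comment> \<open>An exact zonoid makes the infimum zero, so the optimal error vanishes and its
      integrand is zero almost everywhere.\<close>
    have "Q (\<lambda>\<theta>. excluded_area \<theta> N - f \<theta>) = 0"
      unfolding Q_def by (rule integral_eq_zero_AE) (use N(2) in \<open>eventually_elim, simp\<close>)
    then have "Q (\<lambda>\<theta>. u \<theta> - f \<theta>) = 0"
      using opt[OF N(1)] by (simp add: Q_def antisym)
    then have "AE \<theta> in circ. (u \<theta> - f \<theta>)\<^sup>2 = 0"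
      using su unfolding Q_def sq_int_def by (subst (asm) integral_nonneg_eq_0_iff_AE) auto
    then show ?thesis by eventually_elim (simp add: u_def)
  qed

  have w_eq: "(\<lambda>j \<theta>. excluded_area \<theta> (zonotope (V (M (r j)) (k (r j))))) = w"
    by (intro ext) (simp add: w_def Z_def)
  have u_eq: "(\<lambda>\<theta>. excluded_area \<theta> K) = u"
    by (intro ext) (simp add: u_def)
  show ?thesis
  proof (intro exI[of _ r] exI[of _ K] conjI allI impI)
    show "weakstar_W1inf (\<lambda>j \<theta>. excluded_area \<theta> (zonotope (V (M (r j)) (k (r j))))) (\<lambda>\<theta>. excluded_area \<theta> K)"
      unfolding w_eq u_eq by (rule weakstar_W1inf_limit[OF sc u lim bd])
    show "tendsto_W1p p (\<lambda>j \<theta>. excluded_area \<theta> (zonotope (V (M (r j)) (k (r j))))) (\<lambda>\<theta>. excluded_area \<theta> K)"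
      if "1 \<le> p" for p
      unfolding w_eq u_eq by (rule tendsto_W1p_limit[OF sc u lim bd that])
    show "weakstar_second_deriv (\<lambda>j \<theta>. excluded_area \<theta> (zonotope (V (M (r j)) (k (r j))))) (\<lambda>\<theta>.
        excluded_area \<theta> K)"
      unfolding w_eq u_eq by (rule weakstar_second_deriv_limit[OF sc u lim bd])
    show "AE \<theta> in circ. f \<theta> = excluded_area \<theta> K" if "\<exists>N. zonoid N \<and> (AE \<theta> in circ. f \<theta> = excluded_area \<theta> N)"
      using that exact by blast
  qed (fact r zon haus inf)+
qed

end
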